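(* Let $p=\hat u_0\,\hat u_1^{\ell_1}\cdots\hat u_k^{\ell_k}$ be an irreducible polynomial factorization, where $\hat u_j$ belongs to a proper hosting space $\mathcal{U}_j$ for $j=0,\ldots,k$ and $\mathcal{U}_0=\mathbb{C}$. Let $\mathcal{P}\ni p$ be a vector space containing all products $u_0\,u_1^{\ell_1}\cdots u_k^{\ell_k}$ for $u_j\in\mathcal{U}_j$, $j=0,\ldots,k$. Define $$\mathbf{f}:\mathcal{U}_0\times\mathcal{U}_1\times\cdots\times\mathcal{U}_k\times\mathcal{P}\to\mathcal{P},\qquad (u_0,u_1,\ldots,u_k,f)\mapsto u_0\,u_1^{\ell_1}\cdots u_k^{\ell_k}-f,$$ and set $r=\dim(\mathcal{U}_0\times\cdots\times\mathcal{U}_k)-k$. Then, for any $\tilde p\in\mathcal{P}$ sufficiently close to $p$ as empirical data and from any initial iterate $(u_0^{(0)},\ldots,u_k^{(0)})\in\mathcal{U}_0\times\cdots\times\mathcal{U}_k$ near $(\hat u_0,\ldots,\hat u_k)$, the rank-$r$ Newton's iteration $$\big(u_0^{(j+1)},\ldots,u_k^{(j+1)}\big)=\big(u_0^{(j)},\ldots,u_k^{(j)}\big)-\mathbf{f}_{u_0\cdots u_k}\big(u_0^{(j)},\ldots,u_k^{(j)},\tilde p\big)_{\text{rank-}r}^{\dagger}\,\mathbf{f}\big(u_0^{(j)},\ldots,u_k^{(j)},\tilde p\big),\quad j=0,1,\ldots$$ converges to some $(\tilde u_0,\ldots,\tilde u_k)\in\mathcal{U}_0\times\cdots\times\mathcal{U}_k$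 with the error bound $$\big\|(\tilde u_0,\ldots,\tilde u_k)-(\check u_0,\ldots,\check u_k)\big\|_2\le\alpha\,\big\|\mathbf{f}_{u_0\cdots u_k}(\hat u_0,\ldots,\hat u_k,p)_{\text{rank-}r}^{\dagger}\big\|\,\|\tilde p-p\|+O(\|\tilde p-p\|^2),$$ where $(\check u_0,\ldots,\check u_k)$ is an exact factor array of $p$ in the set $$\big\{(t_0\hat u_0,t_1\hat u_1,\ldots,t_k\hat u_k)\;\big|\;t_1,\ldots,t_k\in\mathbb{C}\setminus\{0\},\ t_0=t_1^{-\ell_1}\cdots t_k^{-\ell_k}\big\}$$ and $\alpha>0$ is a constant of moderate size. The convergence is quadratic if $\tilde p=p$. The norm $\big\|\mathbf{f}_{u_0\cdots u_k}(\hat u_0,\ldots,\hat u_k,p)_{\text{rank-}r}^{\dagger}\big\|$ can be defined as the factorization condition number of $p$.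
   Context: Here $p$ is a (multivariate) complex polynomial, $\ell_1,\ldots,\ell_k>0$ are integers, $\hat u_0\in\mathbb{C}$, and the factors $\hat u_1,\ldots,\hat u_k$ are nontrivial. A vector space $\mathcal{U}_j$ of polynomials containing $\hat u_j$ is a proper hosting space of $\hat u_j$ if $s\,\hat u_j\in\mathcal{U}_j$ implies that $s$ is a constant. The spaces $\mathcal{U}_j$ and $\mathcal{P}$ are finite-dimensional normed vector spaces of polynomials, isometrically isomorphic to Euclidean spaces $\mathbb{C}^N$ (for example, via the Euclidean norm of the coefficient vector). A product space carries the norm given by the square root of the sum of the squared component norms; this is the norm on the left-hand side of the error bound. Linear maps carry the operator norm. $\mathbf{f}_{u_0\cdots u_k}$ denotes the partial Jacobian of $\mathbf{f}$ with respect to $(u_0,\ldots,u_k)$, a linear map from $\mathcal{U}_0\times\cdots\times\mathcal{U}_k$ to $\mathcal{P}$. For a matrix $A$, the rank-$r$ projection $A_{\text{rank-}r}$ is the rank-$r$ matrix with the smallest Frobenius distance to $A$ (the rank-$r$ truncated SVD), and $A_{\text{rank-}r}^{\dagger}$ is the Moore–Penrose inverse of $A_{\text{rank-}r}$. For linear maps, the rank-$r$ projection and its Moore–Penrose inverse are defined through the matrix representation with respect to isometric isomorphisms with Euclidean spaces. *)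

theory Defs
  imports
    "HOL-Analysis.Analysis"
    "HOL-Library.Poly_Mapping"
    "HOL-Library.Function_Algebras"
    "HOL-Computational_Algebra.Factorial_Ring"
begin

text \<open>
  Complex polynomials in the variables \<open>x\<^sub>0, x\<^sub>1, \<dots>\<close>: a monomial is an exponent vector
  \<open>nat \<Rightarrow>\<^sub>0 nat\<close>, and every polynomial involves only finitely many variables.
\<close>

type_synonym cpoly = "(nat \<Rightarrow>\<^sub>0 nat) \<Rightarrow>\<^sub>0 complex"

definition Const :: "complex \<Rightarrow> cpoly" where
  "Const c = Poly_Mapping.single 0 c"

definition cp_scale :: "complex \<Rightarrow> cpoly \<Rightarrow> cpoly" where
  "cp_scale c q = Const c * q"

lemma Const_add: "Const (a + b) = Const a + Const b"
  by (simp add: Const_def single_add)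

lemma Const_mult: "Const (a * b) = Const a * Const b"
  by (simp add: Const_def mult_single)

lemma Const_1: "Const 1 = 1"
  by (simp add: Const_def)

global_interpretation cp: vector_space cp_scale
  by unfold_locales
    (simp_all add: cp_scale_def Const_add Const_mult Const_1 distrib_left distrib_right mult.assoc)

text \<open>
  An array \<open>(u\<^sub>0, \<dots>, u\<^sub>k)\<close> is a function on \<open>nat\<close> that vanishes beyond \<open>k\<close>; arrays carry the
  pointwise vector space structure.
\<close>

type_synonym cpoly_array = "nat \<Rightarrow> cpoly"

definition arr_scale :: "complex \<Rightarrow> cpoly_array \<Rightarrow> cpoly_array" where
  "arr_scale c u = (\<lambda>j. cp_scale c (u j))"

global_interpretation arr: vector_space arr_scale
  by unfold_locales
    (simp_all add: arr_scale_def fun_eq_iff cp.scale_right_distrib cp.scale_left_distrib)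

definition product_space :: "nat \<Rightarrow> (nat \<Rightarrow> cpoly set) \<Rightarrow> cpoly_array set" where
  "product_space k U = {u. (\<forall>j\<le>k. u j \<in> U j) \<and> (\<forall>j>k. u j = 0)}"

definition product_norm :: "nat \<Rightarrow> (nat \<Rightarrow> cpoly \<Rightarrow> real) \<Rightarrow> cpoly_array \<Rightarrow> real" where
  "product_norm k nU u = L2_set (\<lambda>j. nU j (u j)) {0..k}"

text \<open>
  \<open>V\<close> with the norm \<open>nrm\<close> is isometrically isomorphic to some \<open>\<complex>\<^sup>N\<close>.  The dimension \<open>N\<close> is
  existentially quantified, so \<open>\<complex>\<^sup>N\<close> is represented by coefficient functions on \<open>{..<N}\<close>; the
  isomorphism sends the standard basis to \<open>b 0, \<dots>, b (N - 1)\<close>.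
\<close>

definition euclidean_on :: "cpoly set \<Rightarrow> (cpoly \<Rightarrow> real) \<Rightarrow> bool" where
  "euclidean_on V nrm \<longleftrightarrow>
     (\<exists>(N::nat) b. V = range (\<lambda>c. \<Sum>i<N. cp_scale (c i) (b i)) \<and>
            (\<forall>c. nrm (\<Sum>i<N. cp_scale (c i) (b i)) = L2_set (\<lambda>i. cmod (c i)) {..<N}))"

definition isometric_iso ::
    "(complex \<Rightarrow> 'b::ab_group_add \<Rightarrow> 'b) \<Rightarrow> ('b \<Rightarrow> real) \<Rightarrow> 'b set \<Rightarrow> (complex^'n \<Rightarrow> 'b) \<Rightarrow> bool" where
  "isometric_iso scl nrm V \<phi> \<longleftrightarrow>
     Vector_Spaces.linear (*s) scl \<phi> \<and> bij_betw \<phi> UNIV V \<and> (\<forall>x. nrm (\<phi> x) = norm x)"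

definition operator_norm_on ::
    "'a set \<Rightarrow> ('a \<Rightarrow> real) \<Rightarrow> ('b \<Rightarrow> real) \<Rightarrow> ('a \<Rightarrow> 'b) \<Rightarrow> real" where
  "operator_norm_on V nV nW T = (SUP v\<in>{v \<in> V. nV v \<le> 1}. nW (T v))"

definition conj_transpose :: "complex^'n^'m \<Rightarrow> complex^'m^'n" where
  "conj_transpose A = (\<chi> i j. cnj (A $ j $ i))"

text \<open>The Moore--Penrose inverse, characterised by the four Penrose equations.\<close>

definition mp_inverse :: "complex^'n^'m \<Rightarrow> complex^'m^'n" where
  "mp_inverse A =
     (THE X. A ** X ** A = A \<and> X ** A ** X = X \<and>
             conj_transpose (A ** X) = A ** X \<and> conj_transpose (X ** A) = X ** A)"

text \<open>The norm of the type \<^typ>\<open>complex^'n^'m\<close> is the Frobenius norm.\<close>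

definition is_rank_projection :: "nat \<Rightarrow> complex^'n^'m \<Rightarrow> complex^'n^'m \<Rightarrow> bool" where
  "is_rank_projection r A B \<longleftrightarrow>
     rank B = r \<and> (\<forall>C. rank C = r \<longrightarrow> norm (A - B) \<le> norm (A - C))"

definition rank_projection :: "nat \<Rightarrow> complex^'n^'m \<Rightarrow> complex^'n^'m" where
  "rank_projection r A = (SOME B. is_rank_projection r A B)"

text \<open>
  \<open>\<phi>\<close> and \<open>\<psi>\<close> are isometric isomorphisms from Euclidean spaces onto the domain and the codomain
  of a map.  The derivative of \<open>g\<close> at \<open>u\<close> is taken in these coordinates.  It is the real
  Frechet derivative of the library; for a holomorphic \<open>g\<close> it is complex linear.
\<close>

definition derivative_map ::
    "(complex^'n \<Rightarrow> 'a) \<Rightarrow> (complex^'m \<Rightarrow> 'b) \<Rightarrow> ('a \<Rightarrow> 'b) \<Rightarrow> 'a \<Rightarrow> 'a \<Rightarrow> 'b" where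
  "derivative_map \<phi> \<psi> g u =
     \<psi> \<circ> frechet_derivative (inv \<psi> \<circ> g \<circ> \<phi>) (at (inv \<phi> u)) \<circ> inv \<phi>"

definition matrix_rep ::
    "(complex^'n \<Rightarrow> 'a) \<Rightarrow> (complex^'m \<Rightarrow> 'b) \<Rightarrow> ('a \<Rightarrow> 'b) \<Rightarrow> complex^'n^'m" where
  "matrix_rep \<phi> \<psi> L = matrix (inv \<psi> \<circ> L \<circ> \<phi>)"

definition rank_pinv_map ::
    "(complex^'n \<Rightarrow> 'a) \<Rightarrow> (complex^'m \<Rightarrow> 'b) \<Rightarrow> nat \<Rightarrow> ('a \<Rightarrow> 'b) \<Rightarrow> 'b \<Rightarrow> 'a" where
  "rank_pinv_map \<phi> \<psi> r L =
     \<phi> \<circ> (\<lambda>y. mp_inverse (rank_projection r (matrix_rep \<phi> \<psi> L)) *v y) \<circ> inv \<psi>"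

definition proper_hosting_space :: "cpoly set \<Rightarrow> cpoly \<Rightarrow> bool" where
  "proper_hosting_space V q \<longleftrightarrow>
     cp.subspace V \<and> q \<in> V \<and> (\<forall>s. s * q \<in> V \<longrightarrow> s \<in> range Const)"

definition power_product :: "nat \<Rightarrow> (nat \<Rightarrow> nat) \<Rightarrow> cpoly_array \<Rightarrow> cpoly" where
  "power_product k l u = u 0 * (\<Prod>j=1..k. u j ^ l j)"

text \<open>
  The exponents collect all multiplicities, so the irreducible factors \<open>u\<^sub>1, \<dots>, u\<^sub>k\<close> are pairwise
  distinct up to constant multiples.
\<close>

definition irreducible_factorization ::
    "cpoly \<Rightarrow> nat \<Rightarrow> (nat \<Rightarrow> nat) \<Rightarrow> cpoly_array \<Rightarrow> bool" where
  "irreducible_factorization p k l u \<longleftrightarrow>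
     p = power_product k l u \<and>
     u 0 \<in> range Const \<and> u 0 \<noteq> 0 \<and>
     (\<forall>j\<in>{1..k}. l j > 0 \<and> irreducible (u j)) \<and>
     (\<forall>i\<in>{1..k}. \<forall>j\<in>{1..k}. i \<noteq> j \<longrightarrow> (\<forall>c. u i \<noteq> cp_scale c (u j)))"

definition factor_arrays :: "nat \<Rightarrow> (nat \<Rightarrow> nat) \<Rightarrow> cpoly_array \<Rightarrow> cpoly_array set" where
  "factor_arrays k l u =
     {(\<lambda>j. cp_scale (t j) (u j)) | t.
        (\<forall>j\<in>{1..k}. t j \<noteq> 0) \<and> t 0 = (\<Prod>j=1..k. t j powi (- int (l j)))}"

definition factor_map :: "nat \<Rightarrow> (nat \<Rightarrow> nat) \<Rightarrow> cpoly_array \<Rightarrow> cpoly \<Rightarrow> cpoly" where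
  "factor_map k l u f = power_product k l u - f"

definition partial_jacobian ::
    "(complex^'n \<Rightarrow> cpoly_array) \<Rightarrow> (complex^'m \<Rightarrow> cpoly) \<Rightarrow> nat \<Rightarrow> (nat \<Rightarrow> nat) \<Rightarrow>
     cpoly_array \<Rightarrow> cpoly \<Rightarrow> cpoly_array \<Rightarrow> cpoly" where
  "partial_jacobian \<phi> \<psi> k l u f = derivative_map \<phi> \<psi> (\<lambda>v. factor_map k l v f) u"

definition newton_step ::
    "(complex^'n \<Rightarrow> cpoly_array) \<Rightarrow> (complex^'m \<Rightarrow> cpoly) \<Rightarrow> nat \<Rightarrow> (nat \<Rightarrow> nat) \<Rightarrow> nat \<Rightarrow>
     cpoly \<Rightarrow> cpoly_array \<Rightarrow> cpoly_array" where
  "newton_step \<phi> \<psi> k l r f u =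
     u - rank_pinv_map \<phi> \<psi> r (partial_jacobian \<phi> \<psi> k l u f) (factor_map k l u f)"

definition newton_iterate ::
    "(complex^'n \<Rightarrow> cpoly_array) \<Rightarrow> (complex^'m \<Rightarrow> cpoly) \<Rightarrow> nat \<Rightarrow> (nat \<Rightarrow> nat) \<Rightarrow> nat \<Rightarrow>
     cpoly \<Rightarrow> cpoly_array \<Rightarrow> nat \<Rightarrow> cpoly_array" where
  "newton_iterate \<phi> \<psi> k l r f u j = (newton_step \<phi> \<psi> k l r f ^^ j) u"

definition factorization_condition_number ::
    "(complex^'n \<Rightarrow> cpoly_array) \<Rightarrow> (complex^'m \<Rightarrow> cpoly) \<Rightarrow> nat \<Rightarrow> (nat \<Rightarrow> nat) \<Rightarrow> nat \<Rightarrow>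
     (nat \<Rightarrow> cpoly \<Rightarrow> real) \<Rightarrow> cpoly set \<Rightarrow> (cpoly \<Rightarrow> real) \<Rightarrow> cpoly_array \<Rightarrow> cpoly \<Rightarrow> real" where
  "factorization_condition_number \<phi> \<psi> k l r nU P nP u p =
     operator_norm_on P nP (product_norm k nU)
       (rank_pinv_map \<phi> \<psi> r (partial_jacobian \<phi> \<psi> k l u p))"

end

theory Submission
  imports Defs "HOL-Computational_Algebra.Polynomial"
begin

text \<open>
  The scalings \<open>(t\<^sub>0 u\<^sub>0, \<dots>, t\<^sub>k u\<^sub>k)\<close> with \<open>t\<^sub>0 = (\<Prod>j\<ge>1. t\<^sub>j powi - l\<^sub>j)\<close> leave the product unchanged, so the
  Jacobian has a kernel of dimension at least \<open>k\<close> at every array with nonzero factors.  At the exact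
  factor array the kernel is not larger: if the derivative in direction \<open>v\<close> vanishes, then
  \<open>u\<^sub>j\<close> divides \<open>v\<^sub>j\<close> because irreducible polynomials are prime (Gauss), and the proper hosting
  spaces force the quotient to be constant.  Hence the Jacobian \<open>J\<close> has rank exactly \<open>r\<close> near the
  factor array, the rank-\<open>r\<close> projection is \<open>J\<close> itself, and with the kernel vectors \<open>T\<close> one has
  the smooth formula \<open>(J\<^sup>* J + T T\<^sup>*)\<^sup>-\<^sup>1 J\<^sup>*\<close> for the Moore--Penrose inverse.  The iteration is then a
  Gauss--Newton iteration of constant rank, whose steps shrink geometrically.  The limit is compared
  with the nearest point of the orbit of exact factor arrays; the difference is orthogonal to the
  kernel of the Jacobian there, so it is controlled by the Moore--Penrose inverse alone.  The constant
  \<open>\<alpha> = 4\<close> works, even without quadratic term.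
\<close>

section \<open>Polynomials in finitely many variables\<close>

text \<open>For k > 0 the exact factor arrays are not isolated, and perturbed data
  \<open>p_tilde\<close> need not be a product at all. So the Jacobian cannot be inverted, and the
  residual need not vanish in the limit; only the Newton step does. Two identities replace
  invertibility. M J M = M removes from the next step the part of the residual that J leaves over,
  so the steps contract without reference to any exact solution. M J d = d for d orthogonal to the
  orbit turns the residual into the distance from a nearest exact array. Both uses need M to vary in
  a Lipschitz way. Moore-Penrose inverses are discontinuous where the rank jumps, hence the constant
  rank and a formula with an ordinary inverse. The constant 4 is 2 times 2: the distance to the
  nearest array is at most twice the image of the data error under M at the limit, and that image is
  at most twice the bound given by the norm of M at the exact array. Primality is proved by
  induction on the number of variables, with pseudo-division in the newest variable in place of
  division over a field of fractions.\<close>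

definition vars_below :: "nat \<Rightarrow> cpoly set" where
  "vars_below n = {f. \<forall>m\<in>Poly_Mapping.keys f. \<forall>i\<ge>n. Poly_Mapping.lookup m i = 0}"

definition Var :: "nat \<Rightarrow> cpoly" where
  "Var n = Poly_Mapping.single (Poly_Mapping.single n 1) 1"

lemma sum_monomials: "(\<Sum>k\<in>Poly_Mapping.keys f. Poly_Mapping.single k (Poly_Mapping.lookup f k)) = (f :: cpoly)"
  by (rule poly_mapping_eqI) (auto simp: lookup_sum lookup_single when_def in_keys_iff)

lemma vars_below_lookup:
  assumes "f \<in> vars_below n" "Poly_Mapping.lookup m i \<noteq> 0" "n \<le> i"
  shows "Poly_Mapping.lookup f m = 0"
proof (rule ccontr)
  assume "Poly_Mapping.lookup f m \<noteq> 0"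
  then have "m \<in> Poly_Mapping.keys f" by (simp add: in_keys_iff)
  with assms(1) have "\<forall>i\<ge>n. Poly_Mapping.lookup m i = 0" by (simp add: vars_below_def)
  with assms(2,3) show False by simp
qed

lemma vars_below_single:
  "(\<And>i. i \<ge> n \<Longrightarrow> Poly_Mapping.lookup m i = 0) \<Longrightarrow> Poly_Mapping.single m c \<in> vars_below n"
  by (auto simp: vars_below_def)

lemma vars_below_Const [simp]: "Const c \<in> vars_below n"
  unfolding Const_def by (rule vars_below_single) simp

lemma vars_below_0 [simp]: "0 \<in> vars_below n"
  by (simp add: vars_below_def)

lemma vars_below_1 [simp]: "1 \<in> vars_below n"
  by (metis Const_1 vars_below_Const)

lemma vars_below_add: "f \<in> vars_below n \<Longrightarrow> g \<in> vars_below n \<Longrightarrow> f + g \<in> vars_below n"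
  using Poly_Mapping.keys_add[of f g] by (fastforce simp: vars_below_def)

lemma vars_below_mult: "f \<in> vars_below n \<Longrightarrow> g \<in> vars_below n \<Longrightarrow> f * g \<in> vars_below n"
  using keys_mult[of f g] by (fastforce simp: vars_below_def lookup_add)

lemma vars_below_uminus: "f \<in> vars_below n \<Longrightarrow> - f \<in> vars_below n"
  by (simp add: vars_below_def in_keys_iff)

lemma vars_below_diff: "f \<in> vars_below n \<Longrightarrow> g \<in> vars_below n \<Longrightarrow> f - g \<in> vars_below n"
  using vars_below_add[of f n "- g"] vars_below_uminus by simp

lemma vars_below_sum: "(\<And>i. i \<in> A \<Longrightarrow> f i \<in> vars_below n) \<Longrightarrow> sum f A \<in> vars_below n"
  by (induction A rule: infinite_finite_induct) (auto intro: vars_below_add)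

lemma vars_below_power: "f \<in> vars_below n \<Longrightarrow> f ^ i \<in> vars_below n"
  by (induction i) (auto intro: vars_below_mult)

lemma vars_below_mono: "n \<le> m \<Longrightarrow> vars_below n \<subseteq> vars_below m"
  by (auto simp: vars_below_def)

lemma vars_below_Var: "i < n \<Longrightarrow> Var i \<in> vars_below n"
  unfolding Var_def by (rule vars_below_single) (auto simp: lookup_single when_def)

lemma vars_below_zero_const: "f \<in> vars_below 0 \<Longrightarrow> f \<in> range Const"
proof -
  assume f: "f \<in> vars_below 0"
  have k: "k = 0" if "k \<in> Poly_Mapping.keys f" for k
    using f that by (intro poly_mapping_eqI) (auto simp: vars_below_def)
  have "f = Const (Poly_Mapping.lookup f 0)"
    using k by (intro poly_mapping_eqI) (force simp: Const_def lookup_single when_def in_keys_iff)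
  then show ?thesis by blast
qed

lemma ex_vars_below: "\<exists>n. f \<in> vars_below n"
proof -
  \<comment> \<open>A crude bound: one more than the sum of all variable indices over all monomials,
    so it exceeds every single index.\<close>
  define n where "n = Suc (\<Sum>m\<in>Poly_Mapping.keys f. \<Sum>i\<in>Poly_Mapping.keys m. i)"
  have "Poly_Mapping.lookup m i = 0" if m: "m \<in> Poly_Mapping.keys f" and i: "i \<ge> n" for m i
  proof (rule ccontr)
    assume "Poly_Mapping.lookup m i \<noteq> 0"
    then have "i \<in> Poly_Mapping.keys m" by (simp add: in_keys_iff)
    then have "i \<le> (\<Sum>i\<in>Poly_Mapping.keys m. i)"
      using member_le_sum[of i "Poly_Mapping.keys m" "\<lambda>i. i"] by simp
    also have "\<dots> \<le> (\<Sum>m\<in>Poly_Mapping.keys f. \<Sum>i\<in>Poly_Mapping.keys m. i)"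
      using m by (intro member_le_sum[where f = "\<lambda>m. \<Sum>i\<in>Poly_Mapping.keys m. i"]) auto
    finally show False using i n_def by simp
  qed
  then show ?thesis by (auto simp: vars_below_def)
qed

section \<open>Splitting off the newest variable: \<open>vars_below (Suc n)\<close> as a univariate
  polynomial ring\<close>

definition polys_over :: "nat \<Rightarrow> cpoly poly set" where
  "polys_over n = {F. \<forall>i. coeff F i \<in> vars_below n}"

lemma polys_over_add: "F \<in> polys_over n \<Longrightarrow> G \<in> polys_over n \<Longrightarrow> F + G \<in> polys_over n"
  by (simp add: polys_over_def vars_below_add)

lemma polys_over_diff: "F \<in> polys_over n \<Longrightarrow> G \<in> polys_over n \<Longrightarrow> F - G \<in> polys_over n"
  by (simp add: polys_over_def vars_below_diff)

lemma polys_over_mult: "F \<in> polys_over n \<Longrightarrow> G \<in> polys_over n \<Longrightarrow> F * G \<in> polys_over n"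
  by (simp add: polys_over_def coeff_mult vars_below_sum vars_below_mult)

lemma polys_over_smult: "c \<in> vars_below n \<Longrightarrow> G \<in> polys_over n \<Longrightarrow> smult c G \<in> polys_over n"
  by (simp add: polys_over_def vars_below_mult)

lemma polys_over_monom: "c \<in> vars_below n \<Longrightarrow> monom c i \<in> polys_over n"
  by (simp add: polys_over_def)

lemma polys_over_0: "0 \<in> polys_over n"
  by (simp add: polys_over_def)

lemma Var_power: "Var n ^ i = Poly_Mapping.single (Poly_Mapping.single n i) 1"
proof (induction i)
  case (Suc i)
  then show ?case
    by (simp add: Var_def mult_single flip: single_add)
qed simp

lemma poly_Var_vars_below: "F \<in> polys_over n \<Longrightarrow> poly F (Var n) \<in> vars_below (Suc n)"
  unfolding poly_altdef polys_over_def
  using vars_below_mono[of n "Suc n"]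
  by (auto intro!: vars_below_sum vars_below_mult vars_below_power vars_below_Var)

lemma lookup_mult_monomial:
  "Poly_Mapping.lookup (f * Poly_Mapping.single a 1) q =
     (\<Sum>k\<in>Poly_Mapping.keys f. if k + a = q then Poly_Mapping.lookup (f :: cpoly) k else 0)"
proof -
  have "f * Poly_Mapping.single a 1 = (\<Sum>k\<in>Poly_Mapping.keys f. Poly_Mapping.single (k + a) (Poly_Mapping.lookup f k))"
    by (subst sum_monomials[of f, symmetric]) (simp add: sum_distrib_right mult_single)
  then show ?thesis by (simp add: lookup_sum lookup_single when_def)
qed

text \<open>The coefficients of \<open>F\<close> are free of variable \<open>n\<close>, so the
  exponent of \<open>n\<close> in a monomial tells which power of \<open>Var n\<close> it comes
  from, and different powers do not mix. Evaluation at \<open>Var n\<close> is therefore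
  injective.\<close>

lemma lookup_poly_Var:
  assumes "F \<in> polys_over n" "Poly_Mapping.lookup m n = 0"
  shows "Poly_Mapping.lookup (poly F (Var n)) (m + Poly_Mapping.single n i) = Poly_Mapping.lookup (coeff F i) m"
proof -
  have *: "Poly_Mapping.lookup (coeff F j * Var n ^ j) (m + Poly_Mapping.single n i)
      = (if j = i then Poly_Mapping.lookup (coeff F i) m else 0)" for j
  proof -
    have "(k + Poly_Mapping.single n j = m + Poly_Mapping.single n i) \<longleftrightarrow> (j = i \<and> k = m)"
      if "k \<in> Poly_Mapping.keys (coeff F j)" for k
    proof
      assume eq: "k + Poly_Mapping.single n j = m + Poly_Mapping.single n i"
      have "Poly_Mapping.lookup k n = 0" using that assms(1) by (auto simp: polys_over_def vars_below_def)
      then have "j = i" using arg_cong[OF eq, of "\<lambda>k. Poly_Mapping.lookup k n"] assms(2)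
        by (simp add: lookup_add)
      with eq show "j = i \<and> k = m" by simp
    qed auto
    then have "(\<Sum>k\<in>Poly_Mapping.keys (coeff F j). if k + Poly_Mapping.single n j = m + Poly_Mapping.single n i
          then Poly_Mapping.lookup (coeff F j) k else 0)
        = (\<Sum>k\<in>Poly_Mapping.keys (coeff F j). if k = m then (if j = i then Poly_Mapping.lookup (coeff F j) m else 0) else 0)"
      by (intro sum.cong) auto
    then show ?thesis by (auto simp: Var_power lookup_mult_monomial in_keys_iff)
  qed
  show ?thesis
    by (auto simp: poly_altdef lookup_sum * coeff_eq_0)
qed

lemma poly_Var_eq_0:
  assumes "F \<in> polys_over n" "poly F (Var n) = 0" shows "F = 0"
proof (rule poly_eqI, rule poly_mapping_eqI)
  fix i m
  show "Poly_Mapping.lookup (coeff F i) m = Poly_Mapping.lookup (coeff 0 i) m"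
  proof (cases "Poly_Mapping.lookup m n = 0")
    case True
    then show ?thesis using lookup_poly_Var[OF assms(1) True, of i] assms(2) by simp
  next
    case False
    have "coeff F i \<in> vars_below n" using assms(1) by (simp add: polys_over_def)
    from vars_below_lookup[OF this False] show ?thesis by simp
  qed
qed

lemma poly_Var_inj:
  "F \<in> polys_over n \<Longrightarrow> G \<in> polys_over n \<Longrightarrow> poly F (Var n) = poly G (Var n) \<Longrightarrow> F = G"
  using poly_Var_eq_0[of "F - G" n] by (simp add: polys_over_diff)

lemma poly_Var_surj:
  assumes "f \<in> vars_below (Suc n)" shows "\<exists>F\<in>polys_over n. f = poly F (Var n)"
proof -
  have "\<exists>F\<in>polys_over n. (\<Sum>k\<in>A. Poly_Mapping.single k (Poly_Mapping.lookup f k)) = poly F (Var n)"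
    if "finite A" "A \<subseteq> Poly_Mapping.keys f" for A
    using that
  proof (induction A)
    case empty
    then show ?case using polys_over_0 by force
  next
    case (insert k A)
    then obtain F where F: "F \<in> polys_over n"
      "(\<Sum>k\<in>A. Poly_Mapping.single k (Poly_Mapping.lookup f k)) = poly F (Var n)" by auto
    define e where "e = Poly_Mapping.lookup k n"
    define k0 where "k0 = k - Poly_Mapping.single n e"
    have k: "k = k0 + Poly_Mapping.single n e"
      by (rule poly_mapping_eqI) (auto simp: k0_def e_def lookup_add lookup_minus lookup_single when_def)
    have k0: "Poly_Mapping.single k0 c \<in> vars_below n" for c
    proof (rule vars_below_single)
      fix i assume "i \<ge> n"
      then show "Poly_Mapping.lookup k0 i = 0"
        using assms insert.prems
        by (cases "i = n") (auto simp: k0_def e_def lookup_minus lookup_single vars_below_def)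
    qed
    have "Poly_Mapping.single k (Poly_Mapping.lookup f k)
        = poly (monom (Poly_Mapping.single k0 (Poly_Mapping.lookup f k)) e) (Var n)"
      by (simp add: poly_monom Var_power mult_single flip: k)
    then show ?case
      using insert F k0
      by (intro bexI[of _ "monom (Poly_Mapping.single k0 (Poly_Mapping.lookup f k)) e + F"])
        (auto intro!: polys_over_add polys_over_monom)
  qed
  from this[of "Poly_Mapping.keys f"] show ?thesis by (simp add: sum_monomials)
qed

definition top_poly :: "nat \<Rightarrow> cpoly \<Rightarrow> cpoly poly" where
  "top_poly n f = (SOME F. F \<in> polys_over n \<and> poly F (Var n) = f)"

lemma
  assumes "f \<in> vars_below (Suc n)"
  shows top_poly_polys_over: "top_poly n f \<in> polys_over n"
    and top_poly: "poly (top_poly n f) (Var n) = f"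
proof -
  have "\<exists>F. F \<in> polys_over n \<and> poly F (Var n) = f" using poly_Var_surj[OF assms] by blast
  from someI_ex[OF this] show "top_poly n f \<in> polys_over n" "poly (top_poly n f) (Var n) = f"
    by (simp_all add: top_poly_def)
qed

lemma top_poly_eq: "F \<in> polys_over n \<Longrightarrow> top_poly n (poly F (Var n)) = F"
  using top_poly top_poly_polys_over poly_Var_vars_below poly_Var_inj by blast

text \<open>Degrees in the newest variable add up over an integral domain. The product has degree 0,
  hence so has each factor.\<close>

lemma vars_below_factor_step:
  assumes "f \<in> vars_below (Suc n)" "g \<in> vars_below (Suc n)" "f * g \<in> vars_below n" "f * g \<noteq> 0"
  shows "f \<in> vars_below n"
proof -
  obtain F G where FG: "F \<in> polys_over n" "f = poly F (Var n)" "G \<in> polys_over n" "g = poly G (Var n)"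
    using assms poly_Var_surj by metis
  have "F * G = [:f * g:]"
    using FG assms(3) polys_over_monom[of "f * g" n 0]
    by (intro poly_Var_inj[of _ n]) (simp_all add: polys_over_mult monom_0)
  moreover have "F \<noteq> 0" "G \<noteq> 0" using FG assms(4) by auto
  ultimately have "Polynomial.degree F = 0" by (metis add_is_0 degree_mult_eq degree_pCons_0)
  then obtain c where "F = [:c:]" by (rule degree_eq_zeroE)
  then show ?thesis using FG by (auto simp: polys_over_def) (metis coeff_pCons_0)
qed

text \<open>Start from a bound on the variables of both factors and lower it one variable at a time.
  Both factors descend together, because each single step asks for the bound on the other
  one.\<close>

lemma vars_below_factor:
  assumes "f * g \<in> vars_below n" "f * g \<noteq> 0"
  shows "f \<in> vars_below n"
proof -
  obtain a b where "f \<in> vars_below a" "g \<in> vars_below b" using ex_vars_below by metis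
  then have *: "f \<in> vars_below (n + (a + b))" "g \<in> vars_below (n + (a + b))"
    using vars_below_mono[of a "n + (a + b)"] vars_below_mono[of b "n + (a + b)"] by auto
  have "f \<in> vars_below (n + d) \<Longrightarrow> g \<in> vars_below (n + d) \<Longrightarrow> f \<in> vars_below n" for d
  proof (induction d)
    case (Suc d)
    have "f * g \<in> vars_below (n + d)" using assms vars_below_mono[of n "n + d"] by auto
    then show ?case using Suc vars_below_factor_step[of f "n + d" g] vars_below_factor_step[of g "n + d" f] assms
      by (simp add: mult.commute)
  qed simp
  then show ?thesis using * by blast
qed

lemma vars_below_factor_right: "f * g \<in> vars_below n \<Longrightarrow> f * g \<noteq> 0 \<Longrightarrow> g \<in> vars_below n"
  using vars_below_factor[of g f n] by (simp add: mult.commute)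

lemma vars_below_dvd: "f dvd g \<Longrightarrow> g \<in> vars_below n \<Longrightarrow> g \<noteq> 0 \<Longrightarrow> f \<in> vars_below n"
  using vars_below_factor by (auto elim!: dvdE)

section \<open>An additive degree, and the units\<close>

definition additive_degree :: "nat \<Rightarrow> (cpoly \<Rightarrow> nat) \<Rightarrow> bool" where
  "additive_degree n \<mu> \<longleftrightarrow>
     (\<forall>f\<in>vars_below n. \<forall>g\<in>vars_below n. f \<noteq> 0 \<longrightarrow> g \<noteq> 0 \<longrightarrow> \<mu> (f * g) = \<mu> f + \<mu> g) \<and>
     (\<forall>f\<in>vars_below n. f \<noteq> 0 \<longrightarrow> \<mu> f = 0 \<longrightarrow> f \<in> range Const)"

lemma additive_degree_mult:
  "additive_degree n \<mu> \<Longrightarrow> f \<in> vars_below n \<Longrightarrow> g \<in> vars_below n \<Longrightarrow> f \<noteq> 0 \<Longrightarrow> g \<noteq> 0 \<Longrightarrow>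
    \<mu> (f * g) = \<mu> f + \<mu> g"
  by (simp add: additive_degree_def)

lemma additive_degree_eq_0:
  "additive_degree n \<mu> \<Longrightarrow> f \<in> vars_below n \<Longrightarrow> f \<noteq> 0 \<Longrightarrow> \<mu> f = 0 \<Longrightarrow> f \<in> range Const"
  by (simp add: additive_degree_def)

text \<open>Degree in the newest variable plus, recursively, the degree of the leading coefficient.
  This is not the total degree, but leading coefficients multiply, so additivity is
  immediate.\<close>

lemma ex_additive_degree:
  "\<exists>\<mu>. additive_degree n \<mu>"
proof (induction n)
  case 0
  show ?case unfolding additive_degree_def using vars_below_zero_const by (intro exI[of _ "\<lambda>_. 0"]) auto
next
  case (Suc n)
  then obtain \<mu> where \<mu>': "additive_degree n \<mu>" by blast
  note \<mu> = additive_degree_mult[OF \<mu>'] additive_degree_eq_0[OF \<mu>']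
  define T where "T = top_poly n"
  have T: "T f \<in> polys_over n \<and> f = poly (T f) (Var n)" if "f \<in> vars_below (Suc n)" for f
    using top_poly[OF that] top_poly_polys_over[OF that] by (simp add: T_def)
  define \<nu> where "\<nu> f = Polynomial.degree (T f) + \<mu> (lead_coeff (T f))" for f
  show ?case unfolding additive_degree_def
  proof (intro exI[of _ \<nu>] conjI ballI impI)
    fix f g assume fg: "f \<in> vars_below (Suc n)" "g \<in> vars_below (Suc n)" "f \<noteq> 0" "g \<noteq> 0"
    have "poly (T (f * g)) (Var n) = f * g" using T[OF vars_below_mult[OF fg(1,2)]] by simp
    also have "\<dots> = poly (T f * T g) (Var n)" using T[OF fg(1)] T[OF fg(2)] by simp
    finally have TT: "T (f * g) = T f * T g"
      using T[OF vars_below_mult[OF fg(1,2)]] T[OF fg(1)] T[OF fg(2)]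
      by (intro poly_Var_inj[of _ n]) (auto intro: polys_over_mult)
    have nz: "T f \<noteq> 0" "T g \<noteq> 0" using T[OF fg(1)] T[OF fg(2)] fg by auto
    show "\<nu> (f * g) = \<nu> f + \<nu> g"
      unfolding \<nu>_def TT lead_coeff_mult
      using nz degree_mult_eq[OF nz] T[OF fg(1)] T[OF fg(2)] \<mu>(1)[of "lead_coeff (T f)" "lead_coeff (T g)"]
      by (simp add: polys_over_def)
  next
    fix f assume f: "f \<in> vars_below (Suc n)" "f \<noteq> 0" "\<nu> f = 0"
    then obtain c where c: "T f = [:c:]" unfolding \<nu>_def by (metis add_is_0 degree_eq_zeroE)
    then have "f = c" "c \<in> vars_below n" using T[OF f(1)] by (auto simp: polys_over_def) (metis coeff_pCons_0)
    then show "f \<in> range Const" using \<mu>(2)[of f] f c by (simp add: \<nu>_def)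
  qed
qed

lemma is_unit_Const: "c \<noteq> 0 \<Longrightarrow> Const c dvd 1"
proof -
  assume "c \<noteq> 0"
  then have "Const c * Const (1 / c) = 1" by (simp add: Const_1 flip: Const_mult)
  then show ?thesis by (metis dvd_triv_left)
qed

lemma Const_eq_0 [simp]: "Const c = 0 \<longleftrightarrow> c = 0"
  by (metis Const_def lookup_single_eq lookup_zero single_zero)

text \<open>Additivity forces degree 0 on 1, hence on both factors of a product equal to 1, and
  degree 0 means constant.\<close>

lemma is_unit_cpoly_iff: "f dvd 1 \<longleftrightarrow> (\<exists>c. c \<noteq> 0 \<and> f = Const c)"
proof
  assume "f dvd 1"
  then obtain g where fg: "f * g = 1" by (metis dvdE)
  obtain a where a: "f \<in> vars_below a" using ex_vars_below by blast
  have ga: "g \<in> vars_below a" "f \<in> vars_below a"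
    using vars_below_dvd[of g 1 a] dvd_triv_right[of g f] fg a by auto
  obtain \<mu> where \<mu>': "additive_degree a \<mu>" using ex_additive_degree by blast
  note \<mu> = additive_degree_mult[OF \<mu>'] additive_degree_eq_0[OF \<mu>']
  have nz: "f \<noteq> 0" "g \<noteq> 0" using fg by auto
  have "\<mu> 1 = \<mu> 1 + \<mu> 1" using \<mu>(1)[of 1 1] by simp
  then have "\<mu> f = 0" using \<mu>(1)[of f g] ga nz fg by simp
  with \<mu>(2) ga nz have "f \<in> range Const" by blast
  then obtain c where "f = Const c" by blast
  then show "\<exists>c. c \<noteq> 0 \<and> f = Const c" using nz(1) by (metis Const_eq_0)
next
  assume "\<exists>c. c \<noteq> 0 \<and> f = Const c"
  then obtain c where "c \<noteq> 0" "f = Const c" by blast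
  then show "f dvd 1" using is_unit_Const by blast
qed

text \<open>The leading coefficient of \<open>G\<close> cannot be inverted, so it is multiplied onto
  \<open>F\<close> in every reduction and collects in \<open>c\<close>. This imitates division over
  the field of fractions of the lower polynomials.\<close>

lemma pseudo_division:
  assumes G: "G \<in> polys_over n" "G \<noteq> 0" and F: "F \<in> polys_over n"
  shows "\<exists>c W R. c \<in> vars_below n \<and> c \<noteq> 0 \<and> W \<in> polys_over n \<and> R \<in> polys_over n \<and>
           smult c F = W * G + R \<and> (R = 0 \<or> Polynomial.degree R < Polynomial.degree G)"
  using F
proof (induction "Polynomial.degree F" arbitrary: F rule: less_induct)
  case less
  show ?case
  proof (cases "F = 0 \<or> Polynomial.degree F < Polynomial.degree G")
    case True
    then show ?thesis using less.prems polys_over_0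
      by (intro exI[of _ 1] exI[of _ 0] exI[of _ F]) auto
  next
    case False
    define d where "d = Polynomial.degree F - Polynomial.degree G"
    define b where "b = lead_coeff G"
    have b: "b \<in> vars_below n" "b \<noteq> 0" using G by (auto simp: b_def polys_over_def)
    have M: "monom (lead_coeff F) d \<in> polys_over n"
      using less.prems by (intro polys_over_monom) (auto simp: polys_over_def)
    define F' where "F' = smult b F - monom (lead_coeff F) d * G"
    have F': "F' \<in> polys_over n" unfolding F'_def
      using b less.prems M G by (intro polys_over_diff polys_over_smult polys_over_mult) auto
    have dF: "Polynomial.degree F = d + Polynomial.degree G" using False by (simp add: d_def)
    have le: "Polynomial.degree F' \<le> Polynomial.degree F" unfolding F'_def
      using dF by (intro degree_diff_le order.trans[OF degree_mult_le] order.trans[OF degree_smult_le])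
        (auto intro!: add_mono degree_monom_le)
    have "coeff F' (Polynomial.degree F) = 0"
      using mult.commute[of b "lead_coeff F"] by (simp add: F'_def dF coeff_monom_mult b_def)
    \<comment> \<open>For two constant polynomials the degree cannot drop, but then the
      cross-multiplied difference is zero; so this case is kept apart from the recursion.\<close>
    then have "F' = 0 \<or> Polynomial.degree F' < Polynomial.degree F"
      using le by (metis eq_zero_or_degree_less)
    then obtain c W R where c: "c \<in> vars_below n" "c \<noteq> 0" "W \<in> polys_over n" "R \<in> polys_over n"
      "smult c F' = W * G + R" "R = 0 \<or> Polynomial.degree R < Polynomial.degree G"
    proof
      assume "F' = 0"
      then show ?thesis using that[of 1 0 0] polys_over_0 by simp
    next
      assume "Polynomial.degree F' < Polynomial.degree F"
      then show ?thesis using less.hyps[OF _ F'] that by blast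
    qed
    have "smult (c * b) F = (W + smult c (monom (lead_coeff F) d)) * G + R"
      using c(5) by (simp add: F'_def smult_diff_right algebra_simps)
    then show ?thesis using c b M
      by (intro exI[of _ "c * b"] exI[of _ "W + smult c (monom (lead_coeff F) d)"] exI[of _ R])
        (auto intro: vars_below_mult polys_over_add polys_over_smult)
  qed
qed

section \<open>Irreducible polynomials are prime\<close>

definition prime_below :: "nat \<Rightarrow> bool" where
  "prime_below n \<longleftrightarrow> (\<forall>q\<in>vars_below n. \<forall>f\<in>vars_below n. \<forall>g\<in>vars_below n.
      irreducible q \<longrightarrow> q dvd f * g \<longrightarrow> q dvd f \<or> q dvd g)"

lemma prime_belowD:
  "prime_below n \<Longrightarrow> irreducible q \<Longrightarrow> q dvd f * g \<Longrightarrow> q \<in> vars_below n \<Longrightarrow>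
     f \<in> vars_below n \<Longrightarrow> g \<in> vars_below n \<Longrightarrow> q dvd f \<or> q dvd g"
  unfolding prime_below_def by blast

text \<open>By \<open>vars_below_factor\<close> the quotient lies in
  \<open>vars_below (Suc n)\<close>, so it is itself a polynomial in \<open>Var n\<close> and
  coefficients can be compared.\<close>

lemma dvd_poly_Var_iff:
  assumes q: "q \<in> vars_below n" "q \<noteq> 0" and F: "F \<in> polys_over n"
  shows "q dvd poly F (Var n) \<longleftrightarrow> (\<forall>i. q dvd coeff F i)"
proof
  assume "\<forall>i. q dvd coeff F i"
  then show "q dvd poly F (Var n)"
    unfolding poly_altdef by (intro dvd_sum) auto
next
  assume "q dvd poly F (Var n)"
  then obtain w where w: "poly F (Var n) = w * q" by (metis dvdE mult.commute)
  show "\<forall>i. q dvd coeff F i"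
  proof (cases "F = 0")
    case False
    then have "poly F (Var n) \<noteq> 0" using poly_Var_eq_0 F by blast
    then have ws: "w \<in> vars_below (Suc n)"
      using w poly_Var_vars_below[OF F] vars_below_factor[of w q "Suc n"] by simp
    have "F = smult q (top_poly n w)"
      using w ws q F by (intro poly_Var_inj[of _ n])
        (simp_all add: polys_over_smult top_poly top_poly_polys_over mult.commute)
    then have "coeff F i = q * coeff (top_poly n w) i" for i by (metis coeff_smult)
    then show ?thesis by simp
  qed simp
qed

text \<open>Gauss's argument for \<open>q\<close> free of the newest variable: take the first
  coefficients of \<open>F\<close> and \<open>G\<close> not divisible by \<open>q\<close>, at
  \<open>i\<close> and \<open>j\<close>. In coefficient \<open>i + j\<close> of the product every
  other term contains an earlier coefficient, which \<open>q\<close> divides.\<close>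

lemma prime_below_poly_Var:
  assumes n: "prime_below n" and q: "irreducible q" "q \<in> vars_below n"
    and f: "f \<in> vars_below (Suc n)" and g: "g \<in> vars_below (Suc n)" and dvd: "q dvd f * g"
  shows "q dvd f \<or> q dvd g"
proof (rule ccontr)
  define F where "F = top_poly n f"
  define G where "G = top_poly n g"
  have F: "F \<in> polys_over n" "poly F (Var n) = f" and G: "G \<in> polys_over n" "poly G (Var n) = g"
    using f g by (simp_all add: F_def G_def top_poly top_poly_polys_over)
  have q0: "q \<noteq> 0" using q by auto
  assume "\<not> (q dvd f \<or> q dvd g)"
  then have "\<exists>i. \<not> q dvd coeff F i" "\<exists>j. \<not> q dvd coeff G j"
    using dvd_poly_Var_iff[OF q(2) q0] F G by metis+
  then obtain i j where i: "\<not> q dvd coeff F i" "\<And>a. a < i \<Longrightarrow> q dvd coeff F a"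
    and j: "\<not> q dvd coeff G j" "\<And>a. a < j \<Longrightarrow> q dvd coeff G a"
    using exists_least_iff[of "\<lambda>i. \<not> q dvd coeff F i"] exists_least_iff[of "\<lambda>i. \<not> q dvd coeff G i"]
    by auto
  have "q dvd poly (F * G) (Var n)" using dvd F G by simp
  then have "q dvd coeff (F * G) (i + j)"
    using dvd_poly_Var_iff[OF q(2) q0 polys_over_mult[OF F(1) G(1)]] by blast
  also have "coeff (F * G) (i + j) = coeff F i * coeff G j + (\<Sum>a\<in>{..i+j} - {i}. coeff F a * coeff G (i + j - a))"
    by (simp add: coeff_mult sum.remove[of _ i])
  finally have *: "q dvd coeff F i * coeff G j + (\<Sum>a\<in>{..i+j} - {i}. coeff F a * coeff G (i + j - a))" .
  have "q dvd (\<Sum>a\<in>{..i+j} - {i}. coeff F a * coeff G (i + j - a))"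
  proof (rule dvd_sum)
    fix a assume a: "a \<in> {..i+j} - {i}"
    show "q dvd coeff F a * coeff G (i + j - a)"
    proof (cases "a < i")
      case True
      then show ?thesis using i(2) by (simp add: dvd_mult2)
    next
      case False
      then have "i + j - a < j" using a by auto
      then show ?thesis using j(2) by (simp add: dvd_mult)
    qed
  qed
  with * have "q dvd coeff F i * coeff G j" by (simp add: dvd_add_left_iff)
  moreover have "coeff F i \<in> vars_below n" "coeff G j \<in> vars_below n"
    using F(1) G(1) by (simp_all add: polys_over_def)
  ultimately show False using prime_belowD[OF n q(1)] q(2) i(1) j(1) by blast
qed

text \<open>Nonunits have positive degree, so a proper splitting of \<open>c\<close> strictly lowers
  the degree. The decrease for \<open>c'\<close> is the measure that lets
  \<open>clear_lower_factor\<close> recurse.\<close>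

lemma ex_irreducible_divisor:
  assumes \<mu>: "additive_degree n \<mu>" and "c \<in> vars_below n" "c \<noteq> 0" "\<not> c dvd 1"
  shows "\<exists>\<pi> c'. irreducible \<pi> \<and> \<pi> \<in> vars_below n \<and> c' \<in> vars_below n \<and> c = \<pi> * c' \<and> \<mu> c' < \<mu> c"
  using assms(2-)
proof (induction "\<mu> c" arbitrary: c rule: less_induct)
  case less
  have pos: "\<mu> a > 0" if "a \<in> vars_below n" "a \<noteq> 0" "\<not> a dvd 1" for a
  proof (rule ccontr)
    assume "\<not> 0 < \<mu> a"
    then have "a \<in> range Const" using additive_degree_eq_0[OF \<mu> that(1,2)] by simp
    then obtain x where "a = Const x" by blast
    then show False using that is_unit_Const[of x] by auto
  qed
  show ?case
  proof (cases "irreducible c")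
    case True
    have "\<mu> 1 = \<mu> 1 + \<mu> 1" using additive_degree_mult[OF \<mu>, of 1 1] by simp
    then show ?thesis using True less.prems pos[OF less.prems]
      by (intro exI[of _ c] exI[of _ 1]) simp
  next
    case False
    then obtain a b where ab: "c = a * b" "\<not> a dvd 1" "\<not> b dvd 1"
      using less.prems unfolding irreducible_def by blast
    have nz: "a \<noteq> 0" "b \<noteq> 0" using ab(1) less.prems(2) by auto
    have v: "a \<in> vars_below n" "b \<in> vars_below n"
      using less.prems ab(1) vars_below_factor[of a b n] vars_below_factor_right[of a b n] by auto
    have "\<mu> c = \<mu> a + \<mu> b" unfolding ab(1) using additive_degree_mult[OF \<mu> v nz] .
    moreover have "\<mu> b > 0" using pos v nz ab by blast
    ultimately have lt: "\<mu> a < \<mu> c" by simp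
    from less.hyps[OF lt v(1) nz(1) ab(2)] obtain \<pi> a' where
      a': "irreducible \<pi>" "\<pi> \<in> vars_below n" "a' \<in> vars_below n" "a = \<pi> * a'" "\<mu> a' < \<mu> a" by blast
    have "\<mu> (a' * b) = \<mu> a' + \<mu> b" using a' nz v by (intro additive_degree_mult[OF \<mu>]) auto
    then show ?thesis using a' ab v \<open>\<mu> c = \<mu> a + \<mu> b\<close>
      by (intro exI[of _ \<pi>] exI[of _ "a' * b"]) (auto intro: vars_below_mult simp: mult.assoc)
  qed
qed

text \<open>Takes the place of Gauss's lemma on contents.\<close>

lemma clear_lower_factor:
  assumes n: "prime_below n" and c: "c \<in> vars_below n" "c \<noteq> 0"
    and s: "s \<in> vars_below (Suc n)" and h: "h \<in> vars_below (Suc n)" and eq: "c * q = s * h"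
  shows "\<exists>c1 c2 s' h'. c1 \<in> vars_below n \<and> c2 \<in> vars_below n \<and> c = c1 * c2 \<and> s = c1 * s' \<and> h = c2 * h' \<and> q = s' * h'"
proof -
  obtain \<mu> where \<mu>: "additive_degree n \<mu>" using ex_additive_degree by blast
  show ?thesis using c s h eq
  proof (induction "\<mu> c" arbitrary: c s h rule: less_induct)
    case less
    show ?case
    proof (cases "c dvd 1")
      case True
      then obtain d where d: "c * d = 1" by (metis dvdE)
      have "s = c * (d * s)" using d by (simp flip: mult.assoc)
      moreover have "q = (d * s) * h" using less.prems(5) d
        by (metis mult.assoc mult.commute mult_1)
      ultimately show ?thesis using less.prems by (intro exI[of _ c] exI[of _ 1] exI[of _ "d * s"] exI[of _ h]) auto
    next
      case False
      from ex_irreducible_divisor[OF \<mu> less.prems(1,2) False] obtain \<pi> c' where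
        \<pi>: "irreducible \<pi>" "\<pi> \<in> vars_below n" "c' \<in> vars_below n" "c = \<pi> * c'" "\<mu> c' < \<mu> c" by blast
      have nz: "\<pi> \<noteq> 0" "c' \<noteq> 0" using \<pi>(4) less.prems(2) by auto
      \<comment> \<open>As \<pi> is free of the newest variable, \<open>prime_below_poly_Var\<close>
        applies; \<pi> is cancelled from one of \<open>s\<close>, \<open>h\<close> and from
        \<open>c\<close>, whose degree drops.\<close>
      have "\<pi> dvd s * h" using \<pi>(4) less.prems(5) by (metis dvd_triv_left mult.assoc)
      then consider "\<pi> dvd s" | "\<pi> dvd h"
        using prime_below_poly_Var[OF n \<pi>(1,2) less.prems(3,4)] by blast
      then show ?thesis
      proof cases
        case 1
        then obtain t where t: "s = \<pi> * t" by (rule dvdE)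
        have tv: "t \<in> vars_below (Suc n)"
          using less.prems(3) t nz by (cases "t = 0") (auto dest: vars_below_factor_right)
        have "\<pi> * (c' * q) = \<pi> * (t * h)" using less.prems(5) \<pi>(4) t by (simp add: mult.assoc)
        then have "c' * q = t * h" using nz by simp
        from less.hyps[OF \<pi>(5,3) nz(2) tv less.prems(4) this] obtain c1 c2 s' h' where
          "c1 \<in> vars_below n" "c2 \<in> vars_below n" "c' = c1 * c2" "t = c1 * s'" "h = c2 * h'" "q = s' * h'" by blast
        then show ?thesis using \<pi> t
          by (intro exI[of _ "\<pi> * c1"] exI[of _ c2] exI[of _ s'] exI[of _ h'])
            (simp add: vars_below_mult mult.assoc)
      next
        case 2
        then obtain t where t: "h = \<pi> * t" by (rule dvdE)
        have tv: "t \<in> vars_below (Suc n)"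
          using less.prems(4) t nz by (cases "t = 0") (auto dest: vars_below_factor_right)
        have "\<pi> * (c' * q) = \<pi> * (s * t)" using less.prems(5) \<pi>(4) t by (simp add: mult_ac)
        then have "c' * q = s * t" using nz by simp
        from less.hyps[OF \<pi>(5,3) nz(2) less.prems(3) tv this] obtain c1 c2 s' h' where
          "c1 \<in> vars_below n" "c2 \<in> vars_below n" "c' = c1 * c2" "s = c1 * s'" "t = c2 * h'" "q = s' * h'" by blast
        then show ?thesis using \<pi> t
          by (intro exI[of _ c1] exI[of _ "\<pi> * c2"] exI[of _ s'] exI[of _ h'])
            (simp add: vars_below_mult mult_ac)
      qed
    qed
  qed
qed

lemma unit_mult_dvd:
  fixes u :: cpoly
  assumes "u dvd 1" "a dvd b" shows "u * a dvd b"
proof -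
  obtain v where v: "1 = u * v" using assms(1) by (rule dvdE)
  obtain k where k: "b = a * k" using assms(2) by (rule dvdE)
  have "b = (u * v) * (a * k)" using k by (simp flip: v)
  then have "b = (u * a) * (v * k)" by (simp add: mult_ac)
  then show ?thesis by (rule dvdI)
qed

text \<open>In a splitting \<open>q = c2 * q'\<close> with \<open>c2\<close> free of the newest
  variable, \<open>q'\<close> is not a unit, since \<open>q\<close> would then be free of it too.
  Irreducibility makes \<open>c2\<close> a unit, so clearing \<open>c\<close> leaves all of
  \<open>q\<close>, up to a unit, as a factor of \<open>f\<close>.\<close>

lemma dvd_of_lower_multiple:
  assumes n: "prime_below n" and q: "irreducible q" "q \<in> vars_below (Suc n)" "q \<notin> vars_below n"
    and c: "c \<in> vars_below n" "c \<noteq> 0" and v: "v \<in> vars_below (Suc n)" and eq: "c * f = v * q"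
  shows "q dvd f"
proof -
  from clear_lower_factor[OF n c v q(2) eq] obtain c1 c2 s' q' where
    *: "c1 \<in> vars_below n" "c2 \<in> vars_below n" "c = c1 * c2" "v = c1 * s'" "q = c2 * q'" "f = s' * q'" by blast
  have "\<not> q' dvd 1"
  proof
    assume "q' dvd 1"
    then obtain x where "q' = Const x" using is_unit_cpoly_iff by blast
    then show False using * q(3) vars_below_mult[of c2 n "Const x"] by simp
  qed
  then have "c2 dvd 1" using irreducibleD[OF q(1) *(5)] by blast
  then show ?thesis using unit_mult_dvd[of c2 q' f] *(5,6) by simp
qed

text \<open>The multipliers \<open>h\<close> with \<open>q dvd h * g\<close> form an ideal
  \<open>I\<close> containing \<open>q\<close> and \<open>f\<close>. Over the field of fractions of
  the lower polynomials it would be principal, generated by an element of least degree in the newest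
  variable; pseudo-division realises this up to a lower factor. Applied to \<open>q\<close> itself,
  it shows that the generator is either free of the newest variable, which gives
  \<open>q dvd g\<close>, or a lower multiple of \<open>q\<close>, which gives
  \<open>q dvd f\<close>.\<close>

lemma prime_below_step:
  assumes n: "prime_below n" and q: "irreducible q" "q \<in> vars_below (Suc n)" "q \<notin> vars_below n"
    and f: "f \<in> vars_below (Suc n)" and g: "g \<in> vars_below (Suc n)" and dvd: "q dvd f * g"
  shows "q dvd f \<or> q dvd g"
proof (cases "q dvd g")
  case False
  define I where "I = {h \<in> vars_below (Suc n). q dvd h * g}"
  define deg where "deg h = Polynomial.degree (top_poly n h)" for h
  have q0: "q \<noteq> 0" using q by auto
  have g0: "g \<noteq> 0" using False by auto
  have "q \<in> {h \<in> I. h \<noteq> 0}" using q q0 by (simp add: I_def)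
  then obtain h where hI: "h \<in> I" "h \<noteq> 0" and hmin: "\<And>h'. h' \<in> I \<Longrightarrow> h' \<noteq> 0 \<Longrightarrow> deg h \<le> deg h'"
    using arg_min_nat_lemma[of "\<lambda>h. h \<in> I \<and> h \<noteq> 0" q deg] by auto
  have h: "h \<in> vars_below (Suc n)" "q dvd h * g" using hI by (auto simp: I_def)
  have red: "\<exists>c w. c \<in> vars_below n \<and> c \<noteq> 0 \<and> w \<in> vars_below (Suc n) \<and> c * a = w * h" if a: "a \<in> I" for a
  proof -
    have av: "a \<in> vars_below (Suc n)" "q dvd a * g" using a by (auto simp: I_def)
    have H: "top_poly n h \<in> polys_over n" "top_poly n h \<noteq> 0" using top_poly[OF h(1)] top_poly_polys_over[OF h(1)] hI(2) by auto
    obtain c W R where c: "c \<in> vars_below n" "c \<noteq> 0" "W \<in> polys_over n" "R \<in> polys_over n"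
      "smult c (top_poly n a) = W * top_poly n h + R"
      "R = 0 \<or> Polynomial.degree R < Polynomial.degree (top_poly n h)"
      using pseudo_division[OF H top_poly_polys_over[OF av(1)]] by blast
    define r where "r = poly R (Var n)"
    define w where "w = poly W (Var n)"
    have wr: "w \<in> vars_below (Suc n)" "r \<in> vars_below (Suc n)"
      using c by (simp_all add: w_def r_def poly_Var_vars_below)
    have "poly (smult c (top_poly n a)) (Var n) = poly (W * top_poly n h + R) (Var n)"
      using c(5) by simp
    then have eq: "c * a = w * h + r" using h av by (simp add: top_poly w_def r_def)
    have "r = c * a - w * h" using eq by simp
    then have "r * g = c * (a * g) - w * (h * g)" by (simp add: left_diff_distrib mult.assoc)
    then have "q dvd r * g" using av(2) h(2) by simp
    then have "r \<in> I" using wr by (simp add: I_def)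
    moreover have "deg r = Polynomial.degree R" using c(4) by (simp add: deg_def r_def top_poly_eq)
    ultimately have "r = 0" using hmin[of r] c(6) by (cases "r = 0") (auto simp: deg_def r_def)
    then show ?thesis using eq c wr by auto
  qed
  have "q \<in> I" using q by (simp add: I_def)
  from red[OF this] obtain c w where cw: "c \<in> vars_below n" "c \<noteq> 0" "w \<in> vars_below (Suc n)" "c * q = w * h" by blast
  from clear_lower_factor[OF n cw(1,2,3) h(1) cw(4)] obtain c1 c2 w' h' where
    *: "c1 \<in> vars_below n" "c2 \<in> vars_below n" "c = c1 * c2" "w = c1 * w'" "h = c2 * h'" "q = w' * h'" by blast
  show ?thesis
  proof (cases "h' dvd 1")
    case True
    then obtain x where "h' = Const x" using is_unit_cpoly_iff by blast
    then have hn: "h \<in> vars_below n" using * by (simp add: vars_below_mult)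
    obtain v where v: "h * g = v * q" using h(2) by (metis dvdE mult.commute)
    have "v * q \<noteq> 0" using v hI(2) g0 by (metis mult_eq_0_iff)
    then have "v \<in> vars_below (Suc n)"
      using v vars_below_factor[of v q "Suc n"] vars_below_mult[OF h(1) g] by simp
    then show ?thesis using dvd_of_lower_multiple[OF n q hn hI(2) _ v] by blast
  next
    case False
    \<comment> \<open>Now \<open>h'\<close> equals \<open>q\<close> up to a unit, so
      \<open>h\<close> is a multiple of \<open>q\<close>, and reducing \<open>f\<close> by
      \<open>h\<close> shows that a lower multiple of \<open>f\<close> is divisible by
      \<open>q\<close>.\<close>
    then have "w' dvd 1" using irreducibleD[OF q(1) *(6)] by blast
    then obtain y where y: "1 = w' * y" by (rule dvdE)
    then have "y dvd 1" by (metis dvd_triv_right)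
    then obtain x where x: "y = Const x" using is_unit_cpoly_iff by blast
    have h'q: "h' = y * q" using y *(6) by (metis mult.assoc mult.commute mult_1)
    have "f \<in> I" using f dvd by (simp add: I_def)
    from red[OF this] obtain b v where b: "b \<in> vars_below n" "b \<noteq> 0" "v \<in> vars_below (Suc n)" "b * f = v * h" by blast
    have "b * f = (v * (c2 * y)) * q" using b(4) *(5) h'q by (simp add: mult_ac)
    moreover have "v * (c2 * y) \<in> vars_below (Suc n)"
      using b(3) *(2) vars_below_mono[of n "Suc n"] x by (auto intro!: vars_below_mult)
    ultimately show ?thesis using dvd_of_lower_multiple[OF n q b(1,2)] by blast
  qed
qed simp

lemma prime_below: "prime_below n"
proof (induction n)
  case 0
  have "\<not> irreducible q" if q: "q \<in> vars_below 0" for q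
  proof
    assume "irreducible q"
    then have "q \<noteq> 0" "\<not> q dvd 1" by (auto simp: irreducible_def)
    moreover obtain c where "q = Const c" using vars_below_zero_const[OF q] by blast
    ultimately show False using is_unit_Const[of c] by auto
  qed
  then show ?case unfolding prime_below_def by blast
next
  case (Suc n)
  show ?case unfolding prime_below_def
  proof (intro ballI impI)
    fix q f g assume *: "q \<in> vars_below (Suc n)" "f \<in> vars_below (Suc n)" "g \<in> vars_below (Suc n)"
      "irreducible q" "q dvd f * g"
    show "q dvd f \<or> q dvd g"
    proof (cases "q \<in> vars_below n")
      case True
      then show ?thesis using prime_below_poly_Var[OF Suc.IH *(4) True *(2,3,5)] by blast
    next
      case False
      then show ?thesis using prime_below_step[OF Suc.IH *(4,1) False *(2,3,5)] by blast
    qed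
  qed
qed

theorem irreducible_cpoly_dvd_mult:
  fixes q f g :: cpoly
  assumes "irreducible q" "q dvd f * g"
  shows "q dvd f \<or> q dvd g"
proof -
  obtain a b c where "q \<in> vars_below a" "f \<in> vars_below b" "g \<in> vars_below c" using ex_vars_below by meson
  then have "q \<in> vars_below (a + b + c)" "f \<in> vars_below (a + b + c)" "g \<in> vars_below (a + b + c)"
    using vars_below_mono[of a "a + b + c"] vars_below_mono[of b "a + b + c"] vars_below_mono[of c "a + b + c"] by auto
  then show ?thesis using prime_belowD[OF prime_below assms] by blast
qed

section \<open>The derivative of the product map and its kernel\<close>

text \<open>The formal derivative of \<open>power_product\<close> at \<open>u\<close> in direction
  \<open>v\<close>, by the Leibniz rule; \<open>derivative_eq_jac\<close> identifies it with the
  Frechet derivative.\<close>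

definition jac :: "nat \<Rightarrow> (nat \<Rightarrow> nat) \<Rightarrow> cpoly_array \<Rightarrow> cpoly_array \<Rightarrow> cpoly" where
  "jac k l u v = v 0 * (\<Prod>j=1..k. u j ^ l j) +
     u 0 * (\<Sum>j=1..k. of_nat (l j) * v j * u j ^ (l j - 1) * (\<Prod>i\<in>{1..k} - {j}. u i ^ l i))"

text \<open>Tangent vectors at \<open>u\<close> of the scaling orbits, on which the product is constant.\<close>

definition tangent :: "(nat \<Rightarrow> nat) \<Rightarrow> nat \<Rightarrow> cpoly_array \<Rightarrow> cpoly_array" where
  "tangent l j u = (\<lambda>i. if i = 0 then cp_scale (- of_nat (l j)) (u 0) else if i = j then u j else 0)"

lemma Const_of_nat: "Const (of_nat n) = of_nat n"
  by (simp add: Const_def)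

lemma Const_uminus: "Const (- c) = - Const c"
  by (simp add: Const_def single_uminus)

lemma Const_power: "Const (c ^ n) = Const c ^ n"
  by (induction n) (simp_all add: Const_1 Const_mult)

lemma Const_prod: "Const (prod f A) = (\<Prod>a\<in>A. Const (f a))"
  by (induction A rule: infinite_finite_induct) (simp_all add: Const_1 Const_mult)

lemma Const_sum: "Const (sum f A) = (\<Sum>a\<in>A. Const (f a))"
  by (induction A rule: infinite_finite_induct) (simp_all add: Const_add)

lemma sum_array_apply: "(\<Sum>a\<in>A. f a) i = (\<Sum>a\<in>A. (f a i :: cpoly))"
  by (induction A rule: infinite_finite_induct) simp_all

text \<open>Euler's identity: differentiating the power of \<open>u j\<close> in direction
  \<open>u j\<close> reproduces it \<open>l j\<close> times, and the weight \<open>- l j\<close> on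
  component 0 cancels exactly this.\<close>

lemma jac_tangent:
  assumes j: "j \<in> {1..k}" and l: "l j > 0"
  shows "jac k l u (tangent l j u) = 0"
proof -
  have "jac k l u (tangent l j u) = - of_nat (l j) * u 0 * (\<Prod>i=1..k. u i ^ l i) +
     u 0 * (\<Sum>i=1..k. if i = j then of_nat (l j) * u j * u j ^ (l j - 1) * (\<Prod>i\<in>{1..k} - {j}. u i ^ l i) else 0)"
    unfolding jac_def
    by (intro arg_cong2[of _ _ _ _ "(+)"] arg_cong2[of _ _ _ _ "(*)"] sum.cong)
      (auto simp: tangent_def cp_scale_def Const_of_nat Const_uminus)
  also have "(\<Sum>i=1..k. if i = j then of_nat (l j) * u j * u j ^ (l j - 1) * (\<Prod>i\<in>{1..k} - {j}. u i ^ l i) else 0)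
      = of_nat (l j) * (u j * u j ^ (l j - 1) * (\<Prod>i\<in>{1..k} - {j}. u i ^ l i))"
    using j by (simp add: mult.assoc)
  also have "u j * u j ^ (l j - 1) * (\<Prod>i\<in>{1..k} - {j}. u i ^ l i) = (\<Prod>i=1..k. u i ^ l i)"
    using j l by (simp add: prod.remove[of _ j] flip: power_Suc)
  finally show ?thesis by (simp add: mult_ac)
qed

lemma irreducible_cpoly_dvd_prod:
  fixes q :: cpoly
  assumes q: "irreducible q" and "finite A" and "q dvd (\<Prod>i\<in>A. f i ^ e i)"
  shows "\<exists>i\<in>A. q dvd f i"
  using assms(2,3)
proof (induction A)
  case empty
  then show ?case using irreducible_not_unit[OF q] by simp
next
  case (insert a A)
  have pow: "q dvd f a ^ n \<Longrightarrow> q dvd f a" for n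
  proof (induction n)
    case 0
    then show ?case using irreducible_not_unit[OF q] by simp
  next
    case (Suc n)
    then show ?case using irreducible_cpoly_dvd_mult[OF q, of "f a" "f a ^ n"] by auto
  qed
  show ?case
    using insert irreducible_cpoly_dvd_mult[OF q, of "f a ^ e a" "\<Prod>i\<in>A. f i ^ e i"] pow by auto
qed

text \<open>Modulo \<open>u j ^ l j\<close> only the j-th summand of the derivative survives.
  Cancelling \<open>u j ^ (l j - 1)\<close> leaves \<open>u j\<close> dividing the product of
  \<open>u 0\<close>, \<open>l j\<close>, \<open>v j\<close> and powers of the other factors. Only
  \<open>v j\<close> can absorb this prime: \<open>u 0\<close> and \<open>l j\<close> are units, and
  the other factors are irreducible and not constant multiples of \<open>u j\<close>.\<close>

lemma jac_kernel_dvd: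
  assumes fac: "irreducible_factorization p k l u" and j: "j \<in> {1..k}" and jac: "jac k l u v = 0"
  shows "u j dvd v j"
proof -
  have irr: "irreducible (u j)" and l: "l j > 0" using fac j by (auto simp: irreducible_factorization_def)
  have u0: "u j \<noteq> 0" using irr by auto
  define S where "S i = of_nat (l i) * v i * u i ^ (l i - 1) * (\<Prod>i\<in>{1..k} - {i}. u i ^ l i)" for i
  have d: "u j ^ l j dvd (\<Prod>i\<in>A. u i ^ l i)" if "j \<in> A" "finite A" for A
    using that by (intro dvd_prodI)
  have "u 0 * S j = - (v 0 * (\<Prod>i=1..k. u i ^ l i) + u 0 * (\<Sum>i\<in>{1..k} - {j}. S i))"
  proof -
    define P where "P = (\<Prod>i=1..k. u i ^ l i)"
    define Q where "Q = (\<Sum>i\<in>{1..k} - {j}. S i)"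
    have "sum S {1..k} = S j + Q" using j by (simp add: Q_def sum.remove[of _ j])
    then have "v 0 * P + u 0 * (S j + Q) = 0" using jac unfolding jac_def S_def[symmetric] P_def[symmetric] by simp
    then have "u 0 * S j + (v 0 * P + u 0 * Q) = 0" by (simp add: distrib_left add_ac)
    then show ?thesis unfolding P_def Q_def by (simp only: eq_neg_iff_add_eq_0)
  qed
  moreover have "u j ^ l j dvd v 0 * (\<Prod>i=1..k. u i ^ l i) + u 0 * (\<Sum>i\<in>{1..k} - {j}. S i)"
    using j d by (intro dvd_add dvd_mult dvd_sum) (auto simp: S_def)
  ultimately have "u j ^ l j dvd u 0 * S j" by (simp only: dvd_minus_iff)
  then have "u j * u j ^ (l j - 1) dvd (u 0 * of_nat (l j) * v j * (\<Prod>i\<in>{1..k} - {j}. u i ^ l i)) * u j ^ (l j - 1)"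
    using l by (simp add: S_def mult_ac flip: power_Suc)
  then have "u j dvd u 0 * of_nat (l j) * v j * (\<Prod>i\<in>{1..k} - {j}. u i ^ l i)"
    using u0 by simp
  then consider "u j dvd u 0" | "u j dvd of_nat (l j)" | "u j dvd v j" | "u j dvd (\<Prod>i\<in>{1..k} - {j}. u i ^ l i)"
    using irreducible_cpoly_dvd_mult[OF irr] by meson
  then show ?thesis
  proof cases
    case 1
    moreover have "u 0 dvd 1" using fac is_unit_Const by (auto simp: irreducible_factorization_def)
    ultimately show ?thesis using irreducible_not_unit[OF irr] dvd_trans by blast
  next
    case 2
    moreover have "of_nat (l j) dvd (1 :: cpoly)" using l is_unit_Const[of "of_nat (l j)"] by (simp add: Const_of_nat)
    ultimately show ?thesis using irreducible_not_unit[OF irr] dvd_trans by blast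
  next
    case 4
    then obtain i where i: "i \<in> {1..k} - {j}" "u j dvd u i"
      using irreducible_cpoly_dvd_prod[OF irr] by blast
    then obtain s where s: "u i = u j * s" by (auto elim: dvdE)
    have "irreducible (u i)" using fac i by (auto simp: irreducible_factorization_def)
    then have "s dvd 1" using irreducibleD[of "u i" "u j" s] s irreducible_not_unit[OF irr] by blast
    then obtain c where "s = Const c" using is_unit_cpoly_iff by blast
    then have "u i = cp_scale c (u j)" using s by (simp add: cp_scale_def mult.commute)
    then show ?thesis using fac i j by (auto simp: irreducible_factorization_def)
  qed
qed

lemma irreducible_factorization_nz:
  assumes "irreducible_factorization p k l u" "j \<le> k"
  shows "u j \<noteq> 0"
proof (cases "j = 0")
  case False
  then have "irreducible (u j)" using assms by (simp add: irreducible_factorization_def)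
  then show ?thesis by auto
qed (use assms in \<open>simp add: irreducible_factorization_def\<close>)

text \<open>Divisibility and the hosting spaces make \<open>v j\<close> a constant multiple of
  \<open>u j\<close> for j >= 1. Only component 0 is then undetermined; cancelling the nonzero
  product of powers from \<open>jac k l u v = 0\<close> gives one scalar equation, which fixes it to
  its value in the combination of tangents.\<close>

lemma jac_kernel:
  assumes fac: "irreducible_factorization p k l u"
    and host: "\<And>j. j \<le> k \<Longrightarrow> proper_hosting_space (U j) (u j)" and U0: "U 0 = range Const"
    and v: "v \<in> product_space k U" and jac: "jac k l u v = 0"
  shows "\<exists>c. v = (\<Sum>j=1..k. arr_scale (c j) (tangent l j u))"
proof -
  have "\<exists>c. v j = cp_scale c (u j)" if j: "j \<in> {1..k}" for j
  proof -
    obtain s where s: "v j = s * u j" using jac_kernel_dvd[OF fac j jac] by (metis dvdE mult.commute)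
    have "v j \<in> U j" using v j by (auto simp: product_space_def)
    then have "s \<in> range Const" using host[of j] j s by (auto simp: proper_hosting_space_def)
    then show ?thesis using s by (auto simp: cp_scale_def)
  qed
  then obtain c where c: "\<And>j. j \<in> {1..k} \<Longrightarrow> v j = cp_scale (c j) (u j)" by metis
  obtain a where a: "u 0 = Const a" "a \<noteq> 0" using fac by (auto simp: irreducible_factorization_def)
  have "v 0 \<in> U 0" using v by (simp add: product_space_def)
  then obtain b where b: "v 0 = Const b" using U0 by blast
  have sum0: "(\<Sum>j=1..k. arr_scale (c j) (tangent l j u)) i = (\<Sum>j=1..k. arr_scale (c j) (tangent l j u) i)" for i
    by (rule sum_array_apply)
  have tan: "(\<Sum>j=1..k. arr_scale (c j) (tangent l j u)) i = (if i \<in> {1..k} then v i else 0)" if "i > 0" for i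
  proof -
    have "(\<Sum>j=1..k. arr_scale (c j) (tangent l j u) i) = (\<Sum>j=1..k. if j = i then cp_scale (c i) (u i) else 0)"
      using that by (intro sum.cong) (auto simp: arr_scale_def tangent_def)
    then show ?thesis unfolding sum0 using c by auto
  qed
  have P0: "(\<Prod>j=1..k. u j ^ l j) \<noteq> 0" using irreducible_factorization_nz[OF fac] by auto
  have "of_nat (l j) * v j * u j ^ (l j - 1) * (\<Prod>i\<in>{1..k} - {j}. u i ^ l i)
       = Const (c j * of_nat (l j)) * (\<Prod>i=1..k. u i ^ l i)" if j: "j \<in> {1..k}" for j
  proof -
    have "l j > 0" using fac j by (auto simp: irreducible_factorization_def)
    then have "u j * u j ^ (l j - 1) * (\<Prod>i\<in>{1..k} - {j}. u i ^ l i) = (\<Prod>i=1..k. u i ^ l i)"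
      using j by (simp add: prod.remove[of _ j] flip: power_Suc)
    then show ?thesis
      using c[OF j] by (simp add: cp_scale_def Const_mult Const_of_nat mult_ac)
  qed
  then have "jac k l u v = v 0 * (\<Prod>j=1..k. u j ^ l j) + u 0 * (\<Sum>j=1..k. Const (c j * of_nat (l j)) * (\<Prod>j=1..k. u j ^ l j))"
    unfolding jac_def by (metis (no_types, lifting) sum.cong)
  also have "\<dots> = Const (b + a * (\<Sum>j=1..k. c j * of_nat (l j))) * (\<Prod>j=1..k. u j ^ l j)"
  proof -
    have "Const (\<Sum>j=1..k. c j * of_nat (l j)) = (\<Sum>j=1..k. Const (c j * of_nat (l j)))"
      by (simp only: Const_sum)
    then show ?thesis using a b by (simp add: Const_add Const_mult distrib_right sum_distrib_right mult.assoc)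
  qed
  finally have "Const (b + a * (\<Sum>j=1..k. c j * of_nat (l j))) * (\<Prod>j=1..k. u j ^ l j) = 0"
    using jac by (simp only:)
  then have "b + a * (\<Sum>j=1..k. c j * of_nat (l j)) = 0" using P0
    by (simp only: mult_eq_0_iff Const_eq_0 simp_thms)
  then have bb: "b = - (\<Sum>j=1..k. c j * of_nat (l j)) * a" by (simp add: eq_neg_iff_add_eq_0 mult.commute)
  have "(\<Sum>j=1..k. arr_scale (c j) (tangent l j u)) 0 = v 0"
  proof -
    have "(\<Sum>j=1..k. arr_scale (c j) (tangent l j u) 0) = (\<Sum>j=1..k. Const (- (c j * of_nat (l j)) * a))"
      using a by (intro sum.cong) (auto simp: arr_scale_def tangent_def cp_scale_def mult.assoc simp flip: Const_mult)
    also have "\<dots> = Const (\<Sum>j=1..k. - (c j * of_nat (l j)) * a)"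
      by (simp only: Const_sum)
    finally show ?thesis unfolding sum0 b bb by (simp add: sum_negf sum_distrib_right)
  qed
  then have "v i = (\<Sum>j=1..k. arr_scale (c j) (tangent l j u)) i" for i
    using tan[of i] v by (cases "i = 0") (auto simp: product_space_def)
  then show ?thesis by blast
qed

section \<open>Moore--Penrose inverse and rank of a matrix with known kernel\<close>

lemma conj_transpose_mult: "conj_transpose (A ** B) = conj_transpose B ** conj_transpose A"
  by (simp add: conj_transpose_def matrix_matrix_mult_def vec_eq_iff mult.commute)

lemma conj_transpose_conj_transpose [simp]: "conj_transpose (conj_transpose A) = A"
  by (simp add: conj_transpose_def vec_eq_iff)

lemma conj_transpose_add: "conj_transpose (A + B) = conj_transpose A + conj_transpose B"
  by (simp add: conj_transpose_def vec_eq_iff)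

lemma conj_transpose_0 [simp]: "conj_transpose 0 = 0"
  by (simp add: conj_transpose_def vec_eq_iff)

lemma conj_transpose_mat_1 [simp]: "conj_transpose (mat 1) = mat 1"
  by (auto simp: conj_transpose_def mat_def vec_eq_iff)

lemma matrix_mul_add_rdistrib: "(A + B) ** C = A ** C + B ** C"
  by (simp add: matrix_matrix_mult_def vec_eq_iff distrib_right sum.distrib)

text \<open>Uniqueness behind the definite description: taking conjugate transposes of
  \<open>A ** Y ** A ** X = A ** X\<close> gives \<open>A ** X = A ** Y\<close>; symmetrically
  \<open>X ** A = Y ** A\<close>, and these two determine the inverse.\<close>

lemma mp_inverse_eqI:
  assumes "A ** X ** A = A" "X ** A ** X = X"
    "conj_transpose (A ** X) = A ** X" "conj_transpose (X ** A) = X ** A"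
  shows "mp_inverse A = X"
  unfolding mp_inverse_def
proof (rule the_equality)
  fix Y assume Y: "A ** Y ** A = A \<and> Y ** A ** Y = Y \<and>
    conj_transpose (A ** Y) = A ** Y \<and> conj_transpose (Y ** A) = Y ** A"
  have "A ** X = conj_transpose (A ** Y ** (A ** X))"
    using Y assms by (simp add: matrix_mul_assoc)
  also have "\<dots> = A ** X ** (A ** Y)"
    using Y assms by (simp add: conj_transpose_mult[of "A ** Y"])
  also have "\<dots> = A ** Y" using assms(1) by (simp add: matrix_mul_assoc)
  finally have 1: "A ** X = A ** Y" .
  have "X ** A = conj_transpose (X ** A ** (Y ** A))"
  proof -
    have "X ** A ** (Y ** A) = X ** (A ** Y ** A)" by (simp add: matrix_mul_assoc)
    then show ?thesis using Y assms by simp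
  qed
  also have "\<dots> = Y ** A ** (X ** A)"
    using Y assms by (simp add: conj_transpose_mult[of "X ** A"])
  also have "\<dots> = Y ** (A ** X ** A)" by (simp add: matrix_mul_assoc)
  finally have 2: "X ** A = Y ** A" using assms(1) by simp
  have "Y = Y ** (A ** Y)" using Y by (simp add: matrix_mul_assoc)
  also have "\<dots> = Y ** (A ** X)" using 1 by simp
  also have "\<dots> = Y ** A ** X" by (simp add: matrix_mul_assoc)
  also have "\<dots> = X ** A ** X" using 2 by simp
  finally show "Y = X" using assms by simp
qed (use assms in simp)

text \<open>
  A Hermitian \<open>B\<close> with \<open>J ** B = 0\<close> acts only on the kernel of \<open>J\<close>, so adding it to the Gram matrix
  does not change anything on the orthogonal complement of the kernel.  This gives a formula for the
  Moore--Penrose inverse without singular values, from which its smoothness can be read off.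
\<close>

lemma
  fixes A :: "'a::semiring_1^'n^'n"
  assumes "invertible A"
  shows matrix_inv_left: "matrix_inv A ** A = mat 1" and matrix_inv_right: "A ** matrix_inv A = mat 1"
  using someI_ex[OF assms[unfolded invertible_def]] unfolding matrix_inv_def by blast+

lemma
  fixes J :: "complex^'n^'m" and B :: "complex^'n^'n"
  assumes B: "conj_transpose B = B" "J ** B = 0" and inv: "invertible (conj_transpose J ** J + B)"
  defines "X \<equiv> matrix_inv (conj_transpose J ** J + B) ** conj_transpose J"
  shows mp_inverse_formula: "mp_inverse J = X"
    and mp_inverse_formula_1: "J ** X ** J = J"
    and mp_inverse_formula_2: "X ** J ** X = X"
proof -
  define A where "A = conj_transpose J ** J"
  define H where "H = A + B"
  define R where "R = matrix_inv H"
  have RH: "R ** H = mat 1" "H ** R = mat 1"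
    using inv unfolding R_def H_def A_def by (simp_all add: matrix_inv_left matrix_inv_right)
  have X: "X = R ** conj_transpose J" by (simp add: X_def R_def H_def A_def)
  have A': "conj_transpose A = A" by (simp add: A_def conj_transpose_mult)
  have AB: "A ** B = 0" using B by (simp add: A_def matrix_mul_assoc[symmetric])
  have BA: "B ** A = 0" using arg_cong[OF AB, of conj_transpose] A' B by (simp add: conj_transpose_mult)
  have H': "conj_transpose H = H" by (simp add: H_def conj_transpose_add A' B)
  have R': "conj_transpose R = R"
  proof -
    have "conj_transpose R ** H = mat 1" using arg_cong[OF RH(2), of conj_transpose] H' by (simp add: conj_transpose_mult)
    then have "conj_transpose R ** H ** R = R" by simp
    then show ?thesis using RH by (simp add: matrix_mul_assoc[symmetric])
  qed
  have comm: "R ** C = C ** R" if "C ** H = H ** C" for C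
  proof -
    have "R ** (C ** H) ** R = R ** (H ** C) ** R" using that by simp
    moreover have "R ** (C ** H) ** R = R ** C" using RH by (simp flip: matrix_mul_assoc)
    moreover have "R ** (H ** C) ** R = C ** R" using RH by (simp add: matrix_mul_assoc)
    ultimately show ?thesis by simp
  qed
  \<comment> \<open>\<open>A\<close> and \<open>B\<close> annihilate each other, so both commute
    with \<open>H\<close> and hence with its inverse \<open>R\<close>. This makes
    \<open>X ** J = R ** A\<close> Hermitian and, because \<open>J ** B = 0\<close>, makes
    \<open>J ** R ** B\<close> vanish.\<close>
  have RA: "R ** A = A ** R"
    by (rule comm) (simp add: H_def matrix_add_ldistrib matrix_mul_add_rdistrib AB BA)
  have RB: "R ** B = B ** R"
    by (rule comm) (simp add: H_def matrix_add_ldistrib matrix_mul_add_rdistrib AB BA)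
  have JB: "J ** R ** B = 0"
    using RB B by (metis matrix_mul_assoc times0_left)
  have BJ: "B ** conj_transpose J = 0"
    using conj_transpose_mult[of J B] B by simp
  show 1: "J ** X ** J = J"
  proof -
    have "J ** X ** J = J ** R ** A" by (simp add: X A_def matrix_mul_assoc)
    also have "\<dots> = J ** R ** A + J ** R ** B" using JB by simp
    also have "\<dots> = J ** (R ** H)" by (simp add: H_def matrix_add_ldistrib matrix_mul_assoc)
    finally show ?thesis using RH by simp
  qed
  show 2: "X ** J ** X = X"
  proof -
    have "R ** B ** R ** conj_transpose J = 0"
      using RB BJ by (metis matrix_mul_assoc times0_right)
    then have "X ** J ** X = (R ** A + R ** B) ** R ** conj_transpose J"
      by (simp add: X A_def matrix_mul_assoc matrix_mul_add_rdistrib)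
    also have "\<dots> = R ** H ** R ** conj_transpose J" by (simp add: H_def matrix_add_ldistrib)
    finally show ?thesis using RH by (simp add: X)
  qed
  have "conj_transpose (J ** X) = J ** X" by (simp add: X conj_transpose_mult R' matrix_mul_assoc)
  moreover have "conj_transpose (X ** J) = X ** J"
  proof -
    have "X ** J = R ** A" by (simp add: X A_def matrix_mul_assoc)
    then show ?thesis using RA by (simp add: conj_transpose_mult A' R')
  qed
  ultimately show "mp_inverse J = X" using 1 2 by (intro mp_inverse_eqI)
qed

section \<open>Hermitian products and Gram matrices with a kernel correction\<close>

definition outer_sum :: "nat \<Rightarrow> (nat \<Rightarrow> complex^'n) \<Rightarrow> complex^'n^'n" where
  "outer_sum k T = (\<chi> a b. \<Sum>j=1..k. T j $ a * cnj (T j $ b))"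

text \<open>Linear in the first argument. The \<open>inner\<close> of the type is only the real part
  of this product and does not detect complex orthogonality from a single vector.\<close>

definition cinner :: "complex^'n \<Rightarrow> complex^'n \<Rightarrow> complex" where
  "cinner x y = (\<Sum>a\<in>UNIV. x $ a * cnj (y $ a))"

lemma cinner_self: "cinner x x = of_real ((norm x)\<^sup>2)"
  by (simp add: cinner_def norm_vec_def L2_set_def sum_nonneg complex_norm_square flip: of_real_power)

lemma cinner_add_left: "cinner (x + y) z = cinner x z + cinner y z"
  by (simp add: cinner_def distrib_right sum.distrib)

lemma cinner_scale_left: "cinner (c *s x) z = c * cinner x z"
  by (simp add: cinner_def sum_distrib_left mult.assoc)

lemma cinner_commute: "cinner x y = cnj (cinner y x)"
  by (simp add: cinner_def mult.commute)

lemma cinner_sum_left: "cinner (\<Sum>j\<in>A. f j) z = (\<Sum>j\<in>A. cinner (f j) z)"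
  by (induction A rule: infinite_finite_induct) (simp_all add: cinner_add_left, simp_all add: cinner_def)

lemma cinner_conj_transpose: "cinner (conj_transpose A *v x) y = cinner x (A *v y)"
proof -
  have "cinner (conj_transpose A *v x) y = (\<Sum>a\<in>UNIV. \<Sum>b\<in>UNIV. cnj (A $ b $ a) * x $ b * cnj (y $ a))"
    by (simp add: cinner_def conj_transpose_def matrix_vector_mult_def sum_distrib_right)
  also have "\<dots> = (\<Sum>b\<in>UNIV. \<Sum>a\<in>UNIV. cnj (A $ b $ a) * x $ b * cnj (y $ a))" by (rule sum.swap)
  also have "\<dots> = cinner x (A *v y)"
    by (simp add: cinner_def matrix_vector_mult_def sum_distrib_left mult_ac)
  finally show ?thesis .
qed

lemma outer_sum_mult: "outer_sum k T *v v = (\<Sum>j=1..k. cinner v (T j) *s T j)"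
proof (rule vec_eq_iff[THEN iffD2], rule allI)
  fix a
  have "(outer_sum k T *v v) $ a = (\<Sum>b\<in>UNIV. \<Sum>j=1..k. T j $ a * cnj (T j $ b) * v $ b)"
    by (simp add: outer_sum_def matrix_vector_mult_def sum_distrib_right)
  also have "\<dots> = (\<Sum>j=1..k. \<Sum>b\<in>UNIV. T j $ a * cnj (T j $ b) * v $ b)" by (rule sum.swap)
  also have "\<dots> = (\<Sum>j=1..k. cinner v (T j) *s T j) $ a"
    by (simp add: cinner_def sum_distrib_right sum_distrib_left mult_ac)
  finally show "(outer_sum k T *v v) $ a = (\<Sum>j=1..k. cinner v (T j) *s T j) $ a" .
qed

lemma conj_transpose_outer_sum: "conj_transpose (outer_sum k T) = outer_sum k T"
  by (simp add: conj_transpose_def outer_sum_def vec_eq_iff mult.commute)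

lemma matrix_vector_scale: "A *v (c *s x) = c *s (A *v (x :: 'a::comm_semiring_1^'n))"
  by (simp add: matrix_vector_mult_def vec_eq_iff sum_distrib_left mult_ac)

lemma matrix_vector_sum: "A *v (\<Sum>j\<in>S. f j) = (\<Sum>j\<in>S. A *v (f j :: 'a::comm_ring_1^'n))"
  by (induction S rule: infinite_finite_induct) (simp_all add: matrix_vector_right_distrib)

lemma mult_outer_sum_eq_0:
  assumes "\<And>j. j \<in> {1..k} \<Longrightarrow> J *v T j = 0"
  shows "J ** outer_sum k T = 0"
proof -
  have "(J ** outer_sum k T) *v v = 0 *v v" for v
    using assms by (simp add: outer_sum_mult matrix_vector_sum matrix_vector_scale flip: matrix_vector_mul_assoc)
  then show ?thesis using matrix_eq by blast
qed

text \<open>The quadratic form of the matrix at \<open>v\<close> is the squared norm of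
  \<open>J *v v\<close> plus the squared moduli of the products of \<open>v\<close> with the
  \<open>T j\<close>. If \<open>v\<close> is mapped to 0, all these terms vanish.\<close>

lemma invertible_gram_sum:
  fixes J :: "complex^'n^'m"
  assumes "\<And>v. J *v v = 0 \<Longrightarrow> (\<And>j. j \<in> {1..k} \<Longrightarrow> cinner v (T j) = 0) \<Longrightarrow> v = 0"
  shows "invertible (conj_transpose J ** J + outer_sum k T)"
proof -
  have "v = 0" if v: "(conj_transpose J ** J + outer_sum k T) *v v = 0" for v
  proof (rule assms)
    have "(conj_transpose J ** J + outer_sum k T) *v v
        = conj_transpose J *v (J *v v) + (\<Sum>j=1..k. cinner v (T j) *s T j)"
      by (simp add: matrix_vector_mult_add_rdistrib outer_sum_mult matrix_vector_mul_assoc)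
    then have "0 = cinner (conj_transpose J *v (J *v v) + (\<Sum>j=1..k. cinner v (T j) *s T j)) v"
      using v by (simp add: cinner_def)
    also have "\<dots> = cinner (J *v v) (J *v v) + (\<Sum>j=1..k. cinner v (T j) * cinner (T j) v)"
      by (simp add: cinner_add_left cinner_sum_left cinner_scale_left cinner_conj_transpose)
    also have "(\<Sum>j=1..k. cinner v (T j) * cinner (T j) v) = of_real (\<Sum>j=1..k. (cmod (cinner v (T j)))\<^sup>2)"
      by (simp add: cinner_commute[of "T _" v] flip: complex_norm_square)
    finally have "complex_of_real ((norm (J *v v))\<^sup>2 + (\<Sum>j=1..k. (cmod (cinner v (T j)))\<^sup>2)) = 0"
      by (simp add: cinner_self)
    then have "(norm (J *v v))\<^sup>2 + (\<Sum>j=1..k. (cmod (cinner v (T j)))\<^sup>2) = 0" by (simp only: of_real_eq_0_iff)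
    moreover have "(\<Sum>j=1..k. (cmod (cinner v (T j)))\<^sup>2) \<ge> 0" by (simp add: sum_nonneg)
    ultimately have *: "(norm (J *v v))\<^sup>2 = 0" "(\<Sum>j=1..k. (cmod (cinner v (T j)))\<^sup>2) = 0"
      by (smt (verit) zero_le_power2)+
    show "J *v v = 0" using *(1) by simp
    show "cinner v (T j) = 0" if "j \<in> {1..k}" for j
      using *(2) that by (subst (asm) sum_nonneg_eq_0_iff) auto
  qed
  then show ?thesis by (simp add: invertible_left_inverse matrix_left_invertible_ker)
qed

text \<open>The rank is taken as the dimension of the row space. Rows pair bilinearly to 0 with the
  kernel vectors, so in the Hermitian sense they are orthogonal to the conjugates of the
  \<open>T j\<close>. The row space and the span of these conjugates therefore meet only in 0, and
  invertibility of the corrected Gram matrix makes them span everything.\<close>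

lemma rank_eq_of_kernel:
  fixes J :: "complex^'n^'m"
  assumes ker: "\<And>j. j \<in> {1..k} \<Longrightarrow> J *v T j = 0"
    and indep: "\<And>c. (\<Sum>j=1..k. c j *s T j) = 0 \<Longrightarrow> \<forall>j\<in>{1..k}. c j = 0"
    and inv: "invertible (conj_transpose J ** J + outer_sum k T)"
  shows "CARD('n) = rank J + k"
proof -
  define cj :: "complex^'n \<Rightarrow> complex^'n" where "cj v = (\<chi> i. cnj (v $ i))" for v
  define C where "C = (\<lambda>j. cj (T j)) ` {1..k}"
  have indep': "c j = 0" if "(\<Sum>j=1..k. c j *s cj (T j)) = 0" "j \<in> {1..k}" for c j
  proof -
    have "(\<Sum>j=1..k. cnj (c j) *s T j) = cj (\<Sum>j=1..k. c j *s cj (T j))"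
      by (simp add: cj_def vec_eq_iff)
    also have "\<dots> = 0" using that by (simp add: cj_def vec_eq_iff)
    finally show ?thesis using indep[of "\<lambda>j. cnj (c j)"] that(2) by auto
  qed
  have inj: "inj_on (\<lambda>j. cj (T j)) {1..k}"
  proof (rule inj_onI, rule ccontr)
    fix i j assume ij: "i \<in> {1..k}" "j \<in> {1..k}" "cj (T i) = cj (T j)" "i \<noteq> j"
    define c :: "nat \<Rightarrow> complex" where "c a = (if a = i then 1 else if a = j then -1 else 0)" for a
    have "(\<Sum>a=1..k. c a *s cj (T a)) = c i *s cj (T i) + c j *s cj (T j) + (\<Sum>a\<in>{1..k}-{i}-{j}. c a *s cj (T a))"
      using ij sum.remove[of "{1..k}" i "\<lambda>a. c a *s cj (T a)"] sum.remove[of "{1..k} - {i}" j "\<lambda>a. c a *s cj (T a)"]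
      by (simp add: add.assoc)
    also have "(\<Sum>a\<in>{1..k}-{i}-{j}. c a *s cj (T a)) = 0" by (intro sum.neutral) (auto simp: c_def)
    also have "c i *s cj (T i) + c j *s cj (T j) + 0 = 0" using ij by (simp add: c_def vec_eq_iff)
    finally have "c i = 0" using indep' ij by blast
    then show False by (simp add: c_def)
  qed
  have ind: "vec.independent C"
  proof (rule vec.independent_if_scalars_zero)
    fix f x assume f: "(\<Sum>x\<in>C. f x *s x) = 0" and x: "x \<in> C"
    have "(\<Sum>j=1..k. f (cj (T j)) *s cj (T j)) = 0"
      using f unfolding C_def by (subst (asm) sum.reindex[OF inj]) simp
    from indep'[OF this] x show "f x = 0" by (auto simp: C_def)
  qed (simp add: C_def)
  have dimC: "vec.dim (vec.span C) = k"
    using ind inj by (simp add: vec.dim_span vec.dim_eq_card_independent C_def card_image)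
  have rowk: "(\<Sum>a\<in>UNIV. w $ a * T j $ a) = 0" if w: "w \<in> vec.span (rows J)" and j: "j \<in> {1..k}" for w j
    using w
  proof (induction rule: vec.span_induct_alt)
    case base
    then show ?case by simp
  next
    case (step c x y)
    then obtain i where x: "x = row i J" by (auto simp: rows_def)
    have "(\<Sum>a\<in>UNIV. x $ a * T j $ a) = (J *v T j) $ i" by (simp add: x row_def matrix_vector_mult_def)
    then have "(\<Sum>a\<in>UNIV. x $ a * T j $ a) = 0" using ker[OF j] by simp
    moreover have "(\<Sum>a\<in>UNIV. (c *s x + y) $ a * T j $ a) = c * (\<Sum>a\<in>UNIV. x $ a * T j $ a) + (\<Sum>a\<in>UNIV. y $ a * T j $ a)"
      by (simp add: algebra_simps sum.distrib sum_distrib_left)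
    ultimately show ?case using step by simp
  qed
  have int: "vec.span (rows J) \<inter> vec.span C = {0}"
  proof -
    have "w = 0" if w: "w \<in> vec.span (rows J)" "w \<in> vec.span C" for w
    proof -
      have "(\<Sum>a\<in>UNIV. w $ a * cnj (v $ a)) = 0" if "v \<in> vec.span C" for v
        using that
      proof (induction rule: vec.span_induct_alt)
        case base
        then show ?case by simp
      next
        case (step c x y)
        then obtain j where x: "x = cj (T j)" "j \<in> {1..k}" by (auto simp: C_def)
        have "(\<Sum>a\<in>UNIV. w $ a * cnj (x $ a)) = 0" using rowk[OF w(1) x(2)] by (simp add: x cj_def)
        moreover have "(\<Sum>a\<in>UNIV. w $ a * cnj ((c *s x + y) $ a)) = cnj c * (\<Sum>a\<in>UNIV. w $ a * cnj (x $ a)) + (\<Sum>a\<in>UNIV. w $ a * cnj (y $ a))"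
          by (simp add: algebra_simps sum.distrib sum_distrib_left)
        ultimately show ?case using step by simp
      qed
      from this[OF w(2)] have "cinner w w = 0" by (simp add: cinner_def)
      then show ?thesis by (simp add: cinner_self)
    qed
    then show ?thesis using vec.span_zero by blast
  qed
  define H where "H = conj_transpose J ** J + outer_sum k T"
  have sum: "{x + y | x y. x \<in> vec.span (rows J) \<and> y \<in> vec.span C} = UNIV"
  proof -
    \<comment> \<open>The transpose of \<open>H\<close> is also onto, and it splits into the
      transpose of \<open>J\<close> times the conjugate of \<open>J\<close>, with values in the row
      space, and a sum of outer products with values in the span of the conjugated
      \<open>T j\<close>.\<close>
    have "\<exists>x y. z = x + y \<and> x \<in> vec.span (rows J) \<and> y \<in> vec.span C" for z
    proof -
      define w where "w = transpose (matrix_inv H) *v z"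
      have "transpose H ** transpose (matrix_inv H) = mat 1"
        using inv by (simp add: H_def matrix_inv_left transpose_mat flip: matrix_transpose_mul)
      moreover have "transpose H *v w = (transpose H ** transpose (matrix_inv H)) *v z"
        unfolding w_def by (rule matrix_vector_mul_assoc)
      ultimately have z: "z = transpose H *v w" by simp
      have tH: "transpose H = transpose J ** (\<chi> b a. cnj (J $ b $ a)) + (\<chi> a b. \<Sum>j=1..k. T j $ b * cnj (T j $ a))"
        by (simp add: H_def transpose_def vec_eq_iff matrix_matrix_mult_def conj_transpose_def outer_sum_def mult.commute)
      define x where "x = transpose J *v ((\<chi> b a. cnj (J $ b $ a)) *v w)"
      define y where "y = (\<chi> a b. \<Sum>j=1..k. T j $ b * cnj (T j $ a)) *v w"
      have "z = x + y" unfolding z tH x_def y_def by (simp add: matrix_vector_mult_add_rdistrib matrix_vector_mul_assoc)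
      moreover have "x \<in> vec.span (rows J)"
      proof -
        have tq: "transpose J *v q = (\<Sum>i\<in>UNIV. q $ i *s row i J)" for q
          by (simp add: vec_eq_iff matrix_vector_mult_def transpose_def row_def mult.commute)
        show ?thesis unfolding x_def tq
          by (intro vec.span_sum vec.span_scale vec.span_base) (auto simp: rows_def)
      qed
      moreover have "y \<in> vec.span C"
      proof -
        have yC: "y = (\<Sum>j=1..k. (\<Sum>b\<in>UNIV. T j $ b * w $ b) *s cj (T j))"
        proof (rule vec_eq_iff[THEN iffD2], rule allI)
          fix a
          have "y $ a = (\<Sum>b\<in>UNIV. \<Sum>j=1..k. T j $ b * cnj (T j $ a) * w $ b)"
            by (simp add: y_def matrix_vector_mult_def sum_distrib_right)
          also have "\<dots> = (\<Sum>j=1..k. \<Sum>b\<in>UNIV. T j $ b * cnj (T j $ a) * w $ b)" by (rule sum.swap)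
          also have "\<dots> = (\<Sum>j=1..k. (\<Sum>b\<in>UNIV. T j $ b * w $ b) *s cj (T j)) $ a"
            by (simp add: cj_def sum_distrib_right sum_distrib_left mult_ac)
          finally show "y $ a = (\<Sum>j=1..k. (\<Sum>b\<in>UNIV. T j $ b * w $ b) *s cj (T j)) $ a" .
        qed
        show ?thesis unfolding yC
          by (intro vec.span_sum vec.span_scale vec.span_base) (auto simp: C_def)
      qed
      ultimately show ?thesis by blast
    qed
    then show ?thesis by blast
  qed
  have "vec.dim {x + y | x y. x \<in> vec.span (rows J) \<and> y \<in> vec.span C} + vec.dim (vec.span (rows J) \<inter> vec.span C)
      = vec.dim (vec.span (rows J)) + vec.dim (vec.span C)"
    by (rule vec.dim_sums_Int) (auto intro: vec.subspace_span)
  moreover have "vec.dim {0 :: complex^'n} = 0" by (simp add: vec.dim_eq_0)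
  ultimately have "vec.dim (UNIV :: (complex^'n) set) = rank J + k"
    unfolding sum int dimC by (simp add: row_rank_def_gen vec.dim_span)
  then show ?thesis by (simp only: vec_dim_card)
qed

section \<open>Bounded Lipschitz and polynomial functions\<close>

text \<open>Boundedness is part of the notion because Lipschitz functions alone are not closed under
  products.\<close>

definition bounded_lipschitz_on :: "'a::real_normed_vector set \<Rightarrow> ('a \<Rightarrow> 'b::real_normed_vector) \<Rightarrow> bool" where
  "bounded_lipschitz_on S f \<longleftrightarrow> (\<exists>C\<ge>0. (\<forall>x\<in>S. norm (f x) \<le> C) \<and> (\<forall>x\<in>S. \<forall>y\<in>S. norm (f x - f y) \<le> C * norm (x - y)))"

lemma bounded_lipschitz_onI:
  assumes "\<And>x. x \<in> S \<Longrightarrow> norm (f x) \<le> C" "\<And>x y. x \<in> S \<Longrightarrow> y \<in> S \<Longrightarrow> norm (f x - f y) \<le> D * norm (x - y)"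
  shows "bounded_lipschitz_on S f"
  unfolding bounded_lipschitz_on_def
proof (intro exI[of _ "max 0 (max C D)"] conjI ballI)
  fix x assume "x \<in> S"
  then show "norm (f x) \<le> max 0 (max C D)" using assms(1) by (simp add: le_max_iff_disj)
next
  fix x y assume "x \<in> S" "y \<in> S"
  then have "norm (f x - f y) \<le> D * norm (x - y)" by (rule assms(2))
  also have "\<dots> \<le> max 0 (max C D) * norm (x - y)" by (intro mult_right_mono) auto
  finally show "norm (f x - f y) \<le> max 0 (max C D) * norm (x - y)" .
qed simp

lemma bounded_lipschitz_on_subset: "bounded_lipschitz_on S f \<Longrightarrow> T \<subseteq> S \<Longrightarrow> bounded_lipschitz_on T f"
  unfolding bounded_lipschitz_on_def by blast

lemma bounded_lipschitz_on_const [intro]: "bounded_lipschitz_on S (\<lambda>x. c)"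
  by (rule bounded_lipschitz_onI[of _ _ "norm c" 0]) auto

lemma bounded_lipschitz_on_add:
  assumes "bounded_lipschitz_on S f" "bounded_lipschitz_on S g"
  shows "bounded_lipschitz_on S (\<lambda>x. f x + g x)"
proof -
  obtain C where C: "C \<ge> 0" "\<And>x. x \<in> S \<Longrightarrow> norm (f x) \<le> C" "\<And>x y. x \<in> S \<Longrightarrow> y \<in> S \<Longrightarrow> norm (f x - f y) \<le> C * norm (x - y)"
    using assms(1) unfolding bounded_lipschitz_on_def by blast
  obtain D where D: "D \<ge> 0" "\<And>x. x \<in> S \<Longrightarrow> norm (g x) \<le> D" "\<And>x y. x \<in> S \<Longrightarrow> y \<in> S \<Longrightarrow> norm (g x - g y) \<le> D * norm (x - y)"
    using assms(2) unfolding bounded_lipschitz_on_def by blast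
  show ?thesis
  proof (rule bounded_lipschitz_onI[of _ _ "C + D" "C + D"])
    show "norm (f x + g x) \<le> C + D" if "x \<in> S" for x
      using C(2) D(2) that by (intro norm_triangle_mono) auto
    show "norm (f x + g x - (f y + g y)) \<le> (C + D) * norm (x - y)" if "x \<in> S" "y \<in> S" for x y
    proof -
      have "norm ((f x - f y) + (g x - g y)) \<le> C * norm (x - y) + D * norm (x - y)"
        using C(3) D(3) that by (intro norm_triangle_mono) auto
      then show ?thesis by (simp add: algebra_simps)
    qed
  qed
qed

lemma bounded_lipschitz_on_mult:
  fixes f g :: "'a::real_normed_vector \<Rightarrow> 'b::real_normed_algebra"
  assumes "bounded_lipschitz_on S f" "bounded_lipschitz_on S g"
  shows "bounded_lipschitz_on S (\<lambda>x. f x * g x)"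
proof -
  obtain C where C: "C \<ge> 0" "\<And>x. x \<in> S \<Longrightarrow> norm (f x) \<le> C" "\<And>x y. x \<in> S \<Longrightarrow> y \<in> S \<Longrightarrow> norm (f x - f y) \<le> C * norm (x - y)"
    using assms(1) unfolding bounded_lipschitz_on_def by blast
  obtain D where D: "D \<ge> 0" "\<And>x. x \<in> S \<Longrightarrow> norm (g x) \<le> D" "\<And>x y. x \<in> S \<Longrightarrow> y \<in> S \<Longrightarrow> norm (g x - g y) \<le> D * norm (x - y)"
    using assms(2) unfolding bounded_lipschitz_on_def by blast
  show ?thesis
  proof (rule bounded_lipschitz_onI[of _ _ "C * D" "2 * C * D"])
    show "norm (f x * g x) \<le> C * D" if "x \<in> S" for x
      using C D that by (intro order.trans[OF norm_mult_ineq] mult_mono) auto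
    show "norm (f x * g x - f y * g y) \<le> (2 * C * D) * norm (x - y)" if xy: "x \<in> S" "y \<in> S" for x y
    proof -
      have "norm ((f x - f y) * g x + f y * (g x - g y)) \<le> (C * norm (x - y)) * D + C * (D * norm (x - y))"
        using C D xy by (intro norm_triangle_mono order.trans[OF norm_mult_ineq] mult_mono) auto
      then show ?thesis by (simp add: algebra_simps)
    qed
  qed
qed

lemma bounded_lipschitz_on_sum:
  "(\<And>i. i \<in> A \<Longrightarrow> bounded_lipschitz_on S (f i)) \<Longrightarrow> bounded_lipschitz_on S (\<lambda>x. \<Sum>i\<in>A. f i x)"
  by (induction A rule: infinite_finite_induct) (auto intro: bounded_lipschitz_on_add)

lemma bounded_lipschitz_on_prod:
  fixes f :: "'i \<Rightarrow> 'a::real_normed_vector \<Rightarrow> complex"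
  shows "(\<And>i. i \<in> A \<Longrightarrow> bounded_lipschitz_on S (f i)) \<Longrightarrow> bounded_lipschitz_on S (\<lambda>x. \<Prod>i\<in>A. f i x)"
  by (induction A rule: infinite_finite_induct) (auto intro: bounded_lipschitz_on_mult)

lemma bounded_lipschitz_on_cnj: "bounded_lipschitz_on S f \<Longrightarrow> bounded_lipschitz_on S (\<lambda>x. cnj (f x))"
  unfolding bounded_lipschitz_on_def by (simp flip: complex_cnj_diff)

lemma bounded_lipschitz_on_inverse:
  fixes f :: "'a::real_normed_vector \<Rightarrow> complex"
  assumes f: "bounded_lipschitz_on S f" and c: "c > 0" "\<And>x. x \<in> S \<Longrightarrow> norm (f x) \<ge> c"
  shows "bounded_lipschitz_on S (\<lambda>x. inverse (f x))"
proof -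
  obtain C where C: "C \<ge> 0" "\<And>x. x \<in> S \<Longrightarrow> norm (f x) \<le> C" "\<And>x y. x \<in> S \<Longrightarrow> y \<in> S \<Longrightarrow> norm (f x - f y) \<le> C * norm (x - y)"
    using f unfolding bounded_lipschitz_on_def by blast
  have inv: "norm (inverse (f x)) \<le> inverse c" if "x \<in> S" for x
    using c that by (simp add: norm_inverse le_imp_inverse_le)
  show ?thesis
  proof (rule bounded_lipschitz_onI[OF inv])
    fix x y assume xy: "x \<in> S" "y \<in> S"
    have nz: "f x \<noteq> 0" "f y \<noteq> 0" using c xy by force+
    have "inverse (f x) - inverse (f y) = - (inverse (f x) * (f x - f y) * inverse (f y))"
      using nz by (rule inverse_diff_inverse)
    then have "norm (inverse (f x) - inverse (f y)) = norm (inverse (f x)) * norm (f x - f y) * norm (inverse (f y))"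
      by (simp add: norm_mult)
    also have "\<dots> \<le> inverse c * (C * norm (x - y)) * inverse c"
      using inv xy C c by (intro mult_mono) auto
    finally show "norm (inverse (f x) - inverse (f y)) \<le> (inverse c * C * inverse c) * norm (x - y)"
      by (simp add: mult_ac)
  qed
qed

lemma bounded_lipschitz_on_nth:
  "bounded S \<Longrightarrow> bounded_lipschitz_on S (\<lambda>x :: 'a::real_normed_vector^'n. x $ i)"
proof -
  assume "bounded S"
  then obtain B where B: "\<And>x. x \<in> S \<Longrightarrow> norm x \<le> B" unfolding bounded_iff by blast
  show ?thesis
  proof (rule bounded_lipschitz_onI[of _ _ B 1])
    show "norm (x $ i) \<le> B" if "x \<in> S" for x using B[OF that] Finite_Cartesian_Product.norm_nth_le[of x i] by linarith
    show "norm (x $ i - y $ i) \<le> 1 * norm (x - y)" for x y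
      using Finite_Cartesian_Product.norm_nth_le[of "x - y" i] by simp
  qed
qed

lemma bounded_lipschitz_on_det:
  fixes A :: "'a::real_normed_vector \<Rightarrow> complex^'n^'n"
  assumes "\<And>i j. bounded_lipschitz_on S (\<lambda>x. A x $ i $ j)"
  shows "bounded_lipschitz_on S (\<lambda>x. det (A x))"
  unfolding det_def
  by (intro bounded_lipschitz_on_sum bounded_lipschitz_on_mult bounded_lipschitz_on_prod assms bounded_lipschitz_on_const)

lemma norm_matrix_vector_le:
  fixes A :: "complex^'n^'m"
  shows "norm (A *v w) \<le> (\<Sum>i\<in>UNIV. \<Sum>j\<in>UNIV. norm (A $ i $ j)) * norm w"
proof -
  have "norm (A *v w) \<le> (\<Sum>i\<in>UNIV. norm ((A *v w) $ i))" unfolding norm_vec_def by (rule L2_set_le_sum) simp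
  also have "\<dots> \<le> (\<Sum>i\<in>UNIV. \<Sum>j\<in>UNIV. norm (A $ i $ j) * norm w)"
  proof (rule sum_mono)
    fix i
    have "norm ((A *v w) $ i) \<le> (\<Sum>j\<in>UNIV. norm (A $ i $ j * w $ j))"
      unfolding matrix_vector_mult_def by (simp add: norm_sum)
    also have "\<dots> \<le> (\<Sum>j\<in>UNIV. norm (A $ i $ j) * norm w)"
      by (intro sum_mono) (simp add: norm_mult mult_left_mono Finite_Cartesian_Product.norm_nth_le)
    finally show "norm ((A *v w) $ i) \<le> (\<Sum>j\<in>UNIV. norm (A $ i $ j) * norm w)" .
  qed
  finally show ?thesis by (simp add: sum_distrib_right)
qed

text \<open>Turns entrywise estimates into the operator estimates that
  \<open>gauss_newton_convergence\<close> asks of the Jacobian and its Moore-Penrose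
  inverse.\<close>

lemma bounded_lipschitz_on_matrix:
  fixes A :: "'a::real_normed_vector \<Rightarrow> complex^'n^'m"
  assumes "\<And>i j. bounded_lipschitz_on S (\<lambda>x. A x $ i $ j)"
  obtains L where "L \<ge> 0" "\<And>x w. x \<in> S \<Longrightarrow> norm (A x *v w) \<le> L * norm w"
    "\<And>x y w. x \<in> S \<Longrightarrow> y \<in> S \<Longrightarrow> norm (A x *v w - A y *v w) \<le> L * norm (x - y) * norm w"
proof -
  have "\<forall>i j. \<exists>C\<ge>0. (\<forall>x\<in>S. norm (A x $ i $ j) \<le> C) \<and> (\<forall>x\<in>S. \<forall>y\<in>S. norm (A x $ i $ j - A y $ i $ j) \<le> C * norm (x - y))"
    using assms unfolding bounded_lipschitz_on_def by blast
  then obtain C where C: "\<And>i j. C i j \<ge> 0" "\<And>i j x. x \<in> S \<Longrightarrow> norm (A x $ i $ j) \<le> C i j"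
    "\<And>i j x y. x \<in> S \<Longrightarrow> y \<in> S \<Longrightarrow> norm (A x $ i $ j - A y $ i $ j) \<le> C i j * norm (x - y)" by metis
  define L where "L = (\<Sum>i\<in>UNIV. \<Sum>j\<in>UNIV. C i j)"
  show ?thesis
  proof (rule that[of L])
    show "L \<ge> 0" unfolding L_def using C by (intro sum_nonneg) auto
    fix x w assume x: "x \<in> S"
    have "norm (A x *v w) \<le> (\<Sum>i\<in>UNIV. \<Sum>j\<in>UNIV. norm (A x $ i $ j)) * norm w" by (rule norm_matrix_vector_le)
    also have "\<dots> \<le> L * norm w" unfolding L_def using C x by (intro mult_right_mono sum_mono) auto
    finally show "norm (A x *v w) \<le> L * norm w" .
    fix y assume y: "y \<in> S"
    have "norm ((A x - A y) *v w) \<le> (\<Sum>i\<in>UNIV. \<Sum>j\<in>UNIV. norm ((A x - A y) $ i $ j)) * norm w" by (rule norm_matrix_vector_le)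
    also have "\<dots> \<le> (\<Sum>i\<in>UNIV. \<Sum>j\<in>UNIV. C i j * norm (x - y)) * norm w"
      using C x y by (intro mult_right_mono sum_mono) auto
    also have "\<dots> = L * norm (x - y) * norm w" by (simp add: L_def sum_distrib_right)
    finally show "norm (A x *v w - A y *v w) \<le> L * norm (x - y) * norm w"
      by (simp add: matrix_vector_mult_diff_rdistrib)
  qed
qed

text \<open>Cramer's rule. It writes the entries of the inverse as quotients of determinants, so a
  lower bound on the determinant makes the inverse Lipschitz.\<close>

lemma matrix_inv_nth:
  fixes A :: "complex^'n^'n"
  assumes "det A \<noteq> 0"
  shows "matrix_inv A $ i $ j = det (\<chi> a b. if b = i then axis j 1 $ a else A $ a $ b) * inverse (det A)"
proof -
  have "A ** matrix_inv A = mat 1" using assms by (intro matrix_inv_right) (simp add: invertible_det_nz)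
  then have "A *v (matrix_inv A *v axis j 1) = axis j 1" by (simp add: matrix_vector_mul_assoc)
  then have "matrix_inv A *v axis j 1 = (\<chi> k. det (\<chi> a b. if b = k then axis j 1 $ a else A $ a $ b) / det A)"
    using cramer[OF assms, of "matrix_inv A *v axis j 1" "axis j 1"] by simp
  then have "(matrix_inv A *v axis j 1) $ i = det (\<chi> a b. if b = i then axis j 1 $ a else A $ a $ b) / det A"
    by simp
  moreover have "(matrix_inv A *v axis j 1) $ i = matrix_inv A $ i $ j"
    by (simp add: matrix_vector_mult_def axis_def if_distrib cong: if_cong)
  ultimately show ?thesis by (simp add: divide_inverse)
qed

lemma bounded_lipschitz_on_matrix_inv:
  fixes A :: "'a::real_normed_vector \<Rightarrow> complex^'n^'n"
  assumes A: "\<And>i j. bounded_lipschitz_on S (\<lambda>x. A x $ i $ j)" and c: "c > 0" "\<And>x. x \<in> S \<Longrightarrow> norm (det (A x)) \<ge> c"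
  shows "bounded_lipschitz_on S (\<lambda>x. matrix_inv (A x) $ i $ j)"
proof -
  have "bounded_lipschitz_on S (\<lambda>x. if b = i then axis j 1 $ a else A x $ a $ b)" for a b
    using A by (cases "b = i") auto
  then have "bounded_lipschitz_on S (\<lambda>x. det (\<chi> a b. if b = i then axis j 1 $ a else A x $ a $ b) * inverse (det (A x)))"
    using A c by (intro bounded_lipschitz_on_mult bounded_lipschitz_on_det bounded_lipschitz_on_inverse) auto
  moreover have "matrix_inv (A x) $ i $ j = det (\<chi> a b. if b = i then axis j 1 $ a else A x $ a $ b) * inverse (det (A x))"
    if "x \<in> S" for x
    using c that by (intro matrix_inv_nth) force
  ultimately show ?thesis unfolding bounded_lipschitz_on_def by simp
qed

section \<open>Polynomial functions of complex coordinates\<close>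

inductive polynomial_fun :: "(complex^'n \<Rightarrow> complex) \<Rightarrow> bool" where
  const: "polynomial_fun (\<lambda>x. c)"
| coord: "polynomial_fun (\<lambda>x. x $ i)"
| add: "polynomial_fun f \<Longrightarrow> polynomial_fun g \<Longrightarrow> polynomial_fun (\<lambda>x. f x + g x)"
| mult: "polynomial_fun f \<Longrightarrow> polynomial_fun g \<Longrightarrow> polynomial_fun (\<lambda>x. f x * g x)"

lemma polynomial_fun_sum: "(\<And>i. i \<in> A \<Longrightarrow> polynomial_fun (f i)) \<Longrightarrow> polynomial_fun (\<lambda>x. \<Sum>i\<in>A. f i x)"
  by (induction A rule: infinite_finite_induct) (auto intro: polynomial_fun.intros)

lemma polynomial_fun_bounded_lipschitz_on:
  "polynomial_fun f \<Longrightarrow> bounded S \<Longrightarrow> bounded_lipschitz_on S f"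
  by (induction rule: polynomial_fun.induct)
    (auto intro: bounded_lipschitz_on_nth bounded_lipschitz_on_add bounded_lipschitz_on_mult)

text \<open>Conjugation is not among the generators, so the real Frechet derivative is complex
  linear and given by a row of complex entries, again polynomial.\<close>

lemma polynomial_fun_derivative:
  fixes f :: "complex^'n \<Rightarrow> complex"
  assumes "polynomial_fun f"
  shows "\<exists>D. (\<forall>j. polynomial_fun (D j)) \<and> (\<forall>x. (f has_derivative (\<lambda>h. \<Sum>j\<in>UNIV. D j x * h $ j)) (at x))"
  using assms
proof (induction rule: polynomial_fun.induct)
  case (const c)
  then show ?case by (intro exI[of _ "\<lambda>j x. 0"]) (auto intro: polynomial_fun.const)
next
  case (coord i)
  have "(\<Sum>j\<in>UNIV. (if j = i then 1 else 0) * h $ j) = h $ i" for h :: "complex^'n"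
    by (simp add: if_distrib[of "\<lambda>x. x * _"] cong: if_cong)
  moreover have "((\<lambda>x :: complex^'n. x $ i) has_derivative (\<lambda>h. h $ i)) (at x)" for x
    by (intro bounded_linear_imp_has_derivative bounded_linear_vec_nth)
  ultimately show ?case
    by (intro exI[of _ "\<lambda>j x. if j = i then 1 else 0"]) (auto intro: polynomial_fun.const)
next
  case (add f g)
  then obtain D E where D: "\<And>j. polynomial_fun (D j)" "\<And>x. (f has_derivative (\<lambda>h. \<Sum>j\<in>UNIV. D j x * h $ j)) (at x)"
    and E: "\<And>j. polynomial_fun (E j)" "\<And>x. (g has_derivative (\<lambda>h. \<Sum>j\<in>UNIV. E j x * h $ j)) (at x)" by blast
  have "((\<lambda>x. f x + g x) has_derivative (\<lambda>h. \<Sum>j\<in>UNIV. (D j x + E j x) * h $ j)) (at x)" for x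
    using has_derivative_add[OF D(2)[of x] E(2)[of x]] by (simp add: distrib_right sum.distrib)
  then show ?case using D E by (intro exI[of _ "\<lambda>j x. D j x + E j x"]) (auto intro: polynomial_fun.add)
next
  case (mult f g)
  then obtain D E where D: "\<And>j. polynomial_fun (D j)" "\<And>x. (f has_derivative (\<lambda>h. \<Sum>j\<in>UNIV. D j x * h $ j)) (at x)"
    and E: "\<And>j. polynomial_fun (E j)" "\<And>x. (g has_derivative (\<lambda>h. \<Sum>j\<in>UNIV. E j x * h $ j)) (at x)" by blast
  have "((\<lambda>x. f x * g x) has_derivative (\<lambda>h. \<Sum>j\<in>UNIV. (f x * E j x + D j x * g x) * h $ j)) (at x)" for x
  proof -
    have "(\<Sum>j\<in>UNIV. (f x * E j x + D j x * g x) * h $ j) = f x * (\<Sum>j\<in>UNIV. E j x * h $ j) + (\<Sum>j\<in>UNIV. D j x * h $ j) * g x" for h :: "complex^'n"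
      unfolding sum_distrib_left sum_distrib_right sum.distrib[symmetric]
      by (rule sum.cong) (simp_all add: algebra_simps)
    then show ?thesis using has_derivative_mult[OF D(2)[of x] E(2)[of x]] by simp
  qed
  moreover have "polynomial_fun (\<lambda>x. f x * E j x + D j x * g x)" for j
    by (intro polynomial_fun.add polynomial_fun.mult mult.hyps D(1) E(1))
  ultimately show ?case by (intro exI[of _ "\<lambda>j x. f x * E j x + D j x * g x"]) auto
qed

lemma polynomial_fun_jacobian:
  fixes G :: "complex^'n \<Rightarrow> complex^'m"
  assumes "\<And>i. polynomial_fun (\<lambda>x. G x $ i)"
  obtains J where "\<And>i j. polynomial_fun (\<lambda>x. J x $ i $ j)" "\<And>x. (G has_derivative (\<lambda>h. J x *v h)) (at x)"
proof -
  have "\<forall>i. \<exists>D. (\<forall>j. polynomial_fun (D j)) \<and> (\<forall>x. ((\<lambda>x. G x $ i) has_derivative (\<lambda>h. \<Sum>j\<in>UNIV. D j x * h $ j)) (at x))"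
    using polynomial_fun_derivative assms by blast
  then obtain D where D: "\<And>i j. polynomial_fun (D i j)"
    "\<And>i x. ((\<lambda>x. G x $ i) has_derivative (\<lambda>h. \<Sum>j\<in>UNIV. D i j x * h $ j)) (at x)" by metis
  define J where "J x = (\<chi> i j. D i j x)" for x
  show ?thesis
  proof (rule that[of J])
    show "polynomial_fun (\<lambda>x. J x $ i $ j)" for i j using D(1) by (simp add: J_def)
    show "(G has_derivative (\<lambda>h. J x *v h)) (at x)" for x
      unfolding has_derivative_componentwise_within[of G]
    proof
      fix b :: "complex^'m" assume "b \<in> Basis"
      then obtain i c where b: "b = axis i c" "c \<in> Basis" by (auto simp: Basis_vec_def)
      have "((\<lambda>x. G x $ i \<bullet> c) has_derivative (\<lambda>h. (\<Sum>j\<in>UNIV. D i j x * h $ j) \<bullet> c)) (at x)"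
        by (intro has_derivative_inner_left D(2))
      then show "((\<lambda>x. G x \<bullet> b) has_derivative (\<lambda>h. (J x *v h) \<bullet> b)) (at x)"
        by (simp add: b inner_axis J_def matrix_vector_mult_def)
    qed
  qed
qed

section \<open>Convergence of the Gauss--Newton iteration with constant rank\<close>

text \<open>With step ratio 1/4 the path from \<open>X j\<close> to the limit is at most the
  geometric series 1 / (1 - 1/4) = 4/3 times the step at \<open>j\<close>.\<close>

lemma geometric_steps_converge:
  fixes X :: "nat \<Rightarrow> 'a :: banach"
  assumes step: "\<And>j. norm (X (Suc (Suc j)) - X (Suc j)) \<le> norm (X (Suc j) - X j) / 4"
  shows "\<exists>l. X \<longlonglongrightarrow> l \<and> (\<forall>j. norm (X j - l) \<le> 4/3 * norm (X (Suc j) - X j))"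
proof -
  define d where "d j = norm (X (Suc j) - X j)" for j
  have d: "d (j + n) \<le> d j / 4 ^ n" for j n
  proof (induction n)
    case (Suc n)
    have "d (j + Suc n) \<le> d (j + n) / 4" using step[of "j + n"] by (simp add: d_def)
    also have "\<dots> \<le> d j / 4 ^ n / 4" using Suc by (intro divide_right_mono) auto
    finally show ?case by simp
  qed simp
  have X: "norm (X (j + n) - X j) \<le> 4/3 * (1 - 1 / 4 ^ n) * d j" for j n
  proof (induction n)
    case (Suc n)
    have "norm (X (j + Suc n) - X j) \<le> d (j + n) + norm (X (j + n) - X j)"
      unfolding d_def using norm_triangle_ineq[of "X (Suc (j + n)) - X (j + n)" "X (j + n) - X j"] by simp
    also have "\<dots> \<le> d j / 4 ^ n + 4/3 * (1 - 1 / 4 ^ n) * d j" using d[of j n] Suc by (rule add_mono)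
    also have "\<dots> = 4/3 * (1 - 1 / 4 ^ Suc n) * d j" by (simp add: field_simps)
    finally show ?case .
  qed simp
  have X': "norm (X (j + n) - X j) \<le> 4/3 * d j" for j n
  proof -
    have "(1 - 1 / 4 ^ n) * d j \<le> 1 * d j" by (intro mult_right_mono) (auto simp: d_def)
    then have "4/3 * (1 - 1 / 4 ^ n) * d j \<le> 4/3 * d j" unfolding mult.assoc by (intro mult_left_mono) auto
    then show ?thesis using X[of j n] by (rule order.trans[rotated])
  qed
  have "(\<lambda>n. d 0 / 4 ^ n) \<longlonglongrightarrow> 0" by real_asymp
  then have d0: "d \<longlonglongrightarrow> 0"
    by (rule tendsto_sandwich[OF _ _ tendsto_const, rotated 2]) (use d[of 0] in \<open>auto simp: d_def\<close>)
  have "Cauchy X"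
  proof (rule CauchyI)
    fix e :: real assume "e > 0"
    then have "\<forall>\<^sub>F n in sequentially. d n < e / 4" using order_tendstoD(2)[OF d0, of "e / 4"] by simp
    then obtain N where N: "d N < e / 4" by (auto simp: eventually_sequentially)
    have *: "norm (X m - X N) < e / 2" if "m \<ge> N" for m
    proof -
      have "norm (X m - X N) \<le> 4/3 * d N" using X'[of N "m - N"] that by simp
      then show ?thesis using N \<open>e > 0\<close> by simp
    qed
    show "\<exists>M. \<forall>m\<ge>M. \<forall>n\<ge>M. norm (X m - X n) < e"
    proof (intro exI[of _ N] allI impI)
      fix m n assume "N \<le> m" "N \<le> n"
      then show "norm (X m - X n) < e" using *[of m] *[of n]
        by (metis field_sum_of_halves norm_diff_triangle_less norm_minus_commute)
    qed
  qed
  then obtain l where l: "X \<longlonglongrightarrow> l" using Cauchy_convergent convergentD by blast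
  moreover have "norm (X j - l) \<le> 4/3 * d j" for j
  proof (rule LIMSEQ_le_const2)
    show "(\<lambda>n. norm (X j - X (n + j))) \<longlonglongrightarrow> norm (X j - l)"
      using l by (intro tendsto_intros LIMSEQ_ignore_initial_segment)
    show "\<exists>N. \<forall>n\<ge>N. norm (X j - X (n + j)) \<le> 4/3 * d j"
      using X'[of j] by (auto simp: norm_minus_commute add.commute)
  qed
  ultimately show ?thesis unfolding d_def by blast
qed

text \<open>\<open>M x\<close> plays the Moore-Penrose inverse of \<open>J x\<close>, but only the
  outer-inverse law \<open>MJM\<close> is imposed near \<open>a\<close>. The hypothesis
  \<open>orbit\<close> supplies an exact solution \<open>z\<close> for which \<open>x - z\<close>
  has no kernel component. The crude constant \<open>L\<close> only shapes the neighbourhood; the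
  error bound is stated with \<kappa>, the bound on \<open>M\<close> at the single point
  \<open>a\<close>.\<close>

theorem gauss_newton_convergence:
  fixes G :: "'a::euclidean_space \<Rightarrow> 'b::euclidean_space" and J :: "'a \<Rightarrow> 'a \<Rightarrow> 'b" and M :: "'a \<Rightarrow> 'b \<Rightarrow> 'a"
    and Z :: "'a set"
  assumes \<rho>: "\<rho> > 0" and L: "L \<ge> 1" and \<kappa>: "\<kappa> > 0"
    and der: "\<And>x. x \<in> ball a \<rho> \<Longrightarrow> (G has_derivative J x) (at x)"
    and linM: "\<And>x. linear (M x)"
    and Jbd: "\<And>x v. x \<in> ball a \<rho> \<Longrightarrow> norm (J x v) \<le> L * norm v"
    and Jlip: "\<And>x y v. x \<in> ball a \<rho> \<Longrightarrow> y \<in> ball a \<rho> \<Longrightarrow> norm (J x v - J y v) \<le> L * norm (x - y) * norm v"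
    and Mbd: "\<And>x w. x \<in> ball a \<rho> \<Longrightarrow> norm (M x w) \<le> L * norm w"
    and Mlip: "\<And>x y w. x \<in> ball a \<rho> \<Longrightarrow> y \<in> ball a \<rho> \<Longrightarrow> norm (M x w - M y w) \<le> L * norm (x - y) * norm w"
    and MJM: "\<And>x w. x \<in> ball a \<rho> \<Longrightarrow> M x (J x (M x w)) = M x w"
    and orbit: "\<And>x. x \<in> ball a \<rho> \<Longrightarrow> \<exists>z\<in>Z. norm (x - z) \<le> norm (x - a) \<and> G z = b \<and>
                   (z \<in> ball a \<rho> \<longrightarrow> M z (J z (x - z)) = x - z)"
    and Ga: "G a = b"
    and Ma: "\<And>w. norm (M a w) \<le> \<kappa> * norm w"
  shows "\<exists>\<delta>>0. \<exists>\<epsilon>>0. \<forall>y X. norm (y - b) < \<delta> \<longrightarrow> norm (X 0 - a) < \<epsilon> \<longrightarrow>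
      (\<forall>j. X (Suc j) = X j - M (X j) (G (X j) - y)) \<longrightarrow>
      (\<forall>j. X j \<in> ball a \<rho>) \<and>
      (\<exists>l. X \<longlonglongrightarrow> l \<and> (\<exists>z\<in>Z. norm (l - z) \<le> 4 * \<kappa> * norm (y - b)) \<and>
         (y = b \<longrightarrow> (\<exists>C. \<forall>j. norm (X (Suc j) - l) \<le> C * (norm (X j - l))\<^sup>2)))"
proof -
  have L2: "1 \<le> L ^ n" for n using L by simp
  have seg: "closed_segment x y \<subseteq> ball a \<rho>" if "x \<in> ball a \<rho>" "y \<in> ball a \<rho>" for x y
    using that by (simp add: closed_segment_subset)
  have taylor: "norm (G y - G x - J x (y - x)) \<le> L * (norm (y - x))\<^sup>2"
    if xy: "x \<in> ball a \<rho>" "y \<in> ball a \<rho>" for x y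
  proof -
    have "norm (G y - G x - J x (y - x)) \<le> norm (y - x) * (L * norm (y - x))"
    proof (rule differentiable_bound_linearization[where S = "closed_segment x y"])
      show "x + t *\<^sub>R (y - x) \<in> closed_segment x y" if "t \<in> {0..1}" for t
        using that by (auto simp: closed_segment_def algebra_simps intro!: exI[of _ t])
      show "(G has_derivative J z) (at z within closed_segment x y)" if "z \<in> closed_segment x y" for z
        using der[of z] seg[OF xy] that by (blast intro: has_derivative_at_withinI)
      show "onorm (J z - J x) \<le> L * norm (y - x)" if z: "z \<in> closed_segment x y" for z
        unfolding fun_diff_def
      proof (rule onorm_le)
        fix v :: 'a
        have "norm (z - x) \<le> norm (y - x)" using z segment_bound(1) by (metis norm_minus_commute)
        then have "L * norm (z - x) * norm v \<le> L * norm (y - x) * norm v"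
          using L by (intro mult_right_mono mult_left_mono) auto
        then show "norm (J z v - J x v) \<le> L * norm (y - x) * norm v"
          using Jlip[of z x v] seg[OF xy] z xy by fastforce
      qed
    qed auto
    then show ?thesis by (simp add: power2_eq_square mult_ac)
  qed
  have lipG: "norm (G y - G x) \<le> L * norm (y - x)" if xy: "x \<in> ball a \<rho>" "y \<in> ball a \<rho>" for x y
    using der Jbd xy by (intro differentiable_bound[of "ball a \<rho>" G J L])
      (auto intro!: onorm_le intro: has_derivative_at_withinI)
  \<comment> \<open>In order: the solution \<open>z\<close> near \<open>x\<close> stays in the large
    ball, being within 2 \<rho>1 of \<open>a\<close>; the error factor
    \<open>2 * L^2 * norm d\<close> in \<open>near\<close> is at most 1/2; \<open>M\<close> changes
    by at most \<kappa> between \<open>a\<close> and the limit; and steps contract, with \<delta>,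
    by 3 * (1/24 + 1/24) = 1/4.\<close>
  define \<rho>1 where "\<rho>1 = Min {\<rho> / 4, 1 / (4 * L^2), \<kappa> / L, 1 / (24 * L^4)}"
  have "\<rho>1 > 0" using \<rho> \<kappa> L by (simp add: \<rho>1_def)
  moreover have "\<rho>1 \<le> \<rho> / 4" "\<rho>1 \<le> 1 / (4 * L^2)" "\<rho>1 \<le> \<kappa> / L" "\<rho>1 \<le> 1 / (24 * L^4)"
    unfolding \<rho>1_def by (rule Min_le; simp)+
  ultimately have \<rho>1: "\<rho>1 > 0" "\<rho>1 \<le> \<rho> / 4" "\<rho>1 \<le> 1 / (4 * L^2)" "\<rho>1 \<le> \<kappa> / L" "\<rho>1 \<le> 1 / (24 * L^4)"
    by blast+
  have in\<rho>: "x \<in> ball a \<rho>" if "norm (x - a) \<le> \<rho>1" for x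
    using that \<rho>1 \<rho> by (simp add: dist_norm norm_minus_commute)
  \<comment> \<open>The first bound is for the contraction. The second, together with \<epsilon>,
    makes the first step at most \<rho>1 / 4, so all iterates stay within \<rho>1 / 3 of the start,
    which is itself within \<rho>1 / 8 of \<open>a\<close>.\<close>
  define \<delta> where "\<delta> = min (1 / (24 * L^3)) (\<rho>1 / (8 * L))"
  define \<epsilon> where "\<epsilon> = \<rho>1 / (8 * L^2)"
  have \<delta>: "\<delta> > 0" "\<delta> \<le> 1 / (24 * L^3)" "\<delta> \<le> \<rho>1 / (8 * L)" using \<rho>1 L by (auto simp: \<delta>_def)
  have \<epsilon>: "\<epsilon> > 0" using \<rho>1 L by (auto simp: \<epsilon>_def)
  have contr: "3 * L^3 * (L * \<rho>1 + \<delta>) \<le> 1 / 4"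
  proof -
    have "L^4 * \<rho>1 \<le> 1 / 24" using \<rho>1(5) L by (simp add: field_simps)
    moreover have "L^3 * \<delta> \<le> 1 / 24" using \<delta>(2) L by (simp add: field_simps)
    moreover have "3 * L^3 * (L * \<rho>1 + \<delta>) = 3 * (L^4 * \<rho>1) + 3 * (L^3 * \<delta>)"
      by (simp add: algebra_simps power_def numeral_eq_Suc)
    ultimately show ?thesis by linarith
  qed
  \<comment> \<open>\<open>M x\<close> recovers the offset \<open>x - z\<close> from the residual up
    to half its size: \<open>M z\<close> applied to \<open>J z d\<close> returns \<open>d\<close>
    exactly, and replacing \<open>M z\<close> by \<open>M x\<close> and \<open>G\<close> by its
    linearization costs \<open>2 * L^2\<close> times the square of \<open>norm d\<close>.\<close>
  have near: "\<exists>z\<in>Z. norm (M x (G x - b) - (x - z)) \<le> norm (x - z) / 2 \<and> norm (G x - b) \<le> L * norm (x - z)"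
    if x: "norm (x - a) \<le> \<rho>1" for x
  proof -
    have xb: "x \<in> ball a \<rho>" using in\<rho> x .
    obtain z where z: "z \<in> Z" "norm (x - z) \<le> norm (x - a)" "G z = b"
      "z \<in> ball a \<rho> \<Longrightarrow> M z (J z (x - z)) = x - z" using orbit[OF xb] by blast
    have "norm (z - a) \<le> norm (x - z) + norm (x - a)"
      using norm_triangle_ineq4[of "x - a" "x - z"] by simp
    then have "norm (z - a) < \<rho>" using z(2) x \<rho>1 \<rho> by simp
    then have zb: "z \<in> ball a \<rho>" by (simp add: dist_norm norm_minus_commute)
    define d where "d = x - z"
    have Mz: "M z (J z d) = d" using z(4) zb by (simp add: d_def)
    define e where "e = G x - G z - J z d"
    have e: "norm e \<le> L * (norm d)\<^sup>2" using taylor[OF zb xb] by (simp add: e_def d_def)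
    have "M x (G x - b) - d = (M x (J z d) - M z (J z d)) + M x e"
      using z(3) Mz by (simp add: e_def flip: linear_add[OF linM])
    also have "norm \<dots> \<le> L * norm d * (L * norm d) + L * (L * (norm d)\<^sup>2)"
    proof (rule norm_triangle_mono)
      have "norm (M x (J z d) - M z (J z d)) \<le> L * norm (x - z) * norm (J z d)" using Mlip[OF xb zb] .
      also have "\<dots> \<le> L * norm (x - z) * (L * norm d)" using Jbd[OF zb] L by (intro mult_left_mono) auto
      finally show "norm (M x (J z d) - M z (J z d)) \<le> L * norm d * (L * norm d)" by (simp add: d_def)
      have "norm (M x e) \<le> L * norm e" using Mbd[OF xb] .
      also have "\<dots> \<le> L * (L * (norm d)\<^sup>2)" using e L by (intro mult_left_mono) auto
      finally show "norm (M x e) \<le> L * (L * (norm d)\<^sup>2)" .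
    qed
    also have "\<dots> = (2 * L^2 * norm d) * norm d" by (simp add: power2_eq_square algebra_simps)
    also have "\<dots> \<le> 1/2 * norm d"
    proof (rule mult_right_mono)
      have "norm d \<le> 1 / (4 * L^2)" using z(2) x \<rho>1(3) by (simp add: d_def)
      then show "2 * L^2 * norm d \<le> 1 / 2" using L by (simp add: field_simps)
    qed simp
    finally have "norm (M x (G x - b) - d) \<le> norm d / 2" by simp
    moreover have "norm (G x - b) \<le> L * norm d" using lipG[OF zb xb] z(3) by (simp add: d_def)
    ultimately show ?thesis using z(1) by (auto simp: d_def)
  qed
  show ?thesis
  proof (rule exI[of _ \<delta>], rule conjI[OF \<delta>(1)], rule exI[of _ \<epsilon>], rule conjI[OF \<epsilon>], intro allI impI)
    fix y :: 'b and X :: "nat \<Rightarrow> 'a"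
    assume y: "norm (y - b) < \<delta>" and "norm (X 0 - a) < \<epsilon>"
      and rec: "\<forall>j. X (Suc j) = X j - M (X j) (G (X j) - y)"
    define x0 where "x0 = X 0"
    have x0: "norm (x0 - a) < \<epsilon>" using \<open>norm (X 0 - a) < \<epsilon>\<close> by (simp add: x0_def)
    define s where "s x = M x (G x - y)" for x
    have XS: "X (Suc j) = X j - s (X j)" and X0: "X 0 = x0" for j by (simp_all add: rec s_def x0_def)
    have res: "norm (G x - y) \<le> L * norm (x - a) + norm (y - b)" if "norm (x - a) \<le> \<rho>1" for x
    proof -
      have "norm (G x - y) \<le> norm (G x - G a) + norm (b - y)"
        using norm_triangle_ineq[of "G x - G a" "b - y"] Ga by simp
      also have "norm (G x - G a) \<le> L * norm (x - a)" using lipG[of a x] in\<rho>[OF that] \<rho> by simp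
      finally show ?thesis by (simp add: norm_minus_commute)
    qed
    have res': "norm (G x - y) \<le> L * \<rho>1 + \<delta>" if "norm (x - a) \<le> \<rho>1" for x
    proof -
      have "L * norm (x - a) \<le> L * \<rho>1" using that L by (intro mult_left_mono) auto
      then show ?thesis using res[OF that] y by simp
    qed
    have step: "norm (s (x - s x)) \<le> 3 * L^3 * norm (G x - y) * norm (s x)"
      if x: "norm (x - a) \<le> \<rho>1" and x': "norm (x - s x - a) \<le> \<rho>1" for x
    proof -
      define x1 where "x1 = x - s x"
      define r where "r = norm (G x - y)"
      have xb: "x \<in> ball a \<rho>" "x1 \<in> ball a \<rho>" using in\<rho> x x' by (auto simp: x1_def)
      define e where "e = G x1 - G x - J x (x1 - x)"
      have linJ: "linear (J x)" using der[OF xb(1)] has_derivative_linear by blast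
      have Je: "J x (x1 - x) = - J x (s x)" using linJ by (simp add: x1_def linear_neg)
      have e: "norm e \<le> L * (norm (s x))\<^sup>2" using taylor[OF xb] by (simp add: e_def x1_def)
      have s: "norm (s x) \<le> L * r" using Mbd[OF xb(1)] by (simp add: s_def r_def)
      \<comment> \<open>The linearized residual left over after the step. \<open>M x\<close>
        annihilates it by \<open>MJM\<close>, so the next step sees only the change of
        \<open>M\<close> from \<open>x\<close> to \<open>x1\<close> and the Taylor error, both
        proportional to the present step.\<close>
      define q where "q = G x - y - J x (s x)"
      have "M x q = M x (G x - y) - M x (J x (M x (G x - y)))"
        unfolding q_def s_def by (rule linear_diff[OF linM])
      then have q0: "M x q = 0" using MJM[OF xb(1), of "G x - y"] by simp
      have q: "norm q \<le> (1 + L^2) * r"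
      proof -
        have "norm q \<le> r + norm (J x (s x))" unfolding q_def r_def by (rule norm_triangle_ineq4)
        also have "norm (J x (s x)) \<le> L * norm (s x)" using Jbd[OF xb(1)] .
        also have "\<dots> \<le> L * (L * r)" using s L by (intro mult_left_mono) auto
        finally show ?thesis by (simp add: power2_eq_square algebra_simps)
      qed
      have "G x1 - y = q + e" using Je by (simp add: q_def e_def)
      then have "s x1 = (M x1 q - M x q) + M x1 e" using q0 by (simp add: s_def linear_add[OF linM])
      also have "norm \<dots> \<le> L * norm (s x) * ((1 + L^2) * r) + L * (norm (s x) * (L * (L * r)))"
      proof (rule norm_triangle_mono)
        have "norm (M x1 q - M x q) \<le> L * norm (x1 - x) * norm q" using Mlip[OF xb(2,1)] .
        also have "\<dots> \<le> L * norm (x1 - x) * ((1 + L^2) * r)" using q L by (intro mult_left_mono) auto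
        finally show "norm (M x1 q - M x q) \<le> L * norm (s x) * ((1 + L^2) * r)" by (simp add: x1_def)
        have "norm (M x1 e) \<le> L * norm e" using Mbd[OF xb(2)] .
        also have "norm e \<le> L * (norm (s x))\<^sup>2" using e .
        also have "\<dots> = norm (s x) * (L * norm (s x))" by (simp add: power2_eq_square)
        also have "\<dots> \<le> norm (s x) * (L * (L * r))" using s L by (intro mult_left_mono) auto
        finally show "norm (M x1 e) \<le> L * (norm (s x) * (L * (L * r)))" using L by simp
      qed
      also have "\<dots> = (L + 2 * L^3) * (r * norm (s x))" by (simp add: algebra_simps power2_eq_square power3_eq_cube)
      also have "\<dots> \<le> (3 * L^3) * (r * norm (s x))"
      proof (rule mult_right_mono)
        have "L ^ 1 \<le> L ^ 3" using L by (intro power_increasing) auto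
        then show "L + 2 * L^3 \<le> 3 * L^3" by simp
      qed (simp add: r_def)
      finally show ?thesis by (simp add: x1_def r_def mult_ac)
    qed
    have step4: "norm (s (x - s x)) \<le> norm (s x) / 4"
      if x: "norm (x - a) \<le> \<rho>1" and x': "norm (x - s x - a) \<le> \<rho>1" for x
    proof -
      have "3 * L^3 * norm (G x - y) \<le> 3 * L^3 * (L * \<rho>1 + \<delta>)" using res'[OF x] L by (intro mult_left_mono) auto
      then have "3 * L^3 * norm (G x - y) \<le> 1 / 4" using contr by simp
      then have "3 * L^3 * norm (G x - y) * norm (s x) \<le> 1 / 4 * norm (s x)" by (intro mult_right_mono) auto
      then show ?thesis using step[OF x x'] by simp
    qed
    have e1: "L^2 * \<epsilon> = \<rho>1 / 8" "\<epsilon> \<le> \<rho>1 / 8" "L * \<delta> \<le> \<rho>1 / 8"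
    proof -
      show "L^2 * \<epsilon> = \<rho>1 / 8" using L by (simp add: \<epsilon>_def)
      have "1 * \<epsilon> \<le> L^2 * \<epsilon>" using L2[of 2] \<epsilon> by (intro mult_right_mono) auto
      then show "\<epsilon> \<le> \<rho>1 / 8" using \<open>L^2 * \<epsilon> = \<rho>1 / 8\<close> by simp
      show "L * \<delta> \<le> \<rho>1 / 8" using \<delta>(3) L by (simp add: field_simps)
    qed
    have s0: "norm (s x0) \<le> \<rho>1 / 4"
    proof -
      have x0': "norm (x0 - a) \<le> \<rho>1" using x0 e1 \<rho>1 by simp
      have "norm (s x0) \<le> L * norm (G x0 - y)" using Mbd[OF in\<rho>[OF x0']] by (simp add: s_def)
      also have "\<dots> \<le> L * (L * norm (x0 - a) + norm (y - b))" using res[OF x0'] L by (intro mult_left_mono) auto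
      also have "\<dots> \<le> L * (L * \<epsilon> + \<delta>)" using x0 y L by (intro mult_left_mono add_mono) auto
      also have "\<dots> = L^2 * \<epsilon> + L * \<delta>" by (simp add: algebra_simps power2_eq_square)
      also have "\<dots> \<le> \<rho>1 / 4" using e1 by simp
      finally show ?thesis .
    qed
    \<comment> \<open>The three claims are proved together: contraction at \<open>j\<close>
      presupposes that iterate \<open>j + 1\<close> is still within \<rho>1 of \<open>a\<close>, and
      that follows from the geometric sum of the earlier steps.\<close>
    have inv: "norm (s (X j)) \<le> norm (s x0) / 4 ^ j \<and> norm (X j - x0) \<le> 4/3 * (1 - 1 / 4 ^ j) * norm (s x0) \<and> norm (X j - a) \<le> \<rho>1" for j
    proof (induction j)
      case 0
      then show ?case using x0 e1 \<rho>1 by (simp add: X0)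
    next
      case (Suc j)
      have "norm (X (Suc j) - x0) \<le> norm (X j - x0) + norm (s (X j))"
        using norm_triangle_ineq4[of "X j - x0" "s (X j)"] by (simp add: XS algebra_simps)
      also have "\<dots> \<le> 4/3 * (1 - 1 / 4 ^ j) * norm (s x0) + norm (s x0) / 4 ^ j"
        using Suc by (intro add_mono) blast+
      also have "\<dots> = 4/3 * (1 - 1 / 4 ^ Suc j) * norm (s x0)" by (simp add: field_simps)
      finally have 1: "norm (X (Suc j) - x0) \<le> 4/3 * (1 - 1 / 4 ^ Suc j) * norm (s x0)" .
      have "4/3 * (1 - 1 / 4 ^ Suc j) * norm (s x0) \<le> 4/3 * 1 * norm (s x0)"
        by (intro mult_right_mono mult_left_mono) auto
      then have "norm (X (Suc j) - x0) \<le> \<rho>1 / 3" using 1 s0 by simp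
      moreover have "norm (X (Suc j) - a) \<le> norm (X (Suc j) - x0) + norm (x0 - a)"
        using norm_triangle_ineq[of "X (Suc j) - x0" "x0 - a"] by simp
      ultimately have 2: "norm (X (Suc j) - a) \<le> \<rho>1" using x0 e1 \<rho>1 by simp
      have "norm (s (X (Suc j))) \<le> norm (s (X j)) / 4" using step4[of "X j"] Suc 2 by (simp add: XS)
      also have "\<dots> \<le> norm (s x0) / 4 ^ j / 4" using Suc by (intro divide_right_mono) auto
      finally show ?case using 1 2 by simp
    qed
    have Xa: "norm (X j - a) \<le> \<rho>1" for j using inv by blast
    have sX: "norm (X (Suc j) - X j) = norm (s (X j))" for j by (simp add: XS)
    have s4: "norm (s (X (Suc j))) \<le> norm (s (X j)) / 4" for j
      using step4[OF Xa[of j]] Xa[of "Suc j"] by (simp add: XS)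
    obtain l where l: "X \<longlonglongrightarrow> l" and lX: "\<And>j. norm (X j - l) \<le> 4/3 * norm (s (X j))"
      using geometric_steps_converge[of X] s4 by (auto simp: sX)
    have la: "norm (l - a) \<le> \<rho>1"
      using Xa by (intro LIMSEQ_le_const2[OF tendsto_norm[OF tendsto_diff[OF l tendsto_const]]]) auto
    \<comment> \<open>The limit is a zero of the step, not of the residual: \<open>y\<close> may lie
      off the image of \<open>G\<close>.\<close>
    have slim: "s l = 0"
    proof -
      define K where "K = L * (L * \<rho>1 + \<delta>) + L * L"
      have K: "norm (s l - s (X j)) \<le> K * norm (X j - l)" for j
      proof -
        have b: "l \<in> ball a \<rho>" "X j \<in> ball a \<rho>" using in\<rho> la Xa by auto
        have "s l - s (X j) = (M l (G l - y) - M (X j) (G l - y)) + M (X j) (G l - G (X j))"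
          by (simp add: s_def linear_diff[OF linM])
        also have "norm \<dots> \<le> L * norm (l - X j) * (L * \<rho>1 + \<delta>) + L * (L * norm (l - X j))"
        proof (rule norm_triangle_mono)
          have "norm (M l (G l - y) - M (X j) (G l - y)) \<le> L * norm (l - X j) * norm (G l - y)" using Mlip[OF b] .
          also have "\<dots> \<le> L * norm (l - X j) * (L * \<rho>1 + \<delta>)" using res'[OF la] L by (intro mult_left_mono) auto
          finally show "norm (M l (G l - y) - M (X j) (G l - y)) \<le> L * norm (l - X j) * (L * \<rho>1 + \<delta>)" .
          have "norm (M (X j) (G l - G (X j))) \<le> L * norm (G l - G (X j))" using Mbd[OF b(2)] .
          also have "\<dots> \<le> L * (L * norm (l - X j))" using lipG[OF b(2,1)] L by (intro mult_left_mono) auto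
          finally show "norm (M (X j) (G l - G (X j))) \<le> L * (L * norm (l - X j))" .
        qed
        finally show ?thesis by (simp add: K_def algebra_simps norm_minus_commute)
      qed
      have "(\<lambda>j. s l - s (X j)) \<longlonglongrightarrow> 0"
      proof (rule Lim_null_comparison)
        show "\<forall>\<^sub>F j in sequentially. norm (s l - s (X j)) \<le> K * norm (X j - l)" using K by simp
        have "(\<lambda>j. K * norm (X j - l)) \<longlonglongrightarrow> K * norm (l - l)" using l by (intro tendsto_intros)
        then show "(\<lambda>j. K * norm (X j - l)) \<longlonglongrightarrow> 0" by simp
      qed
      moreover have "(\<lambda>j. s (X j)) \<longlonglongrightarrow> 0"
      proof -
        have "(\<lambda>j. X j - X (Suc j)) \<longlonglongrightarrow> l - l" using l by (intro tendsto_diff LIMSEQ_Suc)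
        then show ?thesis by (simp add: XS)
      qed
      ultimately have "(\<lambda>j. (s l - s (X j)) + s (X j)) \<longlonglongrightarrow> 0 + 0" by (rule tendsto_add)
      then show ?thesis by (simp add: LIMSEQ_const_iff)
    qed
    \<comment> \<open>At the limit \<open>M l (G l - b) = M l (y - b)\<close>, because the step
      vanishes. By \<open>near\<close> the distance to \<open>z\<close> is at most twice its norm,
      and \<open>M l\<close> differs from \<open>M a\<close> by at most \<kappa>: in all 2 *
      (\<kappa> + \<kappa>).\<close>
    have bound: "\<exists>z\<in>Z. norm (l - z) \<le> 4 * \<kappa> * norm (y - b)"
    proof -
      obtain z where z: "z \<in> Z" "norm (M l (G l - b) - (l - z)) \<le> norm (l - z) / 2" using near[OF la] by blast
      have "M l (G l - b) = s l + M l (y - b)" by (simp add: s_def flip: linear_add[OF linM])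
      then have eq: "M l (G l - b) = M l (y - b)" using slim by simp
      have "norm (l - z) \<le> norm (M l (G l - b)) + norm (M l (G l - b) - (l - z))"
        by (metis norm_triangle_sub norm_minus_commute)
      then have "norm (l - z) \<le> 2 * norm (M l (y - b))" using z(2) eq by simp
      also have "norm (M l (y - b)) \<le> norm (M a (y - b)) + norm (M l (y - b) - M a (y - b))"
        by (metis norm_triangle_sub)
      also have "\<dots> \<le> \<kappa> * norm (y - b) + \<kappa> * norm (y - b)"
      proof (rule add_mono[OF Ma])
        have "norm (M l (y - b) - M a (y - b)) \<le> L * norm (l - a) * norm (y - b)" using Mlip[of l a] in\<rho>[OF la] \<rho> by simp
        also have "L * norm (l - a) \<le> L * (\<kappa> / L)" using la \<rho>1(4) L by (intro mult_left_mono) auto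
        also have "L * (\<kappa> / L) = \<kappa>" using L by simp
        finally show "norm (M l (y - b) - M a (y - b)) \<le> \<kappa> * norm (y - b)" by (simp add: mult_right_mono)
      qed
      finally show ?thesis using z(1) by (auto simp: algebra_simps)
    qed
    \<comment> \<open>For exact data the residual is bounded by a multiple of the step, again by
      \<open>near\<close>, so the estimate \<open>step\<close> becomes quadratic in the step size
      \<open>t\<close>. Steps and errors are comparable: the next error is at most
      \<open>t / 3\<close>, hence \<open>t\<close> is at most 3/2 of the present error.\<close>
    have quad: "\<exists>C. \<forall>j. norm (X (Suc j) - l) \<le> C * (norm (X j - l))\<^sup>2" if yb: "y = b"
    proof (intro exI allI)
      fix j
      define t where "t = norm (s (X j))"
      obtain z where z: "norm (M (X j) (G (X j) - b) - (X j - z)) \<le> norm (X j - z) / 2"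
        "norm (G (X j) - b) \<le> L * norm (X j - z)" using near[OF Xa] by blast
      have "norm (X j - z) \<le> norm (s (X j)) + norm (s (X j) - (X j - z))"
        by (metis norm_triangle_sub norm_minus_commute)
      then have "norm (X j - z) \<le> 2 * t" using z(1) by (simp add: s_def yb t_def)
      then have "L * norm (X j - z) \<le> L * (2 * t)" using L by (intro mult_left_mono) auto
      then have G: "norm (G (X j) - y) \<le> L * (2 * t)" using z(2) yb by simp
      have "norm (s (X (Suc j))) \<le> 3 * L^3 * norm (G (X j) - y) * t"
        using step[OF Xa[of j]] Xa[of "Suc j"] by (simp add: XS t_def)
      also have "\<dots> \<le> 3 * L^3 * (L * (2 * t)) * t" using G L by (intro mult_right_mono mult_left_mono) (auto simp: t_def)
      finally have s1: "norm (s (X (Suc j))) \<le> 6 * L^4 * t\<^sup>2" by (simp add: power2_eq_square algebra_simps power_def numeral_eq_Suc)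
      have "t \<le> norm (X j - l) + norm (X (Suc j) - l)"
        using norm_triangle_ineq4[of "X j - l" "X (Suc j) - l"] by (simp add: XS t_def)
      then have "t \<le> 3/2 * norm (X j - l)" using lX[of "Suc j"] s4[of j] by (simp add: t_def)
      then have "t\<^sup>2 \<le> (3/2 * norm (X j - l))\<^sup>2" by (intro power_mono) (auto simp: t_def)
      then have "6 * L^4 * t\<^sup>2 \<le> 6 * L^4 * (3/2 * norm (X j - l))\<^sup>2" using L by (intro mult_left_mono) auto
      then show "norm (X (Suc j) - l) \<le> (4/3 * (6 * L^4 * (3/2)\<^sup>2)) * (norm (X j - l))\<^sup>2"
        using lX[of "Suc j"] s1 unfolding power_mult_distrib by linarith
    qed
    show "(\<forall>j. X j \<in> ball a \<rho>) \<and>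
      (\<exists>l. X \<longlonglongrightarrow> l \<and> (\<exists>z\<in>Z. norm (l - z) \<le> 4 * \<kappa> * norm (y - b)) \<and>
         (y = b \<longrightarrow> (\<exists>C. \<forall>j. norm (X (Suc j) - l) \<le> C * (norm (X j - l))\<^sup>2)))"
      using l bound quad in\<rho>[OF Xa] by blast
  qed
qed

section \<open>Coordinates\<close>

lemma additive_sum:
  fixes g :: "'a::comm_monoid_add \<Rightarrow> 'b::ab_group_add"
  assumes "\<And>x y. g (x + y) = g x + g y"
  shows "g (sum f A) = (\<Sum>a\<in>A. g (f a))"
proof -
  have "g 0 + g 0 = g 0" using assms[of 0 0] by simp
  then have "g 0 = 0" by simp
  then show ?thesis by (induction A rule: infinite_finite_induct) (simp_all add: assms)
qed

lemma polynomial_fun_linear: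
  fixes g :: "complex^'n \<Rightarrow> complex"
  assumes add: "\<And>x y. g (x + y) = g x + g y" and scale: "\<And>c x. g (c *s x) = c * g x"
  shows "polynomial_fun g"
proof -
  have "g x = (\<Sum>i\<in>UNIV. x $ i * g (axis i 1))" for x
  proof -
    have "g x = g (\<Sum>i\<in>UNIV. x $ i *s axis i 1)" by (simp add: basis_expansion)
    then show ?thesis by (simp add: additive_sum[OF add] scale)
  qed
  then have "g = (\<lambda>x. \<Sum>i\<in>UNIV. x $ i * g (axis i 1))" by blast
  moreover have "polynomial_fun (\<lambda>x. \<Sum>i\<in>UNIV. x $ i * g (axis i 1))"
    by (intro polynomial_fun_sum polynomial_fun.intros)
  ultimately show ?thesis by simp
qed

lemma lookup_cp_scale [simp]: "Poly_Mapping.lookup (cp_scale c q) m = c * Poly_Mapping.lookup q m"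
proof -
  have "cp_scale c q = Poly_Mapping.map ((*) c) q"
    by (simp add: cp_scale_def Const_def mult_map_scale_conv_mult)
  then show ?thesis by (simp add: Poly_Mapping.map.rep_eq when_def)
qed

text \<open>The exponents are confined to one finite set for all \<open>x\<close>, so that a linear
  map applied to \<open>h x\<close> is a fixed finite combination of its coefficients.\<close>

definition coeffwise_polynomial :: "(complex^'n \<Rightarrow> cpoly) \<Rightarrow> bool" where
  "coeffwise_polynomial h \<longleftrightarrow>
     (\<exists>K. finite K \<and> (\<forall>x. Poly_Mapping.keys (h x) \<subseteq> K)) \<and> (\<forall>m. polynomial_fun (\<lambda>x. Poly_Mapping.lookup (h x) m))"

lemma sum_monomials_superset:
  assumes "finite K" "Poly_Mapping.keys f \<subseteq> K"
  shows "f = (\<Sum>k\<in>K. Poly_Mapping.single k (Poly_Mapping.lookup (f :: cpoly) k))"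
proof -
  have "(\<Sum>k\<in>K. Poly_Mapping.single k (Poly_Mapping.lookup f k)) = (\<Sum>k\<in>Poly_Mapping.keys f. Poly_Mapping.single k (Poly_Mapping.lookup f k))"
    using assms by (intro sum.mono_neutral_right) (auto simp: in_keys_iff)
  then show ?thesis by (simp add: sum_monomials)
qed

lemma coeffwise_polynomial_const: "coeffwise_polynomial (\<lambda>x. q)"
  unfolding coeffwise_polynomial_def by (auto intro: polynomial_fun.const exI[of _ "Poly_Mapping.keys q"])

lemma coeffwise_polynomial_mult:
  assumes f: "coeffwise_polynomial f" and g: "coeffwise_polynomial g"
  shows "coeffwise_polynomial (\<lambda>x. f x * g x)"
proof -
  obtain K where K: "finite K" "\<And>x. Poly_Mapping.keys (f x) \<subseteq> K"
    using f unfolding coeffwise_polynomial_def by blast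
  obtain L where L: "finite L" "\<And>x. Poly_Mapping.keys (g x) \<subseteq> L"
    using g unfolding coeffwise_polynomial_def by blast
  have fp: "polynomial_fun (\<lambda>x. Poly_Mapping.lookup (f x) m)" for m
    using f unfolding coeffwise_polynomial_def by blast
  have gp: "polynomial_fun (\<lambda>x. Poly_Mapping.lookup (g x) m)" for m
    using g unfolding coeffwise_polynomial_def by blast
  have fg: "f x * g x = (\<Sum>a\<in>K. \<Sum>b\<in>L. Poly_Mapping.single (a + b) (Poly_Mapping.lookup (f x) a * Poly_Mapping.lookup (g x) b))" for x
  proof -
    have "f x * g x = (\<Sum>k\<in>K. Poly_Mapping.single k (Poly_Mapping.lookup (f x) k)) * (\<Sum>k\<in>L. Poly_Mapping.single k (Poly_Mapping.lookup (g x) k))"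
      using sum_monomials_superset[OF K(1) K(2)[of x]] sum_monomials_superset[OF L(1) L(2)[of x]] by simp
    then show ?thesis by (simp add: sum_product mult_single)
  qed
  have "Poly_Mapping.lookup (f x * g x) m = (\<Sum>a\<in>K. \<Sum>b\<in>L. (if a + b = m then 1 else 0) * (Poly_Mapping.lookup (f x) a * Poly_Mapping.lookup (g x) b))" for x m
    by (auto simp: fg lookup_sum lookup_single when_def intro!: sum.cong)
  moreover have "polynomial_fun (\<lambda>x. \<Sum>a\<in>K. \<Sum>b\<in>L. (if a + b = m then 1 else 0) * (Poly_Mapping.lookup (f x) a * Poly_Mapping.lookup (g x) b))" for m
    by (intro polynomial_fun_sum polynomial_fun.mult polynomial_fun.const fp gp)
  moreover have "Poly_Mapping.keys (f x * g x) \<subseteq> (\<lambda>(a, b). a + b) ` (K \<times> L)" for x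
    using keys_mult[of "f x" "g x"] K(2)[of x] L(2)[of x] by fastforce
  ultimately show ?thesis unfolding coeffwise_polynomial_def
    using K(1) L(1) by (intro conjI exI[of _ "(\<lambda>(a, b). a + b) ` (K \<times> L)"]) auto
qed

lemma coeffwise_polynomial_power: "coeffwise_polynomial f \<Longrightarrow> coeffwise_polynomial (\<lambda>x. f x ^ n)"
  by (induction n) (auto intro: coeffwise_polynomial_const coeffwise_polynomial_mult)

lemma coeffwise_polynomial_prod:
  "(\<And>i. i \<in> A \<Longrightarrow> coeffwise_polynomial (f i)) \<Longrightarrow> coeffwise_polynomial (\<lambda>x. \<Prod>i\<in>A. f i x)"
  by (induction A rule: infinite_finite_induct) (auto intro: coeffwise_polynomial_const coeffwise_polynomial_mult)

lemma coeffwise_polynomial_linear: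
  fixes h :: "complex^'n \<Rightarrow> cpoly"
  assumes add: "\<And>x y. h (x + y) = h x + h y" and scale: "\<And>c x. h (c *s x) = cp_scale c (h x)"
  shows "coeffwise_polynomial h"
  unfolding coeffwise_polynomial_def
proof (intro conjI allI)
  show "polynomial_fun (\<lambda>x. Poly_Mapping.lookup (h x) m)" for m
    by (rule polynomial_fun_linear) (simp_all add: add scale lookup_add)
  have h: "h x = (\<Sum>i\<in>UNIV. cp_scale (x $ i) (h (axis i 1)))" for x
  proof -
    have "h x = h (\<Sum>i\<in>UNIV. x $ i *s axis i 1)" by (simp add: basis_expansion)
    then show ?thesis by (simp add: additive_sum[OF add] scale)
  qed
  have "Poly_Mapping.keys (h x) \<subseteq> (\<Union>i\<in>UNIV. Poly_Mapping.keys (h (axis i 1)))" for x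
  proof
    fix m assume m: "m \<in> Poly_Mapping.keys (h x)"
    show "m \<in> (\<Union>i\<in>UNIV. Poly_Mapping.keys (h (axis i 1)))"
    proof (rule ccontr)
      assume "m \<notin> (\<Union>i\<in>UNIV. Poly_Mapping.keys (h (axis i 1)))"
      then have "Poly_Mapping.lookup (h (axis i 1)) m = 0" for i by (auto simp: in_keys_iff)
      then have "Poly_Mapping.lookup (h x) m = 0" by (subst h) (simp add: lookup_sum)
      then show False using m by (simp add: in_keys_iff)
    qed
  qed
  then show "\<exists>K. finite K \<and> (\<forall>x. Poly_Mapping.keys (h x) \<subseteq> K)"
    by (intro exI[of _ "\<Union>i\<in>UNIV. Poly_Mapping.keys (h (axis i 1))"]) auto
qed

lemma polynomial_fun_of_coeffwise:
  fixes g :: "cpoly \<Rightarrow> complex^'m"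
  assumes h: "coeffwise_polynomial h" and add: "\<And>x y. g (x + y) = g x + g y" and scale: "\<And>c x. g (cp_scale c x) = c *s g x"
  shows "polynomial_fun (\<lambda>x. g (h x) $ i)"
proof -
  obtain K where K: "finite K" "\<And>x. Poly_Mapping.keys (h x) \<subseteq> K"
    using h unfolding coeffwise_polynomial_def by blast
  have s: "Poly_Mapping.single m c = cp_scale c (Poly_Mapping.single m 1)" for m c
    by (simp add: cp_scale_def Const_def mult_single)
  have "g (h x) = (\<Sum>m\<in>K. Poly_Mapping.lookup (h x) m *s g (Poly_Mapping.single m 1))" for x
  proof -
    have "g (h x) = g (\<Sum>m\<in>K. cp_scale (Poly_Mapping.lookup (h x) m) (Poly_Mapping.single m 1))"
      using sum_monomials_superset[OF K(1) K(2)[of x]] by (simp flip: s)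
    then show ?thesis by (simp add: additive_sum[OF add] scale)
  qed
  moreover have "polynomial_fun (\<lambda>x. \<Sum>m\<in>K. Poly_Mapping.lookup (h x) m * g (Poly_Mapping.single m 1) $ i)"
    using h unfolding coeffwise_polynomial_def by (intro polynomial_fun_sum polynomial_fun.mult polynomial_fun.const) blast
  ultimately show ?thesis by simp
qed

lemma scaleR_eq_vector_scale: "r *\<^sub>R y = complex_of_real r *s y"
  unfolding vec_eq_iff vector_scaleR_component vector_smult_component by (simp add: scaleR_conv_of_real)

section \<open>Identification of the derivative along lines\<close>

lemma power_product_line:
  obtains Q where "\<And>t. power_product k l (u + arr_scale t v) = poly Q (Const t)" "coeff Q 1 = jac k l u v"
proof -
  define q where "q j = [:u j, v j:]" for j
  define Q where "Q = q 0 * (\<Prod>j=1..k. q j ^ l j)"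
  have "poly (q j) (Const t) = (u + arr_scale t v) j" for t j
    by (simp add: q_def arr_scale_def cp_scale_def)
  then have "power_product k l (u + arr_scale t v) = poly Q (Const t)" for t
    by (simp add: power_product_def Q_def poly_prod poly_power)
  moreover have "coeff Q 1 = jac k l u v"
  proof -
    have "coeff Q 1 = poly (pderiv Q) 0" by (simp add: poly_0_coeff_0 coeff_pderiv)
    also have "\<dots> = jac k l u v"
    proof -
      have q: "poly (q j) 0 = u j" "poly (pderiv (q j)) 0 = v j" for j
        by (simp_all add: q_def pderiv_pCons)
      show ?thesis
        by (simp add: Q_def q jac_def pderiv_mult pderiv_prod pderiv_power poly_prod poly_power poly_sum mult_ac add_ac)
    qed
    finally show ?thesis .
  qed
  ultimately show ?thesis using that by blast
qed

text \<open>Multiplication by \<open>Const t\<close> scales each coefficient, so the coefficient at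
  \<open>m\<close> is an ordinary complex polynomial in \<open>t\<close> and its derivative at 0 is
  its linear coefficient.\<close>

lemma lookup_poly_Const_derivative:
  "((\<lambda>t. Poly_Mapping.lookup (poly Q (Const t)) m) has_field_derivative Poly_Mapping.lookup (coeff Q 1) m) (at 0)"
proof -
  define R where "R = map_poly (\<lambda>c. Poly_Mapping.lookup c m) Q"
  have "Poly_Mapping.lookup (poly Q (Const t)) m = poly R t" for t
    unfolding R_def
  proof (induction Q)
    case (pCons a Q)
    have "Poly_Mapping.lookup (Const t * poly Q (Const t)) m = t * Poly_Mapping.lookup (poly Q (Const t)) m"
      using lookup_cp_scale[of t] by (simp add: cp_scale_def)
    then show ?case using pCons by (simp add: map_poly_pCons lookup_add)
  qed simp
  moreover have "poly (pderiv R) 0 = Poly_Mapping.lookup (coeff Q 1) m"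
    by (simp add: poly_0_coeff_0 coeff_pderiv R_def coeff_map_poly)
  ultimately show ?thesis using poly_DERIV[of R 0] by simp
qed

text \<open>
  The polynomials carry no topology, so the derivative is identified by comparing coefficients along
  a line.
\<close>

lemma derivative_eq_jac:
  fixes \<phi> :: "complex^'n \<Rightarrow> cpoly_array" and \<psi> :: "complex^'m \<Rightarrow> cpoly"
  assumes \<phi>: "\<And>x y. \<phi> (x + y) = \<phi> x + \<phi> y" "\<And>c x. \<phi> (c *s x) = arr_scale c (\<phi> x)"
    and \<psi>: "\<And>x y. \<psi> (x + y) = \<psi> x + \<psi> y" "\<And>c x. \<psi> (c *s x) = cp_scale c (\<psi> x)"
    and G: "\<And>x. \<psi> (G x) = power_product k l (\<phi> x)" and der: "(G has_derivative D) (at x)"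
  shows "\<psi> (D v) = jac k l (\<phi> x) (\<phi> v)"
proof (rule poly_mapping_eqI)
  fix m
  obtain Q where Q: "\<And>t. power_product k l (\<phi> x + arr_scale t (\<phi> v)) = poly Q (Const t)"
    "coeff Q 1 = jac k l (\<phi> x) (\<phi> v)" using power_product_line[of k l "\<phi> x" "\<phi> v"] by blast
  define \<Lambda> where "\<Lambda> y = Poly_Mapping.lookup (\<psi> y) m" for y
  have \<Lambda>: "bounded_linear \<Lambda>"
  proof -
    have "\<Lambda> (r *\<^sub>R y) = r *\<^sub>R \<Lambda> y" for r y
      by (simp add: scaleR_eq_vector_scale \<Lambda>_def \<psi> scaleR_conv_of_real[of r "Poly_Mapping.lookup _ _"])
    then have "linear \<Lambda>" by (intro linearI) (simp_all add: \<Lambda>_def \<psi> lookup_add)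
    then show ?thesis by (simp add: linear_conv_bounded_linear)
  qed
  \<comment> \<open>A real parameter is used because the Frechet derivative \<open>D\<close> is
    known here only to be real linear.\<close>
  have "((\<lambda>t::real. x + t *\<^sub>R v) has_vector_derivative v) (at 0)"
    by (auto intro!: derivative_eq_intros)
  moreover have "(G has_derivative D) (at (x + 0 *\<^sub>R v))" using der by simp
  ultimately have "((\<lambda>t::real. G (x + t *\<^sub>R v)) has_vector_derivative D v) (at 0)"
    unfolding has_vector_derivative_def
    using has_derivative_compose[of "\<lambda>t::real. x + t *\<^sub>R v" "\<lambda>t. t *\<^sub>R v" 0 UNIV G D] der
    by (simp add: linear_scale[OF has_derivative_linear[OF der]])
  then have 1: "((\<lambda>t::real. \<Lambda> (G (x + t *\<^sub>R v))) has_vector_derivative \<Lambda> (D v)) (at 0)"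
    by (rule bounded_linear.has_vector_derivative[OF \<Lambda>])
  have "\<Lambda> (G (x + t *\<^sub>R v)) = Poly_Mapping.lookup (poly Q (Const (of_real t))) m" for t :: real
    by (simp add: scaleR_eq_vector_scale \<Lambda>_def G \<phi> Q)
  moreover have "((\<lambda>t::real. Poly_Mapping.lookup (poly Q (Const (of_real t))) m) has_vector_derivative
      Poly_Mapping.lookup (coeff Q 1) m) (at 0)"
    using lookup_poly_Const_derivative[of Q m] by (intro has_vector_derivative_real_field) simp
  ultimately have "\<Lambda> (D v) = Poly_Mapping.lookup (coeff Q 1) m"
    using 1 by (simp add: vector_derivative_unique_at)
  then show "Poly_Mapping.lookup (\<psi> (D v)) m = Poly_Mapping.lookup (jac k l (\<phi> x) (\<phi> v)) m"
    using Q(2) by (simp add: \<Lambda>_def)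
qed

section \<open>The factorization map in coordinates\<close>

lemma isCont_tendsto_nhds: "isCont f a \<Longrightarrow> (f \<longlongrightarrow> f a) (nhds a)"
  by (simp add: isCont_def tendsto_at_iff_tendsto_nhds)

locale factorization_setting =
  fixes k :: nat and l :: "nat \<Rightarrow> nat" and p :: cpoly and u_hat :: cpoly_array
    and U :: "nat \<Rightarrow> cpoly set" and nU :: "nat \<Rightarrow> cpoly \<Rightarrow> real" and P :: "cpoly set" and nP :: "cpoly \<Rightarrow> real"
    and \<phi> :: "complex^'n \<Rightarrow> cpoly_array" and \<psi> :: "complex^'m \<Rightarrow> cpoly"
  assumes u_hat: "u_hat \<in> product_space k U"
    and fac: "irreducible_factorization p k l u_hat"
    and host: "\<And>j. j \<le> k \<Longrightarrow> proper_hosting_space (U j) (u_hat j)"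
    and U0: "U 0 = range Const"
    and prod_P: "\<And>u. u \<in> product_space k U \<Longrightarrow> power_product k l u \<in> P"
    and iso_\<phi>: "isometric_iso arr_scale (product_norm k nU) (product_space k U) \<phi>"
    and iso_\<psi>: "isometric_iso cp_scale nP P \<psi>"
begin

lemma \<phi>_add: "\<phi> (x + y) = \<phi> x + \<phi> y" and \<phi>_scale: "\<phi> (c *s x) = arr_scale c (\<phi> x)"
  using iso_\<phi> by (auto simp: isometric_iso_def Vector_Spaces.linear_iff)

lemma \<psi>_add: "\<psi> (x + y) = \<psi> x + \<psi> y" and \<psi>_scale: "\<psi> (c *s x) = cp_scale c (\<psi> x)"
  using iso_\<psi> by (auto simp: isometric_iso_def Vector_Spaces.linear_iff)

lemma \<phi>_diff: "\<phi> (x - y) = \<phi> x - \<phi> y"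
  using \<phi>_add[of "x - y" y] by simp

lemma \<psi>_diff: "\<psi> (x - y) = \<psi> x - \<psi> y"
  using \<psi>_add[of "x - y" y] by simp

lemma \<phi>_0: "\<phi> 0 = 0"
  using \<phi>_diff[of 0 0] by simp

lemma \<psi>_0: "\<psi> 0 = 0"
  using \<psi>_diff[of 0 0] by simp

lemma inj_\<phi>: "inj \<phi>" and range_\<phi>: "range \<phi> = product_space k U"
  using iso_\<phi> by (auto simp: isometric_iso_def bij_betw_def)

lemma inj_\<psi>: "inj \<psi>" and range_\<psi>: "range \<psi> = P"
  using iso_\<psi> by (auto simp: isometric_iso_def bij_betw_def)

lemma inv_\<phi> [simp]: "inv \<phi> (\<phi> x) = x"
  using inj_\<phi> by simp

lemma inv_\<psi> [simp]: "inv \<psi> (\<psi> x) = x"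
  using inj_\<psi> by simp

lemma \<phi>_inv: "u \<in> product_space k U \<Longrightarrow> \<phi> (inv \<phi> u) = u"
  using range_\<phi> f_inv_into_f[of u \<phi> UNIV] by simp

lemma \<psi>_inv: "q \<in> P \<Longrightarrow> \<psi> (inv \<psi> q) = q"
  using range_\<psi> f_inv_into_f[of q \<psi> UNIV] by simp

lemma \<phi>_in: "\<phi> x \<in> product_space k U"
  using range_\<phi> by blast

lemma \<psi>_in: "\<psi> x \<in> P"
  using range_\<psi> by blast

lemma norm_\<phi>: "product_norm k nU (\<phi> x) = norm x" and norm_\<psi>: "nP (\<psi> y) = norm y"
  using iso_\<phi> iso_\<psi> by (auto simp: isometric_iso_def)

lemma l_pos: "j \<in> {1..k} \<Longrightarrow> l j > 0"
  using fac by (simp add: irreducible_factorization_def)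

lemma subspace_U: "j \<le> k \<Longrightarrow> cp.subspace (U j)"
  using host by (simp add: proper_hosting_space_def)

definition G :: "complex^'n \<Rightarrow> complex^'m" where
  "G x = inv \<psi> (power_product k l (\<phi> x))"

definition x_hat :: "complex^'n" where
  "x_hat = inv \<phi> u_hat"

lemma \<phi>_x_hat: "\<phi> x_hat = u_hat"
  by (simp add: x_hat_def \<phi>_inv u_hat)

lemma \<psi>_G: "\<psi> (G x) = power_product k l (\<phi> x)"
  by (simp add: G_def \<psi>_inv prod_P \<phi>_in)

lemma \<psi>_G_x_hat: "\<psi> (G x_hat) = p"
  using fac by (simp add: \<psi>_G \<phi>_x_hat irreducible_factorization_def)

lemma coeffwise_polynomial_\<phi>: "coeffwise_polynomial (\<lambda>x. \<phi> x j)"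
  by (rule coeffwise_polynomial_linear) (simp_all add: \<phi>_add \<phi>_scale arr_scale_def)

lemma polynomial_fun_G: "polynomial_fun (\<lambda>x. G x $ i)"
proof -
  \<comment> \<open>\<open>inv \<psi>\<close> is controlled only on \<open>P\<close>, while
    \<open>polynomial_fun_of_coeffwise\<close> expands into single monomials, which may lie outside
    \<open>P\<close>. A linear left inverse \<open>g\<close> of \<psi> defined on all polynomials
    replaces it.\<close>
  interpret vector_space_pair "(*s) :: complex \<Rightarrow> complex^'m \<Rightarrow> complex^'m" cp_scale
    by unfold_locales
  have "Vector_Spaces.linear (*s) cp_scale \<psi>" using iso_\<psi> by (simp add: isometric_iso_def)
  then obtain g where g: "Vector_Spaces.linear cp_scale (*s) g" "g \<circ> \<psi> = id"
    using linear_injective_left_inverse[OF _ inj_\<psi>] by blast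
  have "coeffwise_polynomial (\<lambda>x. power_product k l (\<phi> x))"
    unfolding power_product_def
    by (intro coeffwise_polynomial_mult coeffwise_polynomial_prod coeffwise_polynomial_power coeffwise_polynomial_\<phi>)
  then have "polynomial_fun (\<lambda>x. g (power_product k l (\<phi> x)) $ i)"
    using g(1) by (intro polynomial_fun_of_coeffwise) (auto simp: Vector_Spaces.linear_iff)
  moreover have "g (power_product k l (\<phi> x)) = G x" for x
    using fun_cong[OF g(2), of "G x"] by (simp add: \<psi>_G)
  ultimately show ?thesis by simp
qed

definition J :: "complex^'n \<Rightarrow> complex^'n^'m" where
  "J x = matrix (frechet_derivative G (at x))"

lemma G_derivative: "(G has_derivative (\<lambda>v. J x *v v)) (at x)"
  and polynomial_fun_J: "polynomial_fun (\<lambda>x. J x $ i $ j)"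
proof -
  obtain K where K: "\<And>i j. polynomial_fun (\<lambda>x. K x $ i $ j)" "\<And>x. (G has_derivative (\<lambda>h. K x *v h)) (at x)"
    using polynomial_fun_jacobian[of G] polynomial_fun_G by blast
  have "J x = K x" for x
    unfolding J_def using frechet_derivative_at[OF K(2)[of x]] by (metis matrix_of_matrix_vector_mul)
  then have "J = K" by blast
  then show "(G has_derivative (\<lambda>v. J x *v v)) (at x)" "polynomial_fun (\<lambda>x. J x $ i $ j)"
    using K by auto
qed

lemma \<psi>_J: "\<psi> (J x *v v) = jac k l (\<phi> x) (\<phi> v)"
  by (rule derivative_eq_jac[of \<phi> \<psi> G]) (simp_all add: \<phi>_add \<phi>_scale \<psi>_add \<psi>_scale \<psi>_G G_derivative)

definition tvec :: "nat \<Rightarrow> complex^'n \<Rightarrow> complex^'n" where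
  "tvec j x = inv \<phi> (tangent l j (\<phi> x))"

lemma tangent_in: "u \<in> product_space k U \<Longrightarrow> j \<in> {1..k} \<Longrightarrow> tangent l j u \<in> product_space k U"
  by (auto simp: product_space_def tangent_def intro: cp.subspace_neg cp.subspace_scale cp.subspace_0 subspace_U)

lemma \<phi>_tvec: "j \<in> {1..k} \<Longrightarrow> \<phi> (tvec j x) = tangent l j (\<phi> x)"
  by (simp add: tvec_def \<phi>_inv tangent_in \<phi>_in)

lemma J_tvec: "j \<in> {1..k} \<Longrightarrow> J x *v tvec j x = 0"
  using \<psi>_J[of x "tvec j x"] jac_tangent[of j k l] l_pos[of j] \<psi>_0 inj_\<psi>
  by (simp add: \<phi>_tvec) (metis injD)

lemma \<phi>_sum: "\<phi> (\<Sum>j\<in>A. f j) = (\<Sum>j\<in>A. \<phi> (f j))"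
  by (rule additive_sum) (rule \<phi>_add)

lemma \<phi>_sum_tvec: "\<phi> (\<Sum>j=1..k. c j *s tvec j x) = (\<Sum>j=1..k. arr_scale (c j) (tangent l j (\<phi> x)))"
  by (simp add: \<phi>_sum \<phi>_scale \<phi>_tvec)

lemma J_x_hat_kernel:
  assumes "J x_hat *v v = 0"
  shows "\<exists>c. v = (\<Sum>j=1..k. c j *s tvec j x_hat)"
proof -
  have "jac k l u_hat (\<phi> v) = 0" using \<psi>_J[of x_hat v] assms by (simp add: \<psi>_0 \<phi>_x_hat)
  then obtain c where "\<phi> v = (\<Sum>j=1..k. arr_scale (c j) (tangent l j u_hat))"
    using jac_kernel[OF fac host U0 \<phi>_in] by blast
  then have "\<phi> v = \<phi> (\<Sum>j=1..k. c j *s tvec j x_hat)" by (simp only: \<phi>_sum_tvec \<phi>_x_hat)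
  then show ?thesis using inj_\<phi> by (auto dest: injD)
qed

text \<open>The tangent depends linearly on the array, so \<open>tvec j\<close> is linear.\<close>

lemma polynomial_fun_tvec: "j \<in> {1..k} \<Longrightarrow> polynomial_fun (\<lambda>x. tvec j x $ a)"
proof (rule polynomial_fun_linear)
  assume j: "j \<in> {1..k}"
  have "tvec j (x + y) = tvec j x + tvec j y" for x y
    using j by (intro injD[OF inj_\<phi>])
      (auto simp: \<phi>_tvec \<phi>_add tangent_def fun_eq_iff cp.scale_right_distrib)
  then show "tvec j (x + y) $ a = tvec j x $ a + tvec j y $ a" for x y by simp
  have "tvec j (c *s x) = c *s tvec j x" for c x
    using j by (intro injD[OF inj_\<phi>])
      (auto simp: \<phi>_tvec \<phi>_scale arr_scale_def tangent_def fun_eq_iff mult.commute)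
  then show "tvec j (c *s x) $ a = c * tvec j x $ a" for c x by simp
qed

text \<open>The matrix inverted in \<open>mp_inverse_formula\<close>. Since its entries depend
  continuously on \<open>x\<close>, invertibility at \<open>x_hat\<close> spreads to a
  neighbourhood.\<close>

definition H :: "complex^'n \<Rightarrow> complex^'n^'n" where
  "H x = conj_transpose (J x) ** J x + outer_sum k (\<lambda>j. tvec j x)"

lemma J_lipschitz: "bounded S \<Longrightarrow> bounded_lipschitz_on S (\<lambda>x. J x $ i $ j)"
  using polynomial_fun_J by (rule polynomial_fun_bounded_lipschitz_on)

lemma H_lipschitz: "bounded S \<Longrightarrow> bounded_lipschitz_on S (\<lambda>x. H x $ i $ j)"
  unfolding H_def matrix_matrix_mult_def conj_transpose_def outer_sum_def
  by (auto intro!: bounded_lipschitz_on_add bounded_lipschitz_on_sum bounded_lipschitz_on_mult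
      bounded_lipschitz_on_cnj J_lipschitz polynomial_fun_bounded_lipschitz_on[OF polynomial_fun_tvec])

text \<open>At \<open>x_hat\<close> the tangents span the whole kernel of the Jacobian, so a kernel
  vector orthogonal to all of them is orthogonal to itself.\<close>

lemma invertible_H_x_hat: "invertible (H x_hat)"
  unfolding H_def
proof (rule invertible_gram_sum)
  fix v assume v: "J x_hat *v v = 0" "\<And>j. j \<in> {1..k} \<Longrightarrow> cinner v (tvec j x_hat) = 0"
  obtain c where c: "v = (\<Sum>j=1..k. c j *s tvec j x_hat)" using J_x_hat_kernel[OF v(1)] by blast
  have "cinner v v = (\<Sum>j=1..k. c j * cinner (tvec j x_hat) v)"
    by (subst c) (simp add: cinner_sum_left cinner_scale_left)
  also have "\<dots> = 0"
  proof (intro sum.neutral ballI)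
    fix j assume "j \<in> {1..k}"
    then show "c j * cinner (tvec j x_hat) v = 0"
      using v(2)[of j] cinner_commute[of "tvec j x_hat" v] by simp
  qed
  finally show "v = 0" by (simp add: cinner_self)
qed

text \<open>Invertibility of \<open>H x\<close> keeps the kernel of \<open>J x\<close> within the
  span of the tangents; nonzero factors make the tangents independent. Together they fix the rank,
  and both conditions are open.\<close>

definition regular :: "complex^'n \<Rightarrow> bool" where
  "regular x \<longleftrightarrow> invertible (H x) \<and> (\<forall>j\<in>{1..k}. \<phi> x j \<noteq> 0)"

lemma regular_rank:
  assumes "regular x"
  shows "CARD('n) = rank (J x) + k"
proof (rule rank_eq_of_kernel)
  show "J x *v tvec j x = 0" if "j \<in> {1..k}" for j using J_tvec[OF that] .
  show "invertible (conj_transpose (J x) ** J x + outer_sum k (\<lambda>j. tvec j x))"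
    using assms by (simp add: regular_def H_def)
  fix c assume "(\<Sum>j=1..k. c j *s tvec j x) = 0"
  then have "(\<Sum>j=1..k. arr_scale (c j) (tangent l j (\<phi> x))) = 0" using \<phi>_sum_tvec[of c x] \<phi>_0 by simp
  then have *: "(\<Sum>j=1..k. arr_scale (c j) (tangent l j (\<phi> x)) i) = 0" for i
    using sum_array_apply[of "\<lambda>j. arr_scale (c j) (tangent l j (\<phi> x))" "{1..k}" i]
    by (simp add: zero_fun_def)
  show "\<forall>i\<in>{1..k}. c i = 0"
  proof
    fix i assume i: "i \<in> {1..k}"
    have "(\<Sum>j=1..k. arr_scale (c j) (tangent l j (\<phi> x)) i) = (\<Sum>j=1..k. if j = i then cp_scale (c i) (\<phi> x i) else 0)"
      using i by (intro sum.cong) (auto simp: arr_scale_def tangent_def)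
    then have "cp_scale (c i) (\<phi> x i) = 0" using * i by simp
    then show "c i = 0" using assms i by (simp add: regular_def)
  qed
qed

definition M :: "complex^'n \<Rightarrow> complex^'m^'n" where
  "M x = mp_inverse (J x)"

lemma
  assumes "regular x"
  shows M_formula: "M x = matrix_inv (H x) ** conj_transpose (J x)"
    and JMJ: "J x ** M x ** J x = J x" and MJM: "M x ** J x ** M x = M x"
proof -
  have *: "conj_transpose (outer_sum k (\<lambda>j. tvec j x)) = outer_sum k (\<lambda>j. tvec j x)"
    "J x ** outer_sum k (\<lambda>j. tvec j x) = 0"
    "invertible (conj_transpose (J x) ** J x + outer_sum k (\<lambda>j. tvec j x))"
    using assms J_tvec by (auto simp: conj_transpose_outer_sum regular_def H_def intro: mult_outer_sum_eq_0)
  show 1: "M x = matrix_inv (H x) ** conj_transpose (J x)"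
    unfolding M_def H_def by (rule mp_inverse_formula[OF *])
  show "J x ** M x ** J x = J x" unfolding 1 H_def by (rule mp_inverse_formula_1[OF *])
  show "M x ** J x ** M x = M x" unfolding 1 H_def by (rule mp_inverse_formula_2[OF *])
qed

text \<open>On vectors orthogonal to the tangents the correction term of \<open>H x\<close>
  vanishes, so inverting \<open>H x\<close> undoes the Gram matrix of \<open>J x\<close> there. This
  provides the last clause of \<open>orbit\<close> in
  \<open>gauss_newton_convergence\<close>.\<close>

lemma MJ_orthogonal:
  assumes "regular x" "\<And>j. j \<in> {1..k} \<Longrightarrow> cinner d (tvec j x) = 0"
  shows "M x *v (J x *v d) = d"
proof -
  have "outer_sum k (\<lambda>j. tvec j x) *v d = 0" using assms(2) by (simp add: outer_sum_mult)
  then have "H x *v d = conj_transpose (J x) *v (J x *v d)"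
    by (simp add: H_def matrix_vector_mult_add_rdistrib matrix_vector_mul_assoc)
  then have "M x *v (J x *v d) = matrix_inv (H x) *v (H x *v d)"
    by (simp add: M_formula[OF assms(1)] flip: matrix_vector_mul_assoc)
  then show ?thesis
    using matrix_inv_left[of "H x"] assms(1) by (simp add: regular_def matrix_vector_mul_assoc)
qed

text \<open>Subtracting the constant \<open>f\<close> does not change the derivative, and
  \<open>J x\<close> already has the prescribed rank. It is thus at distance 0 from itself among the
  competitors, so every rank projection equals it and the choice in \<open>rank_projection\<close>
  is determined.\<close>

lemma rank_pinv_map_eq:
  assumes x: "regular x" and f: "f \<in> P" and q: "q \<in> P"
  shows "rank_pinv_map \<phi> \<psi> (CARD('n) - k) (partial_jacobian \<phi> \<psi> k l (\<phi> x) f) q = \<phi> (M x *v inv \<psi> q)"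
proof -
  have "inv \<psi> \<circ> (\<lambda>v. factor_map k l v f) \<circ> \<phi> = (\<lambda>x. G x - inv \<psi> f)"
  proof
    fix z
    have "factor_map k l (\<phi> z) f = \<psi> (G z - inv \<psi> f)"
      by (simp add: factor_map_def \<psi>_diff \<psi>_G \<psi>_inv f)
    then show "(inv \<psi> \<circ> (\<lambda>v. factor_map k l v f) \<circ> \<phi>) z = G z - inv \<psi> f" by simp
  qed
  moreover have "((\<lambda>x. G x - inv \<psi> f) has_derivative (\<lambda>v. J x *v v)) (at x)"
    using has_derivative_diff[OF G_derivative has_derivative_const] by simp
  ultimately have D: "frechet_derivative (inv \<psi> \<circ> (\<lambda>v. factor_map k l v f) \<circ> \<phi>) (at x) = (\<lambda>v. J x *v v)"
    using frechet_derivative_at by metis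
  have "inv \<psi> \<circ> partial_jacobian \<phi> \<psi> k l (\<phi> x) f \<circ> \<phi> = (\<lambda>v. J x *v v)"
    by (simp add: partial_jacobian_def derivative_map_def D fun_eq_iff)
  then have R: "matrix_rep \<phi> \<psi> (partial_jacobian \<phi> \<psi> k l (\<phi> x) f) = J x"
    by (simp add: matrix_rep_def matrix_of_matrix_vector_mul)
  have r: "rank (J x) = CARD('n) - k" using regular_rank[OF x] by simp
  have "is_rank_projection (CARD('n) - k) (J x) B \<longleftrightarrow> B = J x" for B
  proof
    assume "is_rank_projection (CARD('n) - k) (J x) B"
    then have "norm (J x - B) \<le> norm (J x - J x)" unfolding is_rank_projection_def using r by blast
    then show "B = J x" by simp
  qed (simp add: is_rank_projection_def r)
  then have "rank_projection (CARD('n) - k) (J x) = J x" by (simp add: rank_projection_def)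
  then show ?thesis by (simp add: rank_pinv_map_def R M_def)
qed

lemma dim_product_space: "arr.dim (product_space k U) = CARD('n)"
proof -
  interpret vector_space_pair "(*s) :: complex \<Rightarrow> complex^'n \<Rightarrow> complex^'n" arr_scale
    by unfold_locales
  have lin: "Vector_Spaces.linear (*s) arr_scale \<phi>" using iso_\<phi> by (simp add: isometric_iso_def)
  define B where "B = \<phi> ` cart_basis"
  have "arr.independent B" unfolding B_def
    using lin inj_\<phi> independent_cart_basis by (intro linear_independent_injective_image) (auto simp: vec.span_UNIV)
  moreover have "arr.span B = product_space k U"
    unfolding B_def using linear_span_image[OF lin, of cart_basis] span_cart_basis range_\<phi> by simp
  ultimately have "arr.dim (product_space k U) = card B" by (metis arr.dim_eq_card_independent arr.dim_span)
  also have "\<dots> = CARD('n)" unfolding B_def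
    by (subst card_image) (auto intro: inj_on_subset[OF inj_\<phi>] simp: card_cart_basis)
  finally show ?thesis .
qed

lemma ex_regular_ball:
  obtains \<rho> c where "\<rho> > 0" "c > 0" "\<And>x. x \<in> ball x_hat \<rho> \<Longrightarrow> norm (det (H x)) \<ge> c"
    "\<And>x. x \<in> ball x_hat \<rho> \<Longrightarrow> regular x"
proof -
  have cont: "isCont (\<lambda>x. det (H x)) x_hat"
  proof -
    have "bounded_lipschitz_on (ball x_hat 1) (\<lambda>x. det (H x))"
      by (intro bounded_lipschitz_on_det H_lipschitz) simp
    then obtain C where C: "\<And>x y. x \<in> ball x_hat 1 \<Longrightarrow> y \<in> ball x_hat 1 \<Longrightarrow> norm (det (H x) - det (H y)) \<le> C * norm (x - y)"
      unfolding bounded_lipschitz_on_def by blast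
    have "((\<lambda>x. det (H x) - det (H x_hat)) \<longlongrightarrow> 0) (at x_hat)"
    proof (rule Lim_null_comparison)
      have "\<forall>\<^sub>F x in at x_hat. x \<in> ball x_hat 1" by (intro eventually_at_in_open') auto
      then show "\<forall>\<^sub>F x in at x_hat. norm (det (H x) - det (H x_hat)) \<le> C * norm (x - x_hat)"
        by eventually_elim (simp add: C)
      have "((\<lambda>x. C * norm (x - x_hat)) \<longlongrightarrow> C * norm (x_hat - x_hat)) (at x_hat)" by (intro tendsto_intros)
      then show "((\<lambda>x. C * norm (x - x_hat)) \<longlongrightarrow> 0) (at x_hat)" by simp
    qed
    then show ?thesis unfolding isCont_def by (simp add: LIM_zero_iff)
  qed
  define c where "c = norm (det (H x_hat)) / 2"
  have d0: "det (H x_hat) \<noteq> 0" using invertible_H_x_hat by (simp add: invertible_det_nz)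
  have "\<forall>\<^sub>F x in nhds x_hat. norm (det (H x)) > c"
  proof -
    have "isCont (\<lambda>x. norm (det (H x))) x_hat" using cont by (intro continuous_intros)
    then have "((\<lambda>x. norm (det (H x))) \<longlongrightarrow> norm (det (H x_hat))) (nhds x_hat)"
      by (rule isCont_tendsto_nhds)
    then show ?thesis by (rule order_tendstoD(1)) (use d0 in \<open>simp add: c_def\<close>)
  qed
  moreover have "\<forall>\<^sub>F x in nhds x_hat. \<forall>j\<in>{1..k}. \<phi> x j \<noteq> 0"
  proof (rule eventually_ball_finite)
    show "\<forall>j\<in>{1..k}. \<forall>\<^sub>F x in nhds x_hat. \<phi> x j \<noteq> 0"
    proof
      fix j assume j: "j \<in> {1..k}"
      then have "u_hat j \<noteq> 0" using irreducible_factorization_nz[OF fac] by simp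
      \<comment> \<open>A nonzero polynomial has a nonzero coefficient, and that coefficient is a
        continuous complex function of \<open>x\<close>.\<close>
      then obtain m where m: "Poly_Mapping.lookup (u_hat j) m \<noteq> 0"
        by (metis poly_mapping_eqI lookup_zero)
      have "polynomial_fun (\<lambda>x. Poly_Mapping.lookup (\<phi> x j) m)"
        using coeffwise_polynomial_\<phi>[of j] unfolding coeffwise_polynomial_def by blast
      then obtain D where "((\<lambda>x. Poly_Mapping.lookup (\<phi> x j) m) has_derivative D) (at x_hat)"
        using polynomial_fun_derivative by blast
      then have "isCont (\<lambda>x. Poly_Mapping.lookup (\<phi> x j) m) x_hat"
        by (rule has_derivative_continuous)
      then have "\<forall>\<^sub>F x in nhds x_hat. Poly_Mapping.lookup (\<phi> x j) m \<noteq> 0"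
        using m by (intro tendsto_imp_eventually_ne[OF isCont_tendsto_nhds]) (simp_all add: \<phi>_x_hat)
      then show "\<forall>\<^sub>F x in nhds x_hat. \<phi> x j \<noteq> 0" by (rule eventually_mono) auto
    qed
  qed simp
  ultimately have "\<forall>\<^sub>F x in nhds x_hat. norm (det (H x)) > c \<and> (\<forall>j\<in>{1..k}. \<phi> x j \<noteq> 0)"
    by (rule eventually_conj)
  then obtain \<rho> where \<rho>: "\<rho> > 0" "\<And>x. dist x x_hat < \<rho> \<Longrightarrow> norm (det (H x)) > c \<and> (\<forall>j\<in>{1..k}. \<phi> x j \<noteq> 0)"
    unfolding eventually_nhds_metric by blast
  have c: "c > 0" using d0 by (simp add: c_def)
  show ?thesis
  proof (rule that[OF \<rho>(1) c])
    fix x assume x: "x \<in> ball x_hat \<rho>"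
    then have *: "norm (det (H x)) > c" "\<forall>j\<in>{1..k}. \<phi> x j \<noteq> 0" using \<rho>(2)[of x] by (auto simp: dist_commute)
    then show "norm (det (H x)) \<ge> c" by simp
    have "det (H x) \<noteq> 0" using * c by auto
    then show "regular x" using * by (simp add: regular_def invertible_det_nz)
  qed
qed

lemma M_lipschitz:
  assumes "c > 0" "\<And>x. x \<in> ball x_hat \<rho> \<Longrightarrow> norm (det (H x)) \<ge> c" "\<And>x. x \<in> ball x_hat \<rho> \<Longrightarrow> regular x"
  shows "bounded_lipschitz_on (ball x_hat \<rho>) (\<lambda>x. M x $ i $ j)"
proof -
  have "bounded_lipschitz_on (ball x_hat \<rho>) (\<lambda>x. (matrix_inv (H x) ** conj_transpose (J x)) $ i $ j)"
    unfolding matrix_matrix_mult_def conj_transpose_def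
    by (auto intro!: bounded_lipschitz_on_sum bounded_lipschitz_on_mult bounded_lipschitz_on_cnj
      bounded_lipschitz_on_matrix_inv[OF _ assms(1,2)] J_lipschitz H_lipschitz)
  then show ?thesis unfolding bounded_lipschitz_on_def by (simp add: M_formula assms(3))
qed

end

section \<open>Orbits of exact factor arrays\<close>

lemma inner_eq_Re_cinner: "inner x y = Re (cinner x y)"
  by (simp add: inner_vec_def cinner_def inner_complex_def)

lemma cinner_scale_right: "cinner x (c *s y) = cnj c * cinner x y"
  by (simp add: cinner_def sum_distrib_left mult_ac)

text \<open>The real product with \<open>\<i> *s y\<close> is the imaginary part of the Hermitian
  product with \<open>y\<close>, so two real conditions give complex orthogonality.\<close>

lemma cinner_eq_0I:
  assumes "inner x y = 0" "inner x (\<i> *s y) = 0"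
  shows "cinner x y = 0"
  using assms by (simp add: inner_eq_Re_cinner cinner_scale_right complex_eq_iff)

lemma bounded_linear_vector_scale: "bounded_linear (\<lambda>c. c *s (v :: complex^'n))"
proof -
  have "linear (\<lambda>c. c *s v)"
    by (intro linearI) (simp_all add: vec_eq_iff algebra_simps scaleR_conv_of_real[of _ "_ :: complex"])
  then show ?thesis by (simp add: linear_conv_bounded_linear)
qed

text \<open>The first-order condition for the squared distance along the curve; squaring avoids the
  point where the norm is not differentiable.\<close>

lemma inner_eq_0_of_local_min:
  fixes w :: "real \<Rightarrow> 'a::real_inner"
  assumes w: "(w has_vector_derivative v) (at 0)"
    and min: "\<forall>\<^sub>F s in nhds 0. norm (x - w 0) \<le> norm (x - w s)"
  shows "inner (x - w 0) v = 0"
proof -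
  define h where "h s = inner (x - w s) (x - w s)" for s
  have xw: "((\<lambda>s. x - w s) has_vector_derivative - v) (at 0)"
    using has_vector_derivative_diff[OF has_vector_derivative_const w] by simp
  have "(h has_vector_derivative (inner (x - w 0) (- v) + inner (- v) (x - w 0))) (at 0)"
    unfolding h_def by (rule bounded_bilinear.has_vector_derivative[OF bounded_bilinear_inner xw xw])
  then have "DERIV h 0 :> - 2 * inner (x - w 0) v"
    by (simp add: has_real_derivative_iff_has_vector_derivative inner_commute)
  moreover obtain d where d: "d > 0" "\<And>s. dist s 0 < d \<Longrightarrow> norm (x - w 0) \<le> norm (x - w s)"
    using min unfolding eventually_nhds_metric by blast
  have "h 0 \<le> h s" if "\<bar>0 - s\<bar> < d" for s
  proof -
    have "(norm (x - w 0))\<^sup>2 \<le> (norm (x - w s))\<^sup>2" using d(2)[of s] that by (intro power_mono) auto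
    then show ?thesis by (simp add: h_def power2_norm_eq_inner)
  qed
  ultimately have "- 2 * inner (x - w 0) v = 0" using DERIV_local_min[of h _ 0 d] d(1) by blast
  then show ?thesis by simp
qed

context factorization_setting
begin

definition component :: "nat \<Rightarrow> complex^'n" where
  "component j = inv \<phi> (\<lambda>i. if i = j then u_hat j else 0)"

lemma \<phi>_component: "j \<le> k \<Longrightarrow> \<phi> (component j) = (\<lambda>i. if i = j then u_hat j else 0)"
  unfolding component_def using u_hat
  by (intro \<phi>_inv) (auto simp: product_space_def intro: cp.subspace_0 subspace_U)

text \<open>Coordinates of an exact factor array. The scale of component 0 is computed from those of
  the others, so the orbit is parametrised by \<open>t 1\<close> to \<open>t k\<close>
  alone.\<close>

definition scaled :: "(nat \<Rightarrow> complex) \<Rightarrow> complex^'n" where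
  "scaled t = (\<Prod>j=1..k. inverse (t j) ^ l j) *s component 0 + (\<Sum>j=1..k. t j *s component j)"

lemma scaled_cong: "(\<And>j. j \<in> {1..k} \<Longrightarrow> s j = t j) \<Longrightarrow> scaled s = scaled t"
  unfolding scaled_def by simp

lemma \<phi>_scaled: "\<phi> (scaled t) i = cp_scale (if i = 0 then \<Prod>j=1..k. inverse (t j) ^ l j else t i) (u_hat i)"
proof -
  have "\<phi> (scaled t) = arr_scale (\<Prod>j=1..k. inverse (t j) ^ l j) (\<phi> (component 0)) + (\<Sum>j=1..k. arr_scale (t j) (\<phi> (component j)))"
    by (simp add: scaled_def \<phi>_add \<phi>_scale \<phi>_sum)
  also have "(\<Sum>j=1..k. arr_scale (t j) (\<phi> (component j))) = (\<Sum>j=1..k. arr_scale (t j) (\<lambda>i. if i = j then u_hat j else 0))"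
    by (intro sum.cong) (auto simp: \<phi>_component)
  finally have "\<phi> (scaled t) i = (if i = 0 then cp_scale (\<Prod>j=1..k. inverse (t j) ^ l j) (u_hat 0) else 0)
      + (\<Sum>j=1..k. arr_scale (t j) (\<lambda>i. if i = j then u_hat j else 0) i)"
    by (simp add: sum_array_apply \<phi>_component arr_scale_def)
  also have "(\<Sum>j=1..k. arr_scale (t j) (\<lambda>i. if i = j then u_hat j else 0) i)
      = (\<Sum>j=1..k. if j = i then cp_scale (t i) (u_hat i) else 0)"
    by (intro sum.cong) (auto simp: arr_scale_def)
  finally show ?thesis using u_hat by (auto simp: product_space_def)
qed

lemma scaled_1: "scaled (\<lambda>_. 1) = x_hat"
  by (intro injD[OF inj_\<phi>]) (auto simp: fun_eq_iff \<phi>_scaled \<phi>_x_hat)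

lemma scaled_in_factor_arrays:
  assumes "\<And>j. j \<in> {1..k} \<Longrightarrow> t j \<noteq> 0"
  shows "\<phi> (scaled t) \<in> factor_arrays k l u_hat"
  unfolding factor_arrays_def
proof (intro CollectI exI conjI)
  define s where "s = (\<lambda>i. if i = 0 then \<Prod>j=1..k. inverse (t j) ^ l j else t i)"
  show "\<phi> (scaled t) = (\<lambda>j. cp_scale (s j) (u_hat j))" by (simp add: fun_eq_iff \<phi>_scaled s_def)
  show "\<forall>j\<in>{1..k}. s j \<noteq> 0" using assms by (simp add: s_def)
  show "s 0 = (\<Prod>j=1..k. s j powi - int (l j))"
    by (auto simp: s_def power_int_minus power_inverse intro!: prod.cong)
qed

lemma G_scaled:
  assumes "\<And>j. j \<in> {1..k} \<Longrightarrow> t j \<noteq> 0"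
  shows "G (scaled t) = G x_hat"
proof (rule injD[OF inj_\<psi>])
  have "power_product k l (\<phi> (scaled t)) = Const (\<Prod>j=1..k. inverse (t j) ^ l j) * u_hat 0 * (\<Prod>j=1..k. Const (t j ^ l j) * u_hat j ^ l j)"
    unfolding power_product_def \<phi>_scaled by (simp add: cp_scale_def power_mult_distrib Const_power)
  also have "\<dots> = Const ((\<Prod>j=1..k. inverse (t j) ^ l j) * (\<Prod>j=1..k. t j ^ l j)) * power_product k l u_hat"
    by (simp add: prod.distrib Const_mult Const_prod power_product_def mult_ac)
  also have "(\<Prod>j=1..k. inverse (t j) ^ l j) * (\<Prod>j=1..k. t j ^ l j) = 1"
    unfolding prod.distrib[symmetric] using assms by (intro prod.neutral) (simp flip: power_mult_distrib)
  finally show "\<psi> (G (scaled t)) = \<psi> (G x_hat)" by (simp add: \<psi>_G \<phi>_x_hat Const_1)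
qed

lemma tvec_scaled:
  assumes j: "j \<in> {1..k}"
  shows "tvec j (scaled t) = (- of_nat (l j) * (\<Prod>j=1..k. inverse (t j) ^ l j)) *s component 0 + t j *s component j"
proof (rule injD[OF inj_\<phi>])
  have "0 \<le> k" "j \<le> k" using j by auto
  then show "\<phi> (tvec j (scaled t)) = \<phi> ((- of_nat (l j) * (\<Prod>j=1..k. inverse (t j) ^ l j)) *s component 0 + t j *s component j)"
    using j by (auto simp: \<phi>_tvec tangent_def \<phi>_add \<phi>_diff \<phi>_scale arr_scale_def \<phi>_component \<phi>_scaled fun_eq_iff)
qed

text \<open>Moving \<open>t j\<close> exponentially keeps it nonzero and multiplies the scale of
  component 0 by the exponential with rate \<open>- l j * \<omega>\<close>, so the velocity at 0 is
  exactly \<omega> times the tangent vector. The values 1 and \<open>\<i>\<close> of \<omega> give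
  both real directions.\<close>

lemma scaled_curve_derivative:
  assumes j: "j \<in> {1..k}" and t: "\<And>i. i \<in> {1..k} \<Longrightarrow> t i \<noteq> 0"
  shows "((\<lambda>s::real. scaled (t(j := t j * exp (\<omega> * of_real s)))) has_vector_derivative \<omega> *s tvec j (scaled t)) (at 0)"
proof -
  define q where "q = (\<Prod>j=1..k. inverse (t j) ^ l j)"
  define r where "r = (\<Sum>i\<in>{1..k} - {j}. t i *s component i)"
  have w: "scaled (t(j := t j * exp (\<omega> * of_real s)))
      = (q * exp (- of_nat (l j) * \<omega> * of_real s)) *s component 0 + (t j * exp (\<omega> * of_real s)) *s component j + r" for s :: real
  proof -
    have "(\<Prod>i=1..k. inverse ((t(j := t j * exp (\<omega> * of_real s))) i) ^ l i)
        = inverse (t j * exp (\<omega> * of_real s)) ^ l j * (\<Prod>i\<in>{1..k} - {j}. inverse (t i) ^ l i)"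
      using j by (simp add: prod.remove[of _ j])
    also have "inverse (t j * exp (\<omega> * of_real s)) ^ l j = inverse (t j) ^ l j * exp (- of_nat (l j) * \<omega> * of_real s)"
      by (simp add: power_mult_distrib exp_minus[symmetric] exp_of_nat_mult[symmetric] mult_ac)
    finally have 1: "(\<Prod>i=1..k. inverse ((t(j := t j * exp (\<omega> * of_real s))) i) ^ l i) = q * exp (- of_nat (l j) * \<omega> * of_real s)"
      using j by (simp add: q_def prod.remove[of _ j] mult_ac)
    have "(\<Sum>i=1..k. (t(j := t j * exp (\<omega> * of_real s))) i *s component i) = (t j * exp (\<omega> * of_real s)) *s component j + r"
      using j by (simp add: r_def sum.remove[of _ j])
    then show ?thesis unfolding scaled_def 1 by simp
  qed
  have e: "((\<lambda>s::real. b * exp (a * of_real s)) has_vector_derivative b * a) (at 0)" for a b :: complex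
  proof (rule has_vector_derivative_real_field)
    show "((\<lambda>z. b * exp (a * z)) has_field_derivative b * a) (at (of_real 0))"
      by (auto intro!: derivative_eq_intros)
  qed
  have "((\<lambda>s::real. (q * exp ((- of_nat (l j) * \<omega>) * of_real s)) *s component 0 + (t j * exp (\<omega> * of_real s)) *s component j + r)
     has_vector_derivative (q * (- of_nat (l j) * \<omega>)) *s component 0 + (t j * \<omega>) *s component j + 0) (at 0)"
    by (intro has_vector_derivative_add has_vector_derivative_const
        bounded_linear.has_vector_derivative[OF bounded_linear_vector_scale] e)
  moreover have "(q * (- of_nat (l j) * \<omega>)) *s component 0 + (t j * \<omega>) *s component j + 0 = \<omega> *s tvec j (scaled t)"
    by (simp add: tvec_scaled[OF j] q_def vec_eq_iff algebra_simps)
  ultimately show ?thesis unfolding w by simp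
qed

text \<open>A nonzero coefficient of \<open>u_hat j\<close> reads off \<open>t j - 1\<close>
  linearly from \<open>scaled t - x_hat\<close>. This is what will place the nearest point in the
  interior of the compact parameter set.\<close>

lemma scaled_near_imp_scale_near:
  obtains B where "B \<ge> 0" "\<And>t j. j \<in> {1..k} \<Longrightarrow> cmod (t j - 1) \<le> B * norm (scaled t - x_hat)"
proof -
  have "\<exists>B\<ge>0. \<forall>t. cmod (t j - 1) \<le> B * norm (scaled t - x_hat)" if j: "j \<in> {1..k}" for j
  proof -
    have "u_hat j \<noteq> 0" using irreducible_factorization_nz[OF fac] j by simp
    then obtain m where m: "Poly_Mapping.lookup (u_hat j) m \<noteq> 0" by (metis poly_mapping_eqI lookup_zero)
    define \<Lambda> where "\<Lambda> y = Poly_Mapping.lookup (\<phi> y j) m" for y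
    have "linear \<Lambda>"
      by (intro linearI) (simp_all add: \<Lambda>_def \<phi>_add lookup_add scaleR_eq_vector_scale \<phi>_scale arr_scale_def
          scaleR_conv_of_real[of _ "_ :: complex"])
    then have "bounded_linear \<Lambda>" by (simp add: linear_conv_bounded_linear)
    then obtain C where C: "C \<ge> 0" "\<And>y. norm (\<Lambda> y) \<le> norm y * C" using bounded_linear.nonneg_bounded by blast
    show ?thesis
    proof (intro exI[of _ "C / cmod (Poly_Mapping.lookup (u_hat j) m)"] conjI allI)
      fix t
      have "\<Lambda> (scaled t - x_hat) = (t j - 1) * Poly_Mapping.lookup (u_hat j) m"
        using j by (simp add: \<Lambda>_def \<phi>_diff \<phi>_scaled \<phi>_x_hat lookup_minus algebra_simps)
      then have "cmod (t j - 1) * cmod (Poly_Mapping.lookup (u_hat j) m) \<le> C * norm (scaled t - x_hat)"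
        using C(2)[of "scaled t - x_hat"] by (simp add: norm_mult mult.commute)
      then show "cmod (t j - 1) \<le> C / cmod (Poly_Mapping.lookup (u_hat j) m) * norm (scaled t - x_hat)"
        using m by (simp add: field_simps)
    qed (use C in simp)
  qed
  then obtain B where B: "\<And>j. j \<in> {1..k} \<Longrightarrow> B j \<ge> 0 \<and> (\<forall>t. cmod (t j - 1) \<le> B j * norm (scaled t - x_hat))"
    by metis
  show ?thesis
  proof (rule that[of "\<Sum>j=1..k. B j"])
    show "(\<Sum>j=1..k. B j) \<ge> 0" using B by (intro sum_nonneg) auto
    fix t j assume j: "j \<in> {1..k}"
    then have "cmod (t j - 1) \<le> B j * norm (scaled t - x_hat)" using B by blast
    also have "\<dots> \<le> (\<Sum>j=1..k. B j) * norm (scaled t - x_hat)"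
      using j B by (intro mult_right_mono member_le_sum) auto
    finally show "cmod (t j - 1) \<le> (\<Sum>j=1..k. B j) * norm (scaled t - x_hat)" .
  qed
qed

text \<open>
  A nearest array on the orbit differs from \<open>x\<close> by a vector orthogonal to the orbit, hence to the
  kernel of the Jacobian.  The scaling parameters are stored in the coordinates \<open>\<iota> j\<close> of a vector
  of \<open>complex^'n\<close>, which makes the parameter set compact.
\<close>

lemma ex_nearest_factor_array:
  obtains \<rho> where "\<rho> > 0" "\<And>x. x \<in> ball x_hat \<rho> \<Longrightarrow> \<exists>z. \<phi> z \<in> factor_arrays k l u_hat \<and>
     norm (x - z) \<le> norm (x - x_hat) \<and> G z = G x_hat \<and> (\<forall>j\<in>{1..k}. cinner (x - z) (tvec j z) = 0)"
proof -
  obtain B where B: "B \<ge> 0" "\<And>t j. j \<in> {1..k} \<Longrightarrow> cmod (t j - 1) \<le> B * norm (scaled t - x_hat)"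
    by (rule scaled_near_imp_scale_near) blast
  have "regular x_hat" using ex_regular_ball by (metis centre_in_ball)
  \<comment> \<open>There is room for the k parameters because the rank formula gives k at most
    \<open>CARD('n)\<close>.\<close>
  then have "card {1..k} \<le> CARD('n)" using regular_rank by simp
  then obtain \<iota> :: "nat \<Rightarrow> 'n" where \<iota>: "inj_on \<iota> {1..k}"
    using card_le_inj[of "{1..k}" "UNIV :: 'n set"] by auto
  \<comment> \<open>Discs of radius 1/2 around 1: compact, and away from the scale 0, where the
    orbit degenerates.\<close>
  define K :: "(complex^'n) set" where "K = {c. \<forall>i. dist (c $ i) 1 \<le> 1/2}"
  have K0: "c $ i \<noteq> 0" if "c \<in> K" for c i
  proof
    assume "c $ i = 0"
    moreover have "dist (c $ i) 1 \<le> 1/2" using that by (simp add: K_def)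
    ultimately show False by (simp add: dist_norm)
  qed
  have "compact K"
  proof -
    have "closed K" unfolding K_def by (intro closed_Collect_all closed_Collect_le continuous_intros)
    moreover have "bounded K"
      unfolding bounded_iff
    proof (intro exI ballI)
      fix c assume c: "c \<in> K"
      have "norm c \<le> (\<Sum>i\<in>UNIV. norm (c $ i))" unfolding norm_vec_def by (rule L2_set_le_sum) simp
      also have "\<dots> \<le> (\<Sum>i\<in>(UNIV :: 'n set). 3/2)"
      proof (rule sum_mono)
        fix i
        have "dist (c $ i) 1 \<le> 1/2" using c by (simp add: K_def)
        then show "norm (c $ i) \<le> 3/2" using norm_triangle_sub[of "c $ i" 1] by (simp add: dist_norm)
      qed
      finally show "norm c \<le> (\<Sum>i\<in>(UNIV :: 'n set). 3/2)" .
    qed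
    ultimately show ?thesis by (simp add: compact_eq_bounded_closed)
  qed
  define z where "z c = scaled (\<lambda>j. c $ \<iota> j)" for c :: "complex^'n"
  have contz: "continuous_on K z"
    unfolding z_def scaled_def using K0
    by (auto intro!: continuous_intros bounded_linear.continuous_on[OF bounded_linear_vector_scale])
  have one: "(\<chi> i. 1) \<in> K" "z (\<chi> i. 1) = x_hat"
    by (simp_all add: K_def z_def scaled_1)
  show ?thesis
  \<comment> \<open>The nearest array is at most twice as far from \<open>x_hat\<close> as
    \<open>x\<close> is, so this radius forces every \<open>t j\<close> to within less than 1/2 of 1
    and the minimum is not on the boundary of \<open>K\<close>.\<close>
  proof (rule that[of "1 / (4 * (B + 1))"])
    show "1 / (4 * (B + 1)) > 0" using B by simp
    fix x assume x: "x \<in> ball x_hat (1 / (4 * (B + 1)))"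
    have "continuous_on K (\<lambda>c. norm (x - z c))" by (intro continuous_intros contz)
    then obtain c where c: "c \<in> K" "\<And>c'. c' \<in> K \<Longrightarrow> norm (x - z c) \<le> norm (x - z c')"
      using continuous_attains_inf[OF \<open>compact K\<close>, of "\<lambda>c. norm (x - z c)"] one by blast
    define t where "t = (\<lambda>j. c $ \<iota> j)"
    have zc: "z c = scaled t" by (simp add: z_def t_def)
    have t0: "t j \<noteq> 0" for j using K0[OF c(1)] by (simp add: t_def)
    have le: "norm (x - z c) \<le> norm (x - x_hat)" using c(2)[OF one(1)] one(2) by simp
    have int: "cmod (t j - 1) < 1/2" if j: "j \<in> {1..k}" for j
    proof -
      have "norm (z c - x_hat) \<le> norm (x - x_hat) + norm (x - z c)"
        using norm_triangle_ineq4[of "x - x_hat" "x - z c"] by simp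
      also have "\<dots> \<le> 2 * norm (x - x_hat)" using le by simp
      also have "\<dots> < 2 * (1 / (4 * (B + 1)))" using x by (simp add: dist_norm norm_minus_commute)
      also have "2 * (1 / (4 * (B + 1))) = 1 / (2 * (B + 1))" using B(1) by (simp add: field_simps)
      finally have "norm (z c - x_hat) \<le> 1 / (2 * (B + 1))" by simp
      then have "B * norm (z c - x_hat) \<le> B * (1 / (2 * (B + 1)))" using B(1) by (intro mult_left_mono)
      also have "\<dots> < 1 / 2" using B(1) by (simp add: field_simps)
      finally show ?thesis using B(2)[OF j, of t] by (simp add: zc)
    qed
    have orth: "inner (x - z c) (\<omega> *s tvec j (z c)) = 0" if j: "j \<in> {1..k}" for j \<omega>
    proof -
      define w where "w s = scaled (t(j := t j * exp (\<omega> * of_real s)))" for s :: real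
      have w0: "w 0 = z c" by (simp add: w_def zc)
      have "\<forall>\<^sub>F s in nhds 0. norm (x - w 0) \<le> norm (x - w s)"
      proof -
        have "isCont (\<lambda>s::real. cmod (t j * exp (\<omega> * of_real s) - 1)) 0" by (intro continuous_intros)
        then have "((\<lambda>s::real. cmod (t j * exp (\<omega> * of_real s) - 1)) \<longlongrightarrow> cmod (t j - 1)) (nhds 0)"
          using isCont_tendsto_nhds by fastforce
        then have "\<forall>\<^sub>F s::real in nhds 0. cmod (t j * exp (\<omega> * of_real s) - 1) < 1/2"
          by (rule order_tendstoD(2)) (rule int[OF j])
        then show ?thesis
        proof eventually_elim
          case (elim s)
          \<comment> \<open>Only the parameter of index \<open>j\<close> moves. Strictness of the
            bound keeps it in its disc for small \<open>s\<close>, and injectivity of \<iota> leaves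
            the other scales alone.\<close>
          define c' where "c' = (\<chi> i. if i = \<iota> j then t j * exp (\<omega> * of_real s) else c $ i)"
          have "c' \<in> K" using c(1) elim by (auto simp: K_def c'_def dist_norm)
          moreover have "z c' = w s"
            unfolding z_def w_def using \<iota> j
            by (intro scaled_cong) (auto simp: c'_def t_def dest: inj_onD)
          ultimately show ?case using c(2)[of c'] by (simp add: w0)
        qed
      qed
      moreover have "(w has_vector_derivative \<omega> *s tvec j (z c)) (at 0)"
        unfolding w_def zc using scaled_curve_derivative[OF j t0] .
      ultimately show ?thesis using inner_eq_0_of_local_min[of w] by (simp add: w0)
    qed
    have "cinner (x - z c) (tvec j (z c)) = 0" if "j \<in> {1..k}" for j
      using orth[OF that, of 1] orth[OF that, of \<i>] by (intro cinner_eq_0I) simp_all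
    moreover have "\<phi> (z c) \<in> factor_arrays k l u_hat" "G (z c) = G x_hat"
      unfolding zc using t0 by (auto intro: scaled_in_factor_arrays G_scaled)
    ultimately show "\<exists>z. \<phi> z \<in> factor_arrays k l u_hat \<and>
       norm (x - z) \<le> norm (x - x_hat) \<and> G z = G x_hat \<and> (\<forall>j\<in>{1..k}. cinner (x - z) (tvec j z) = 0)"
      using le by blast
  qed
qed

section \<open>Convergence of the iteration\<close>

abbreviation "cond \<equiv> factorization_condition_number \<phi> \<psi> k l (CARD('n) - k) nU P nP u_hat p"

lemma p_in: "p \<in> P"
  using \<psi>_in[of "G x_hat"] by (simp add: \<psi>_G_x_hat)

lemma regular_x_hat: "regular x_hat"
  using ex_regular_ball by (metis centre_in_ball)

text \<open>Positivity is what \<open>gauss_newton_convergence\<close> asks of \<kappa>. If the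
  condition number were not positive, \<open>M x_hat\<close> would vanish and with it
  \<open>J x_hat\<close>, by \<open>J ** M ** J = J\<close>; but the derivative in the direction of
  component 0 alone is \<open>p\<close>, which is nonzero.\<close>

lemma norm_M_x_hat_le: "norm (M x_hat *v w) \<le> cond * norm w"
  and cond_pos: "cond > 0"
proof -
  define T where "T = rank_pinv_map \<phi> \<psi> (CARD('n) - k) (partial_jacobian \<phi> \<psi> k l u_hat p)"
  define L where "L = (\<Sum>i\<in>UNIV. \<Sum>j\<in>UNIV. norm (M x_hat $ i $ j))"
  have T: "product_norm k nU (T (\<psi> w)) = norm (M x_hat *v w)" for w
    using rank_pinv_map_eq[OF regular_x_hat p_in \<psi>_in, of w] by (simp add: T_def \<phi>_x_hat norm_\<phi>)
  have L: "norm (M x_hat *v w) \<le> L * norm w" for w unfolding L_def by (rule norm_matrix_vector_le)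
  have "L \<ge> 0" unfolding L_def by (intro sum_nonneg) auto
  have cond: "cond = (SUP v\<in>{v \<in> P. nP v \<le> 1}. product_norm k nU (T v))"
    by (simp add: factorization_condition_number_def operator_norm_on_def T_def)
  have bdd: "bdd_above ((\<lambda>v. product_norm k nU (T v)) ` {v \<in> P. nP v \<le> 1})"
  proof (rule bdd_aboveI2)
    fix v assume "v \<in> {v \<in> P. nP v \<le> 1}"
    then obtain w where w: "v = \<psi> w" "norm w \<le> 1" using \<psi>_inv norm_\<psi> by (metis (mono_tags, lifting) mem_Collect_eq)
    have "product_norm k nU (T v) \<le> L * norm w" using L T w by simp
    also have "\<dots> \<le> L * 1" using w \<open>L \<ge> 0\<close> by (intro mult_left_mono)
    finally show "product_norm k nU (T v) \<le> L * 1" .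
  qed
  have le: "norm (M x_hat *v w) \<le> cond * norm w" for w
  proof (cases "w = 0")
    case False
    define e where "e = complex_of_real (1 / norm w) *s w"
    have e: "e = (1 / norm w) *\<^sub>R w" by (simp add: e_def scaleR_eq_vector_scale)
    have "norm e = 1" using False by (simp add: e)
    then have "\<psi> e \<in> {v \<in> P. nP v \<le> 1}" by (simp add: \<psi>_in norm_\<psi>)
    then have "product_norm k nU (T (\<psi> e)) \<le> cond" unfolding cond using bdd by (rule cSUP_upper)
    moreover have "M x_hat *v e = (1 / norm w) *\<^sub>R (M x_hat *v w)"
      by (simp add: e_def matrix_vector_scale scaleR_eq_vector_scale)
    ultimately have "norm (M x_hat *v w) / norm w \<le> cond" by (simp add: T)
    then show ?thesis using False by (simp add: field_simps)
  qed simp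
  then show "norm (M x_hat *v w) \<le> cond * norm w" .
  show "cond > 0"
  proof (rule ccontr)
    assume "\<not> cond > 0"
    then have "cond * norm w \<le> 0" for w :: "complex^'m" by (simp add: mult_nonpos_nonneg)
    then have "norm (M x_hat *v w) \<le> 0" for w using le[of w] order.trans by blast
    then have "M x_hat *v w = 0" for w by simp
    then have "M x_hat ** J x_hat *v v = 0" for v by (simp flip: matrix_vector_mul_assoc)
    then have "J x_hat ** M x_hat ** J x_hat *v v = 0" for v
      by (simp add: matrix_mul_assoc[symmetric]) (simp flip: matrix_vector_mul_assoc)
    then have J0: "J x_hat *v component 0 = 0" using JMJ[OF regular_x_hat] by simp
    have "jac k l u_hat (\<lambda>i. if i = 0 then u_hat 0 else 0) = power_product k l u_hat"
      unfolding jac_def power_product_def by (auto intro!: sum.neutral)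
    then have "p = 0"
      using \<psi>_J[of x_hat "component 0"] J0 fac
      by (simp add: \<phi>_component \<phi>_x_hat \<psi>_0 irreducible_factorization_def)
    moreover have "p \<noteq> 0" using fac irreducible_factorization_nz[OF fac]
      by (simp add: irreducible_factorization_def power_product_def)
    ultimately show False by simp
  qed
qed

lemma newton_step_eq:
  assumes "regular x" "f \<in> P"
  shows "newton_step \<phi> \<psi> k l (CARD('n) - k) f (\<phi> x) = \<phi> (x - M x *v (G x - inv \<psi> f))"
proof -
  have "factor_map k l (\<phi> x) f = \<psi> (G x - inv \<psi> f)"
    by (simp add: factor_map_def \<psi>_diff \<psi>_G \<psi>_inv assms)
  then show ?thesis
    using rank_pinv_map_eq[OF assms \<psi>_in, of "G x - inv \<psi> f"] by (simp add: newton_step_def \<phi>_diff)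
qed

lemma newton_convergence:
  "\<exists>\<delta> \<epsilon>. \<delta> > 0 \<and> \<epsilon> > 0 \<and>
    (\<forall>p_tilde\<in>P. \<forall>u_init\<in>product_space k U.
       nP (p_tilde - p) < \<delta> \<longrightarrow> product_norm k nU (u_init - u_hat) < \<epsilon> \<longrightarrow>
       (\<exists>u_tilde\<in>product_space k U.
          (\<lambda>j. product_norm k nU (newton_iterate \<phi> \<psi> k l (CARD('n) - k) p_tilde u_init j - u_tilde)) \<longlonglongrightarrow> 0 \<and>
          (\<exists>u_check\<in>factor_arrays k l u_hat.
             product_norm k nU (u_tilde - u_check) \<le> 4 * cond * nP (p_tilde - p)) \<and>
          (p_tilde = p \<longrightarrow>
             (\<exists>C. \<forall>j. product_norm k nU (newton_iterate \<phi> \<psi> k l (CARD('n) - k) p u_init (Suc j) - u_tilde)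
                     \<le> C * (product_norm k nU (newton_iterate \<phi> \<psi> k l (CARD('n) - k) p u_init j - u_tilde))\<^sup>2))))"
proof -
  obtain \<rho>1 c where \<rho>1: "\<rho>1 > 0" "c > 0" "\<And>x. x \<in> ball x_hat \<rho>1 \<Longrightarrow> norm (det (H x)) \<ge> c"
    "\<And>x. x \<in> ball x_hat \<rho>1 \<Longrightarrow> regular x" by (rule ex_regular_ball) blast
  obtain \<rho>2 where \<rho>2: "\<rho>2 > 0" "\<And>x. x \<in> ball x_hat \<rho>2 \<Longrightarrow> \<exists>z. \<phi> z \<in> factor_arrays k l u_hat \<and>
     norm (x - z) \<le> norm (x - x_hat) \<and> G z = G x_hat \<and> (\<forall>j\<in>{1..k}. cinner (x - z) (tvec j z) = 0)"
    by (rule ex_nearest_factor_array) blast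
  define \<rho> where "\<rho> = min \<rho>1 \<rho>2"
  have \<rho>: "\<rho> > 0" "ball x_hat \<rho> \<subseteq> ball x_hat \<rho>1" "ball x_hat \<rho> \<subseteq> ball x_hat \<rho>2"
    using \<rho>1 \<rho>2 by (auto simp: \<rho>_def)
  have reg: "regular x" if "x \<in> ball x_hat \<rho>" for x using that \<rho>(2) \<rho>1(4) by blast
  have "bounded_lipschitz_on (ball x_hat \<rho>) (\<lambda>x. J x $ i $ j)" for i j by (rule J_lipschitz) simp
  then obtain LJ where LJ: "LJ \<ge> 0" "\<And>x w. x \<in> ball x_hat \<rho> \<Longrightarrow> norm (J x *v w) \<le> LJ * norm w"
    "\<And>x y w. x \<in> ball x_hat \<rho> \<Longrightarrow> y \<in> ball x_hat \<rho> \<Longrightarrow> norm (J x *v w - J y *v w) \<le> LJ * norm (x - y) * norm w"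
    by (rule bounded_lipschitz_on_matrix) blast
  have "bounded_lipschitz_on (ball x_hat \<rho>) (\<lambda>x. M x $ i $ j)" for i j
    using M_lipschitz[OF \<rho>1(2-4)] \<rho>(2) by (rule bounded_lipschitz_on_subset)
  then obtain LM where LM: "LM \<ge> 0" "\<And>x w. x \<in> ball x_hat \<rho> \<Longrightarrow> norm (M x *v w) \<le> LM * norm w"
    "\<And>x y w. x \<in> ball x_hat \<rho> \<Longrightarrow> y \<in> ball x_hat \<rho> \<Longrightarrow> norm (M x *v w - M y *v w) \<le> LM * norm (x - y) * norm w"
    by (rule bounded_lipschitz_on_matrix) blast
  define L where "L = 1 + LJ + LM"
  have L: "L \<ge> 1" "LJ \<le> L" "LM \<le> L" using LJ(1) LM(1) by (simp_all add: L_def)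
  have up: "a \<le> L * b * d" if "a \<le> K * b * d" "K \<le> L" "b \<ge> 0" "d \<ge> 0" for a b d K :: real
  proof -
    have "K * b * d \<le> L * b * d" using that by (intro mult_right_mono) auto
    then show ?thesis using that(1) by simp
  qed
  define Z where "Z = {z. \<phi> z \<in> factor_arrays k l u_hat}"
  have "\<exists>\<delta>>0. \<exists>\<epsilon>>0. \<forall>y X. norm (y - G x_hat) < \<delta> \<longrightarrow> norm (X 0 - x_hat) < \<epsilon> \<longrightarrow>
      (\<forall>j. X (Suc j) = X j - M (X j) *v (G (X j) - y)) \<longrightarrow>
      (\<forall>j. X j \<in> ball x_hat \<rho>) \<and>
      (\<exists>l. X \<longlonglongrightarrow> l \<and> (\<exists>z\<in>Z. norm (l - z) \<le> 4 * cond * norm (y - G x_hat)) \<and>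
         (y = G x_hat \<longrightarrow> (\<exists>C. \<forall>j. norm (X (Suc j) - l) \<le> C * (norm (X j - l))\<^sup>2)))"
  proof (rule gauss_newton_convergence[where J = "\<lambda>x v. J x *v v" and M = "\<lambda>x w. M x *v w" and L = L])
    show "norm (J x *v v) \<le> L * norm v" if "x \<in> ball x_hat \<rho>" for x v
      using up[of _ LJ 1] LJ(2)[OF that] L by simp
    show "norm (M x *v w) \<le> L * norm w" if "x \<in> ball x_hat \<rho>" for x w
      using up[of _ LM 1] LM(2)[OF that] L by simp
    show "norm (J x *v v - J y *v v) \<le> L * norm (x - y) * norm v" if "x \<in> ball x_hat \<rho>" "y \<in> ball x_hat \<rho>" for x y v
      by (rule up[OF LJ(3)[OF that]]) (use L in auto)
    show "norm (M x *v v - M y *v v) \<le> L * norm (x - y) * norm v" if "x \<in> ball x_hat \<rho>" "y \<in> ball x_hat \<rho>" for x y v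
      by (rule up[OF LM(3)[OF that]]) (use L in auto)
    show "M x *v (J x *v (M x *v w)) = M x *v w" if "x \<in> ball x_hat \<rho>" for x w
      using MJM[OF reg[OF that]] by (simp add: matrix_vector_mul_assoc matrix_mul_assoc)
    show "linear (\<lambda>w. M x *v w)" for x
      by (intro linearI) (simp_all add: matrix_vector_right_distrib scaleR_eq_vector_scale matrix_vector_scale)
    show "\<exists>z\<in>Z. norm (x - z) \<le> norm (x - x_hat) \<and> G z = G x_hat \<and>
        (z \<in> ball x_hat \<rho> \<longrightarrow> M z *v (J z *v (x - z)) = x - z)" if x: "x \<in> ball x_hat \<rho>" for x
    proof -
      obtain z where "\<phi> z \<in> factor_arrays k l u_hat" "norm (x - z) \<le> norm (x - x_hat)" "G z = G x_hat"
        "\<And>j. j \<in> {1..k} \<Longrightarrow> cinner (x - z) (tvec j z) = 0" using \<rho>2(2)[of x] \<rho>(3) x by blast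
      then show ?thesis using MJ_orthogonal[OF reg] by (intro bexI[of _ z]) (auto simp: Z_def)
    qed
  qed (use \<rho>(1) L cond_pos G_derivative norm_M_x_hat_le in auto)
  then obtain \<delta> \<epsilon> where \<delta>: "\<delta> > 0" "\<epsilon> > 0"
    and conv: "\<And>y X. norm (y - G x_hat) < \<delta> \<Longrightarrow> norm (X 0 - x_hat) < \<epsilon> \<Longrightarrow>
      (\<forall>j. X (Suc j) = X j - M (X j) *v (G (X j) - y)) \<Longrightarrow>
      (\<forall>j. X j \<in> ball x_hat \<rho>) \<and>
      (\<exists>l. X \<longlonglongrightarrow> l \<and> (\<exists>z\<in>Z. norm (l - z) \<le> 4 * cond * norm (y - G x_hat)) \<and>
         (y = G x_hat \<longrightarrow> (\<exists>C. \<forall>j. norm (X (Suc j) - l) \<le> C * (norm (X j - l))\<^sup>2)))"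
    by blast
  show ?thesis
  proof (rule exI[of _ \<delta>], rule exI[of _ \<epsilon>], intro conjI ballI impI)
    fix p_tilde u_init
    assume pt: "p_tilde \<in> P" and ui: "u_init \<in> product_space k U"
      and close: "nP (p_tilde - p) < \<delta>" "product_norm k nU (u_init - u_hat) < \<epsilon>"
    define y where "y = inv \<psi> p_tilde"
    define X where "X j = ((\<lambda>x. x - M x *v (G x - y)) ^^ j) (inv \<phi> u_init)" for j
    have nP: "nP (p_tilde - p) = norm (y - G x_hat)"
      using norm_\<psi>[of "y - G x_hat"] by (simp add: \<psi>_diff y_def \<psi>_inv pt \<psi>_G_x_hat)
    have "product_norm k nU (u_init - u_hat) = norm (X 0 - x_hat)"
      using norm_\<phi>[of "X 0 - x_hat"] by (simp add: \<phi>_diff X_def \<phi>_inv ui \<phi>_x_hat)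
    moreover have rec: "\<forall>j. X (Suc j) = X j - M (X j) *v (G (X j) - y)" by (simp add: X_def)
    ultimately obtain lim where ball: "\<And>j. X j \<in> ball x_hat \<rho>" and lim: "X \<longlonglongrightarrow> lim"
      and bound: "\<exists>z\<in>Z. norm (lim - z) \<le> 4 * cond * norm (y - G x_hat)"
      and quad: "y = G x_hat \<Longrightarrow> \<exists>C. \<forall>j. norm (X (Suc j) - lim) \<le> C * (norm (X j - lim))\<^sup>2"
      using conv[of y X] close nP by auto
    \<comment> \<open>The given iteration agrees with the one in coordinates only at regular points,
      so the conclusion that all iterates stay in the ball is used at every step.\<close>
    have iter: "newton_iterate \<phi> \<psi> k l (CARD('n) - k) p_tilde u_init j = \<phi> (X j)" for j
    proof (induction j)
      case 0
      then show ?case by (simp add: newton_iterate_def X_def \<phi>_inv ui)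
    next
      case (Suc j)
      have "newton_iterate \<phi> \<psi> k l (CARD('n) - k) p_tilde u_init (Suc j) = newton_step \<phi> \<psi> k l (CARD('n) - k) p_tilde (\<phi> (X j))"
        using Suc by (simp add: newton_iterate_def)
      then show ?case using newton_step_eq[OF reg[OF ball] pt] rec by (simp add: y_def)
    qed
    have dist: "product_norm k nU (newton_iterate \<phi> \<psi> k l (CARD('n) - k) p_tilde u_init j - \<phi> lim) = norm (X j - lim)" for j
      by (simp add: iter norm_\<phi> flip: \<phi>_diff)
    show "\<exists>u_tilde\<in>product_space k U.
          (\<lambda>j. product_norm k nU (newton_iterate \<phi> \<psi> k l (CARD('n) - k) p_tilde u_init j - u_tilde)) \<longlonglongrightarrow> 0 \<and>
          (\<exists>u_check\<in>factor_arrays k l u_hat.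
             product_norm k nU (u_tilde - u_check) \<le> 4 * cond * nP (p_tilde - p)) \<and>
          (p_tilde = p \<longrightarrow>
             (\<exists>C. \<forall>j. product_norm k nU (newton_iterate \<phi> \<psi> k l (CARD('n) - k) p u_init (Suc j) - u_tilde)
                     \<le> C * (product_norm k nU (newton_iterate \<phi> \<psi> k l (CARD('n) - k) p u_init j - u_tilde))\<^sup>2))"
    proof (rule bexI[of _ "\<phi> lim"], intro conjI impI)
      have "(\<lambda>j. norm (X j - lim)) \<longlonglongrightarrow> norm (lim - lim)" using lim by (intro tendsto_intros)
      then show "(\<lambda>j. product_norm k nU (newton_iterate \<phi> \<psi> k l (CARD('n) - k) p_tilde u_init j - \<phi> lim)) \<longlonglongrightarrow> 0"
        by (simp add: dist)
      obtain z where "\<phi> z \<in> factor_arrays k l u_hat" "norm (lim - z) \<le> 4 * cond * norm (y - G x_hat)"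
        using bound by (auto simp: Z_def)
      then show "\<exists>u_check\<in>factor_arrays k l u_hat. product_norm k nU (\<phi> lim - u_check) \<le> 4 * cond * nP (p_tilde - p)"
        by (intro bexI[of _ "\<phi> z"]) (simp_all add: nP norm_\<phi> flip: \<phi>_diff)
      assume eq: "p_tilde = p"
      then have "y = G x_hat" using inv_\<psi>[of "G x_hat"] by (simp add: y_def \<psi>_G_x_hat)
      then show "\<exists>C. \<forall>j. product_norm k nU (newton_iterate \<phi> \<psi> k l (CARD('n) - k) p u_init (Suc j) - \<phi> lim)
                     \<le> C * (product_norm k nU (newton_iterate \<phi> \<psi> k l (CARD('n) - k) p u_init j - \<phi> lim))\<^sup>2"
        using quad dist unfolding eq by simp
    qed (rule \<phi>_in)
  qed (use \<delta> in auto)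
qed

end

theorem theorem3:
  shows "\<exists>\<alpha>>0.
    \<forall>(k::nat) (l::nat \<Rightarrow> nat) (p::cpoly) (u_hat::cpoly_array)
      (U::nat \<Rightarrow> cpoly set) (nU::nat \<Rightarrow> cpoly \<Rightarrow> real) (P::cpoly set) (nP::cpoly \<Rightarrow> real)
      (\<phi>::complex^'n \<Rightarrow> cpoly_array) (\<psi>::complex^'m \<Rightarrow> cpoly) (r::nat).
      u_hat \<in> product_space k U \<longrightarrow>
      irreducible_factorization p k l u_hat \<longrightarrow>
      (\<forall>j\<le>k. proper_hosting_space (U j) (u_hat j)) \<longrightarrow>
      U 0 = range Const \<longrightarrow>
      (\<forall>j\<le>k. euclidean_on (U j) (nU j)) \<longrightarrow>
      p \<in> P \<longrightarrow>
      (\<forall>u\<in>product_space k U. power_product k l u \<in> P) \<longrightarrow>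
      isometric_iso arr_scale (product_norm k nU) (product_space k U) \<phi> \<longrightarrow>
      isometric_iso cp_scale nP P \<psi> \<longrightarrow>
      r = arr.dim (product_space k U) - k \<longrightarrow>
      (\<exists>K \<delta> \<epsilon>. \<delta> > 0 \<and> \<epsilon> > 0 \<and>
        (\<forall>p_tilde\<in>P. \<forall>u_init\<in>product_space k U.
           nP (p_tilde - p) < \<delta> \<longrightarrow> product_norm k nU (u_init - u_hat) < \<epsilon> \<longrightarrow>
           (\<exists>u_tilde\<in>product_space k U.
              (\<lambda>j. product_norm k nU (newton_iterate \<phi> \<psi> k l r p_tilde u_init j - u_tilde))
                 \<longlonglongrightarrow> 0 \<and>
              (\<exists>u_check\<in>factor_arrays k l u_hat.
                 product_norm k nU (u_tilde - u_check)
                   \<le> \<alpha> * factorization_condition_number \<phi> \<psi> k l r nU P nP u_hat p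
                         * nP (p_tilde - p)
                      + K * (nP (p_tilde - p))\<^sup>2) \<and>
              (p_tilde = p \<longrightarrow>
                 (\<exists>C. \<forall>j. product_norm k nU (newton_iterate \<phi> \<psi> k l r p u_init (Suc j) - u_tilde)
                         \<le> C * (product_norm k nU
                                 (newton_iterate \<phi> \<psi> k l r p u_init j - u_tilde))\<^sup>2)))))"
proof (rule exI[of _ 4], rule conjI, simp, intro allI impI)
  fix k l p u_hat U nU P nP r and \<phi> :: "complex^'n \<Rightarrow> cpoly_array" and \<psi> :: "complex^'m \<Rightarrow> cpoly"
  assume "u_hat \<in> product_space k U" "irreducible_factorization p k l u_hat"
    "\<forall>j\<le>k. proper_hosting_space (U j) (u_hat j)" "U 0 = range Const"
    "\<forall>u\<in>product_space k U. power_product k l u \<in> P"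
    "isometric_iso arr_scale (product_norm k nU) (product_space k U) \<phi>" "isometric_iso cp_scale nP P \<psi>"
    and r: "r = arr.dim (product_space k U) - k"
  then interpret factorization_setting k l p u_hat U nU P nP \<phi> \<psi>
    by unfold_locales auto
  have r': "r = CARD('n) - k" using r dim_product_space by simp
  show "\<exists>K \<delta> \<epsilon>. \<delta> > 0 \<and> \<epsilon> > 0 \<and>
        (\<forall>p_tilde\<in>P. \<forall>u_init\<in>product_space k U.
           nP (p_tilde - p) < \<delta> \<longrightarrow> product_norm k nU (u_init - u_hat) < \<epsilon> \<longrightarrow>
           (\<exists>u_tilde\<in>product_space k U.
              (\<lambda>j. product_norm k nU (newton_iterate \<phi> \<psi> k l r p_tilde u_init j - u_tilde))
                 \<longlonglongrightarrow> 0 \<and>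
              (\<exists>u_check\<in>factor_arrays k l u_hat.
                 product_norm k nU (u_tilde - u_check)
                   \<le> 4 * factorization_condition_number \<phi> \<psi> k l r nU P nP u_hat p
                         * nP (p_tilde - p)
                      + K * (nP (p_tilde - p))\<^sup>2) \<and>
              (p_tilde = p \<longrightarrow>
                 (\<exists>C. \<forall>j. product_norm k nU (newton_iterate \<phi> \<psi> k l r p u_init (Suc j) - u_tilde)
                         \<le> C * (product_norm k nU
                                 (newton_iterate \<phi> \<psi> k l r p u_init j - u_tilde))\<^sup>2))))"
    by (rule exI[of _ 0]) (use newton_convergence in \<open>simp add: r'\<close>)
qed

end
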